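(* For $n$ a positive integer and $N=2n+1$, \begin{equation*} \sum_{\boldsymbol{m}\in\mathbb N^{N-1}} \frac{q^{\frac{1}{2}\boldsymbol{m} C \boldsymbol{m}^t+|\boldsymbol{m}|_{-}}}{(q)_{\boldsymbol{m}}} =\frac{1}{(q)_{\infty}^{2n^2+n}} \sum \chi(\boldsymbol{v}/\boldsymbol{\rho}^{\ast}) q^{\tfrac{||\boldsymbol{v}||^2-||\boldsymbol{\rho}^{\ast}+1||^2}{4(n+2)}}, \end{equation*} where the sum on the right is over $\boldsymbol{v}\in \mathbb Z^n$ such that $v_i\equiv \rho_i^{\ast}+1\pmod{2n+4}$.
   Context: Notation: $(a)_m=(a;q)_m=\prod_{i=1}^m(1-aq^{i-1})$ for $m\in\mathbb N\cup\{\infty\}$, $\mathbb N=\{0,1,2,\dots\}$; $(q)_{\boldsymbol{m}}=(q)_{m_1}\cdots(q)_{m_{N-1}}$. $C$ is the Cartan matrix of $\textup{A}_{N-1}$, so $\frac{1}{2}\boldsymbol{m} C\boldsymbol{m}^t=\sum_{i=1}^{N-1}m_i^2-\sum_{i=1}^{N-2}m_im_{i+1}$, and $|\boldsymbol{m}|_{-}=\sum_{i=1}^{N-1}(-1)^{i-1}m_i$. $\boldsymbol{\rho}^{\ast}=(1,2,\dots,n)$, $\boldsymbol{\rho}^{\ast}+1=(2,3,\dots,n+1)$, $||\boldsymbol{v}||^2=v_1^2+\cdots+v_n^2$, and $\chi(\boldsymbol{v}/\boldsymbol{w})=\prod_{i=1}^n \frac{v_i}{w_i}\prod_{1\leq i<j\leq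 n} \frac{v_i^2-v_j^2}{w_i^2-w_j^2}$. *)

theory Defs
  imports "HOL-Analysis.Analysis" "HOL-Number_Theory.Cong"
begin

(* Vectors of length k are functions on the index set {1..k} that are undefined elsewhere
   (elements of PiE {1..k} _), so that distinct functions are distinct vectors. *)

abbreviation nat_vecs :: "nat \<Rightarrow> (nat \<Rightarrow> nat) set" where
  "nat_vecs k \<equiv> PiE {1..k} (\<lambda>_. UNIV)"

abbreviation int_vecs :: "nat \<Rightarrow> (nat \<Rightarrow> int) set" where
  "int_vecs k \<equiv> PiE {1..k} (\<lambda>_. UNIV)"

definition qpoch :: "complex \<Rightarrow> complex \<Rightarrow> nat \<Rightarrow> complex" where
  "qpoch a q m = (\<Prod>i=1..m. 1 - a * q ^ (i - 1))"

(* The index of prodinf starts at 0, so the factor 1 - a q^(i-1) is reindexed. *)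
definition qpoch_inf :: "complex \<Rightarrow> complex \<Rightarrow> complex" where
  "qpoch_inf a q = (\<Prod>i. 1 - a * q ^ i)"

definition qpoch_vec :: "nat \<Rightarrow> complex \<Rightarrow> (nat \<Rightarrow> nat) \<Rightarrow> complex" where
  "qpoch_vec k q m = (\<Prod>i=1..k. qpoch q q (m i))"

definition cartan_A :: "nat \<Rightarrow> nat \<Rightarrow> int" where
  "cartan_A i j = (if i = j then 2 else if i = j + 1 \<or> j = i + 1 then -1 else 0)"

definition cartan_form :: "nat \<Rightarrow> (nat \<Rightarrow> nat) \<Rightarrow> int" where
  "cartan_form k m = (\<Sum>i=1..k. \<Sum>j=1..k. int (m i) * cartan_A i j * int (m j))"

definition alt_sum :: "nat \<Rightarrow> (nat \<Rightarrow> nat) \<Rightarrow> int" where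
  "alt_sum k m = (\<Sum>i=1..k. (-1) ^ (i - 1) * int (m i))"

definition rho_star :: "nat \<Rightarrow> int" where
  "rho_star i = int i"

definition norm_sq :: "nat \<Rightarrow> (nat \<Rightarrow> int) \<Rightarrow> int" where
  "norm_sq n v = (\<Sum>i=1..n. (v i)\<^sup>2)"

definition chi :: "nat \<Rightarrow> (nat \<Rightarrow> int) \<Rightarrow> (nat \<Rightarrow> int) \<Rightarrow> complex" where
  "chi n v w =
     (\<Prod>i=1..n. of_int (v i) / of_int (w i)) *
     (\<Prod>(i, j) | 1 \<le> i \<and> i < j \<and> j \<le> n.
        of_int ((v i)\<^sup>2 - (v j)\<^sup>2) / of_int ((w i)\<^sup>2 - (w j)\<^sup>2))"

definition congruent_vecs :: "nat \<Rightarrow> (nat \<Rightarrow> int) set" where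
  "congruent_vecs n =
     {v \<in> int_vecs n. \<forall>i\<in>{1..n}. [v i = rho_star i + 1] (mod (2 * int n + 4))}"

(* The two quotients of integers below are exact: see cartan_form_eq and rhs_exponent_exact. *)

definition lhs_exponent :: "nat \<Rightarrow> (nat \<Rightarrow> nat) \<Rightarrow> int" where
  "lhs_exponent k m = cartan_form k m div 2 + alt_sum k m"

definition rhs_exponent :: "nat \<Rightarrow> (nat \<Rightarrow> int) \<Rightarrow> int" where
  "rhs_exponent n v =
     (norm_sq n v - norm_sq n (\<lambda>i. rho_star i + 1)) div (4 * (int n + 2))"

lemma cartan_form_eq:
  "cartan_form k m =
     2 * ((\<Sum>i=1..k. (int (m i))\<^sup>2) - (\<Sum>i=1..<k. int (m i) * int (m (i + 1))))"
proof (induction k)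
  case 0
  show ?case by (simp add: cartan_form_def)
next
  case (Suc k)
  have row: "(\<Sum>i=1..k. int (m i) * cartan_A i (Suc k) * int (m (Suc k))) =
      (if k = 0 then 0 else - (int (m k) * int (m (Suc k))))"
  proof -
    have "(\<Sum>i=1..k. int (m i) * cartan_A i (Suc k) * int (m (Suc k))) =
        (\<Sum>i=1..k. if i = k then - (int (m k) * int (m (Suc k))) else 0)"
      by (rule sum.cong) (auto simp: cartan_A_def)
    then show ?thesis by simp
  qed
  have sym: "cartan_A i j = cartan_A j i" for i j
    by (auto simp: cartan_A_def)
  have col: "(\<Sum>j=1..k. int (m (Suc k)) * cartan_A (Suc k) j * int (m j)) =
      (\<Sum>i=1..k. int (m i) * cartan_A i (Suc k) * int (m (Suc k)))"
    by (rule sum.cong) (auto simp: sym[of "Suc k"])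
  have "cartan_form (Suc k) m = cartan_form k m
      + (\<Sum>i=1..k. int (m i) * cartan_A i (Suc k) * int (m (Suc k)))
      + (\<Sum>j=1..k. int (m (Suc k)) * cartan_A (Suc k) j * int (m j))
      + 2 * (int (m (Suc k)))\<^sup>2"
    by (simp add: cartan_form_def sum.distrib cartan_A_def[of "Suc k" "Suc k"] power2_eq_square)
  then have "cartan_form (Suc k) m = cartan_form k m
      + 2 * (if k = 0 then 0 else - (int (m k) * int (m (Suc k)))) + 2 * (int (m (Suc k)))\<^sup>2"
    by (simp only: row col)
  then show ?case
    using Suc.IH by (cases "k = 0") (auto simp: algebra_simps)
qed

lemma rhs_exponent_exact:
  assumes "v \<in> congruent_vecs n"
  shows "4 * (int n + 2) * rhs_exponent n v = norm_sq n v - norm_sq n (\<lambda>i. rho_star i + 1)"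
proof -
  have "4 * (int n + 2) dvd (v i)\<^sup>2 - (rho_star i + 1)\<^sup>2" if "i \<in> {1..n}" for i
  proof -
    have "[v i = rho_star i + 1] (mod (2 * int n + 4))"
      using assms that by (auto simp: congruent_vecs_def)
    then obtain k where "v i - (rho_star i + 1) = (2 * int n + 4) * k"
      by (auto simp: cong_iff_dvd_diff)
    then have "v i = rho_star i + 1 + (2 * int n + 4) * k" by simp
    then have "(v i)\<^sup>2 - (rho_star i + 1)\<^sup>2 =
        4 * (int n + 2) * (k * (rho_star i + 1 + (int n + 2) * k))"
      by (simp add: power2_eq_square algebra_simps)
    then show ?thesis by simp
  qed
  then have "4 * (int n + 2) dvd norm_sq n v - norm_sq n (\<lambda>i. rho_star i + 1)"
    unfolding norm_sq_def sum_subtractf[symmetric] by (intro dvd_sum)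
  then show ?thesis by (simp add: rhs_exponent_def)
qed

end

theory Submission
  imports Defs "HOL-Complex_Analysis.Complex_Analysis" "Jordan_Normal_Form.Determinant"
begin

no_notation vec_nth (infixl "$" 90)
no_notation vec_index (infixl "$" 100)
notation fps_nth (infixl "$" 75)
hide_const (open) Determinants.det

text \<open>
  For \<open>q = p\<^sup>2\<close> the exponent on the left is, up to a constant, half the sum of the squared
  differences \<open>m\<^sub>i - m\<^sub>i\<^sub>+\<^sub>1\<close> with every second difference shifted by \<open>1\<close>, so the sum iterates the
  kernel \<open>q\<^bsup>(a-b)\<^sup>2/2\<^esup>/(q)\<^sub>b\<close>. The continuous big \<open>q\<close>-Hermite polynomials diagonalise this kernel with
  eigenvalue \<open>\<theta>(z)/(q)\<^sub>\<infinity>\<close>, where \<open>\<theta>(z) = \<Sum>q\<^bsup>k\<^sup>2/2\<^esup>z\<^sup>k\<close>; hence the left side is \<open>(q)\<^sub>\<infinity>\<^bsup>-2n\<^esup>\<close> times a single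
  Laurent coefficient of the product of \<open>\<theta>\<^bsup>2n\<^esup>\<close> and an odd theta function.

  That product is an odd theta function of level \<open>n + 2\<close>, so it has only \<open>n + 1\<close> independent
  coefficients. It vanishes to order \<open>2n + 1\<close> at one point, and its leading Taylor coefficient is known from
  Jacobi's identity for \<open>(q)\<^sub>\<infinity>\<^sup>3\<close>. By Cramer's rule the wanted coefficient is a quotient of determinants of
  theta series. The numerator is of size \<open>n\<close> and expands, by Vandermonde's determinant, into the sum over
  \<open>v\<close> on the right. The denominator satisfies a first-order differential equation in \<open>q\<close>, because each theta
  series satisfies the heat equation, and is therefore a constant times a power of \<open>(q)\<^sub>\<infinity>\<close>.
  The value \<open>q = 0\<close> is reached by continuity.
\<close>

text \<open>An odd theta function enters at the end of the chain: the last factor p^(a^2) equals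
  (q)_a times the value of the normalised big q-Hermite polynomial of degree a under the
  orthogonality functional of the q-Hermite polynomials, and the moments of that functional are
  coefficients of an odd theta function. A shifted edge raises the degree by one, the next edge
  brings it back through the three-term recurrence, and each such pair advances the Chebyshev
  recurrence in z + 1/z. Against an odd sequence the Chebyshev sum collapses to its extreme
  coefficient.

  The zero of order 2n + 1 turns the moments of orders 1, 3, ..., 2n + 1 into n + 1 equations for
  the n + 1 coefficients. That their determinant is nonzero is not known beforehand, so Cramer's
  rule is used without division. The same relation, extended by the moment of order 2n + 3, closes
  the differential equation of the determinant: the third moment of Jacobi's series brings in the
  logarithmic derivative of (q)_\<infinity>, and no separate power of q survives.\<close>

lemma summable_on_dominated:
  fixes f :: "'a \<Rightarrow> 'b::banach"
  assumes "M summable_on A" "\<And>x. x \<in> A \<Longrightarrow> norm (f x) \<le> M x"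
  shows "f summable_on A"
  by (rule abs_summable_summable[OF summable_on_comparison_test[OF assms]]) auto

text \<open>Tannery's theorem for unordered sums: the majorant makes the finite partial sums
  converge uniformly in the parameter, so the two limits may be exchanged.\<close>

lemma tendsto_infsum_dominated:
  fixes f :: "'a \<Rightarrow> 'b \<Rightarrow> 'c::banach"
  assumes lim: "\<And>x. x \<in> X \<Longrightarrow> (f x \<longlongrightarrow> g x) F"
    and bound: "\<And>x n. x \<in> X \<Longrightarrow> norm (f x n) \<le> M x"
    and M: "M summable_on X" and F: "F \<noteq> bot"
  shows "((\<lambda>n. \<Sum>\<^sub>\<infinity>x\<in>X. f x n) \<longlongrightarrow> (\<Sum>\<^sub>\<infinity>x\<in>X. g x)) F"
proof -
  have gb: "norm (g x) \<le> M x" if "x \<in> X" for x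
    by (rule tendsto_upperbound[OF tendsto_norm[OF lim[OF that]]]) (use bound[OF that] F in simp_all)
  have gs: "g summable_on X"
    by (rule summable_on_dominated[OF M gb])
  show ?thesis
  proof (rule swap_uniform_limit'[where F = "finite_subsets_at_top X" and S = UNIV])
    show "uniform_limit UNIV (\<lambda>Y n. \<Sum>x\<in>Y. f x n) (\<lambda>n. \<Sum>\<^sub>\<infinity>x\<in>X. f x n) (finite_subsets_at_top X)"
      by (rule Weierstrass_m_test_general[where M = M]) (use bound M in auto)
    show "((\<lambda>Y. \<Sum>x\<in>Y. g x) \<longlongrightarrow> infsum g X) (finite_subsets_at_top X)"
      by (rule infsum_tendsto[OF gs])
    show "\<forall>\<^sub>F Y in finite_subsets_at_top X. ((\<lambda>n. \<Sum>x\<in>Y. f x n) \<longlongrightarrow> (\<Sum>x\<in>Y. g x)) F"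
    proof (rule eventually_finite_subsets_at_top_weakI)
      fix Y assume "Y \<subseteq> X"
      then show "((\<lambda>n. \<Sum>x\<in>Y. f x n) \<longlongrightarrow> (\<Sum>x\<in>Y. g x)) F" by (intro tendsto_sum lim) blast
    qed
  qed simp_all
qed

section \<open>The \<open>q\<close>-Pochhammer symbol\<close>

lemma qpoch_eq_lessThan: "qpoch q q m = (\<Prod>i<m. 1 - q * q ^ i)"
  unfolding qpoch_def by (rule prod.reindex_bij_witness[of _ Suc "\<lambda>i. i - 1"]) auto

lemma qpoch_0 [simp]: "qpoch q q 0 = 1"
  by (simp add: qpoch_def)

lemma qpoch_Suc: "qpoch q q (Suc m) = qpoch q q m * (1 - q ^ Suc m)"
  by (simp add: qpoch_eq_lessThan)

context
  fixes q :: complex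
  assumes norm_q: "norm q < 1"
begin

lemma one_minus_power_nonzero: "1 - q ^ Suc m \<noteq> 0"
proof
  assume "1 - q ^ Suc m = 0"
  then have "norm (q ^ Suc m) = 1" by simp
  moreover have "norm (q ^ Suc m) < 1"
    using norm_q by (simp add: norm_power power_less_one_iff del: power_Suc)
  ultimately show False by simp
qed

lemma qpoch_nonzero [simp]: "qpoch q q m \<noteq> 0"
  by (induction m) (use one_minus_power_nonzero in \<open>simp_all add: qpoch_Suc del: power_Suc\<close>)

lemma convergent_prod_qpoch: "convergent_prod (\<lambda>i. 1 - q * q ^ i)"
proof (rule abs_convergent_prod_imp_convergent_prod[OF summable_imp_abs_convergent_prod])
  show "summable (\<lambda>i. norm (1 - q * q ^ i - 1))"
    using summable_mult[OF summable_geometric[of "norm q"], of "norm q"] norm_q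
    by (simp add: norm_mult norm_power)
qed

lemma qpoch_inf_nonzero [simp]: "qpoch_inf q q \<noteq> 0"
  unfolding qpoch_inf_def
  using one_minus_power_nonzero by (intro prodinf_nonzero convergent_prod_qpoch) simp

lemma qpoch_tendsto: "(\<lambda>m. qpoch q q m) \<longlonglongrightarrow> qpoch_inf q q"
  unfolding qpoch_eq_lessThan qpoch_inf_def
  using convergent_prod_LIMSEQ[OF convergent_prod_qpoch]
  by (rule iffD2[OF LIMSEQ_lessThan_iff_atMost[where f = "\<lambda>A. \<Prod>i\<in>A. 1 - q * q ^ i"]])

lemma inverse_qpoch_tendsto: "(\<lambda>m. 1 / qpoch q q m) \<longlonglongrightarrow> 1 / qpoch_inf q q"
  by (intro tendsto_intros qpoch_tendsto) simp

lemma inverse_qpoch_bounded: "\<exists>C\<ge>1. \<forall>m. norm (1 / qpoch q q m) \<le> C"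
proof -
  have "Bseq (\<lambda>m. 1 / qpoch q q m)"
    using inverse_qpoch_tendsto by (auto intro: convergent_imp_Bseq convergentI)
  then obtain C where "\<forall>m. norm (1 / qpoch q q m) \<le> C" by (auto simp: Bseq_def)
  then show ?thesis by (intro exI[of _ "max C 1"]) (auto simp: le_max_iff_disj)
qed

lemma inverse_qpoch_Suc: "1 / qpoch q q (Suc m) * (1 - q ^ Suc m) = 1 / qpoch q q m"
  using one_minus_power_nonzero[of m] by (simp add: qpoch_Suc del: power_Suc)

text \<open>Splitting \<open>1 - q\<^bsup>N+1\<^esup> = (1 - q\<^bsup>N+1-r\<^esup>) + q\<^bsup>N+1-r\<^esup> (1 - q\<^sup>r)\<close> lowers the order of a convolution.\<close>
lemma qpoch_convolution_Suc:
  fixes c :: "nat \<Rightarrow> complex"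
  defines "g \<equiv> \<lambda>m. 1 / qpoch q q m"
  shows "(1 - q ^ Suc N) * (\<Sum>r\<le>Suc N. c r * (g r * g (Suc N - r))) =
    (\<Sum>r\<le>N. c r * (g r * g (N - r))) + (\<Sum>r\<le>N. c (Suc r) * q ^ (N - r) * (g r * g (N - r)))"
proof -
  have g_Suc: "g (Suc m) * (1 - q ^ Suc m) = g m" for m
    unfolding g_def by (rule inverse_qpoch_Suc)
  have "(1 - q ^ Suc N) * (\<Sum>r\<le>Suc N. c r * (g r * g (Suc N - r))) =
     (\<Sum>r\<le>Suc N. c r * (g r * (g (Suc N - r) * (1 - q ^ (Suc N - r))))
        + c r * q ^ (Suc N - r) * (g r * (1 - q ^ r) * g (Suc N - r)))"
    unfolding sum_distrib_left
  proof (intro sum.cong refl)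
    fix r assume "r \<in> {..Suc N}"
    then have *: "q ^ Suc N = q ^ (Suc N - r) * q ^ r" by (subst power_add[symmetric]) simp
    show "(1 - q ^ Suc N) * (c r * (g r * g (Suc N - r))) =
        c r * (g r * (g (Suc N - r) * (1 - q ^ (Suc N - r))))
        + c r * q ^ (Suc N - r) * (g r * (1 - q ^ r) * g (Suc N - r))"
      unfolding * by (simp only: algebra_simps mult_1_left)
  qed
  also have "\<dots> = (\<Sum>r\<le>Suc N. c r * (g r * (g (Suc N - r) * (1 - q ^ (Suc N - r)))))
     + (\<Sum>r\<le>Suc N. c r * q ^ (Suc N - r) * (g r * (1 - q ^ r) * g (Suc N - r)))"
    by (rule sum.distrib)
  also have "(\<Sum>r\<le>Suc N. c r * (g r * (g (Suc N - r) * (1 - q ^ (Suc N - r))))) = (\<Sum>r\<le>N. c r * (g r * g (N - r)))"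
    using g_Suc by (simp add: Suc_diff_le del: power_Suc)
  also have "(\<Sum>r\<le>Suc N. c r * q ^ (Suc N - r) * (g r * (1 - q ^ r) * g (Suc N - r)))
      = (\<Sum>r\<le>N. c (Suc r) * q ^ (N - r) * (g r * g (N - r)))"
    using g_Suc by (subst sum.atMost_Suc_shift) (simp del: power_Suc)
  finally show ?thesis .
qed

text \<open>The q-Chu-Vandermonde sum with one index sent to infinity. In the induction
  \<open>qpoch_convolution_Suc\<close> splits the sum for r + 1 into two sums over k <= r; by A and
  B their coefficients are those of r times q^(s-k) and 1 - q^(s-k), so together they reproduce the
  sum for r.\<close>

lemma qpoch_pentagon:
  "(\<Sum>k\<le>r. if k \<le> s then q ^ ((r - k) * (s - k)) /
       (qpoch q q k * qpoch q q (r - k) * qpoch q q (s - k)) else 0) = 1 / (qpoch q q r * qpoch q q s)"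
proof (induction r)
  case (Suc r)
  define g where "g m = 1 / qpoch q q m" for m
  have g_Suc: "g (Suc m) * (1 - q ^ Suc m) = g m" for m
    unfolding g_def by (rule inverse_qpoch_Suc)
  define c where "c R k = (if k \<le> s then q ^ ((R - k) * (s - k)) * g (s - k) else 0)" for R k
  have eq: "(\<Sum>k\<le>r. if k \<le> s then q ^ ((r - k) * (s - k)) / (qpoch q q k * qpoch q q (r - k) * qpoch q q (s - k)) else 0)
     = (\<Sum>k\<le>r. c r k * (g k * g (r - k)))" for r
    by (intro sum.cong) (auto simp: c_def g_def)
  have A: "c (Suc r) k = c r k * q ^ (s - k)" if "k \<le> r" for k
    by (simp only: c_def Suc_diff_le[OF that] mult_Suc power_add) (simp add: mult_ac)
  have B: "c (Suc r) (Suc k) * q ^ (r - k) = c r k * (1 - q ^ (s - k))" for k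
  proof (cases "Suc k \<le> s")
    case True
    then obtain j where j: "s - k = Suc j" "s - Suc k = j" by (metis Suc_diff_Suc Suc_le_eq)
    have "c (Suc r) (Suc k) * q ^ (r - k) = q ^ ((r - k) * Suc j) * (g (Suc j) * (1 - q ^ Suc j))"
      unfolding g_Suc using True by (simp add: c_def j power_add)
    then show ?thesis using True by (simp add: c_def j del: power_Suc)
  next
    case False
    then have "c (Suc r) (Suc k) = 0" "k \<le> s \<Longrightarrow> k = s" by (simp_all add: c_def)
    then show ?thesis by (cases "k \<le> s") (simp_all add: c_def)
  qed
  have "(1 - q ^ Suc r) * (\<Sum>k\<le>Suc r. c (Suc r) k * (g k * g (Suc r - k)))
      = (\<Sum>k\<le>r. c (Suc r) k * (g k * g (r - k))) + (\<Sum>k\<le>r. c (Suc r) (Suc k) * q ^ (r - k) * (g k * g (r - k)))"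
    unfolding g_def by (rule qpoch_convolution_Suc)
  also have "\<dots> = (\<Sum>k\<le>r. c r k * (g k * g (r - k)))"
    unfolding sum.distrib[symmetric] B using A by (intro sum.cong) (auto simp: algebra_simps)
  also have "\<dots> = g r * g s"
    using Suc.IH unfolding eq by (simp add: g_def)
  also have "\<dots> = (1 - q ^ Suc r) * (g (Suc r) * g s)"
    by (simp only: g_Suc[of r, symmetric] mult_ac)
  finally have "(\<Sum>k\<le>Suc r. c (Suc r) k * (g k * g (Suc r - k))) = g (Suc r) * g s"
    by (rule mult_left_cancel[OF one_minus_power_nonzero, THEN iffD1])
  then show ?case unfolding eq by (simp only: g_def) simp
qed simp

lemma summable_on_square_power:
  fixes x :: "'a::{real_normed_field,banach}"
  assumes "norm x < 1"
  shows "(\<lambda>j::nat. norm x ^ (j * (j + k))) summable_on UNIV"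
proof (rule summable_on_comparison_test)
  have "summable (\<lambda>j. norm x ^ j)" using assms by (intro summable_geometric) auto
  then show "(\<lambda>j. norm x ^ j) summable_on UNIV" by (simp add: summable_on_UNIV_nonneg_real_iff)
  fix j :: nat
  have "j \<le> j * (j + k)" by (cases j) auto
  then show "norm x ^ (j * (j + k)) \<le> norm x ^ j"
    using assms by (intro power_decreasing) auto
qed auto

text \<open>The limit of \<open>qpoch_pentagon\<close> as both arguments tend to infinity with fixed difference.\<close>
lemma qpoch_durfee:
  "((\<lambda>j. q ^ (j * (j + k)) / (qpoch q q j * qpoch q q (j + k))) has_sum 1 / qpoch_inf q q) UNIV"
proof -
  obtain C where C: "C \<ge> 1" "\<And>m. norm (1 / qpoch q q m) \<le> C" using inverse_qpoch_bounded by blast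
  define g where "g m = 1 / qpoch q q m" for m
  have gC: "norm (g m) \<le> C" for m using C by (simp add: g_def)
  define c where "c j = q ^ (j * (j + k)) * g j * g (j + k)" for j
  have cb: "norm (c j) \<le> C\<^sup>2 * norm q ^ (j * (j + k))" for j
  proof -
    have "norm (c j) = norm q ^ (j * (j + k)) * (norm (g j) * norm (g (j + k)))"
      by (simp add: c_def norm_mult norm_power)
    also have "\<dots> \<le> norm q ^ (j * (j + k)) * (C * C)"
      using gC C(1) by (intro mult_left_mono mult_mono) auto
    finally show ?thesis by (simp add: power2_eq_square mult_ac)
  qed
  have csum: "c summable_on UNIV"
    by (rule summable_on_dominated[OF summable_on_cmult_right[OF summable_on_square_power[OF norm_q]] cb])
  \<comment> \<open>After truncation at j <= N the sum over j is \<open>qpoch_pentagon\<close> for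
    the arguments N and N + k, read backwards through i = N - j. The bound on c, times C, dominates
    f uniformly in N.\<close>
  define f where "f j N = (if j \<le> N then c j * g (N - j) else 0)" for j N
  have gl: "g \<longlonglongrightarrow> 1 / qpoch_inf q q" unfolding g_def by (rule inverse_qpoch_tendsto)
  have fl: "f j \<longlonglongrightarrow> c j * (1 / qpoch_inf q q)" for j
  proof (rule Lim_transform_eventually)
    show "(\<lambda>N. c j * g (N - j)) \<longlonglongrightarrow> c j * (1 / qpoch_inf q q)"
      by (intro tendsto_mult tendsto_const filterlim_compose[OF gl] filterlim_minus_const_nat_at_top)
    show "\<forall>\<^sub>F N in sequentially. c j * g (N - j) = f j N"
      using eventually_ge_at_top[of j] by eventually_elim (simp add: f_def)
  qed
  have fb: "norm (f j N) \<le> C\<^sup>2 * norm q ^ (j * (j + k)) * C" for j N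
  proof (cases "j \<le> N")
    case True
    then show ?thesis using cb[of j] gC[of "N - j"] C(1)
      by (simp only: f_def if_True norm_mult) (rule mult_mono, simp_all)
  qed (use C(1) in \<open>simp add: f_def\<close>)
  have "(\<lambda>N. \<Sum>\<^sub>\<infinity>j. f j N) \<longlonglongrightarrow> (\<Sum>\<^sub>\<infinity>j. c j * (1 / qpoch_inf q q))"
    by (rule tendsto_infsum_dominated[OF fl fb summable_on_cmult_left[OF summable_on_cmult_right[OF
          summable_on_square_power[OF norm_q]]]]) simp
  moreover have "(\<Sum>\<^sub>\<infinity>j. f j N) = g N * g (N + k)" for N
  proof -
    have "(\<Sum>\<^sub>\<infinity>j. f j N) = (\<Sum>\<^sub>\<infinity>j\<in>{..N}. f j N)"
      by (rule infsum_cong_neutral) (auto simp: f_def)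
    also have "\<dots> = (\<Sum>j\<le>N. c j * g (N - j))" by (simp add: f_def)
    also have "\<dots> = (\<Sum>i\<le>N. c (N - i) * g i)"
      by (rule sum.reindex_bij_witness[of _ "\<lambda>i. N - i" "\<lambda>i. N - i"]) auto
    also have "\<dots> = (\<Sum>i\<le>N. if i \<le> N + k then q ^ ((N - i) * (N + k - i)) /
        (qpoch q q i * qpoch q q (N - i) * qpoch q q (N + k - i)) else 0)"
      by (intro sum.cong) (auto simp: c_def g_def)
    also have "\<dots> = g N * g (N + k)"
      using qpoch_pentagon[of "N + k" N] by (simp add: g_def)
    finally show ?thesis .
  qed
  moreover have "(\<lambda>N. g N * g (N + k)) \<longlonglongrightarrow> 1 / qpoch_inf q q * (1 / qpoch_inf q q)"
    by (intro tendsto_mult gl LIMSEQ_ignore_initial_segment)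
  ultimately have "(\<Sum>\<^sub>\<infinity>j. c j * (1 / qpoch_inf q q)) = 1 / qpoch_inf q q * (1 / qpoch_inf q q)"
    using LIMSEQ_unique by fastforce
  then have "infsum c UNIV = 1 / qpoch_inf q q"
    unfolding infsum_cmult_left' by (metis mult_right_cancel divide_eq_0_iff one_neq_zero qpoch_inf_nonzero)
  moreover have "c = (\<lambda>j. q ^ (j * (j + k)) / (qpoch q q j * qpoch q q (j + k)))"
    by (auto simp: c_def g_def)
  ultimately show ?thesis using csum by (metis has_sum_infsum)
qed

text \<open>Here c (r+1) q^(N-r) = -x q^N c r, with a factor independent of r. The second sum of
  \<open>qpoch_convolution_Suc\<close> is therefore a multiple of the first, and each step
  contributes one factor 1 - x q^N.\<close>

lemma qbinomial_theorem:
  "(\<Sum>r\<le>N. (-1) ^ r * q ^ (r * (r - 1) div 2) * x ^ r / (qpoch q q r * qpoch q q (N - r)))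
     = (\<Prod>i<N. 1 - x * q ^ i) / qpoch q q N"
proof (induction N)
  case (Suc N)
  define g where "g m = 1 / qpoch q q m" for m
  define c where "c r = (-1) ^ r * q ^ (r * (r - 1) div 2) * x ^ r" for r
  define S where "S N = (\<Sum>r\<le>N. c r * (g r * g (N - r)))" for N
  have c_Suc: "c (Suc r) * q ^ (N - r) = - x * q ^ N * c r" if "r \<le> N" for r
  proof -
    have "Suc r * (Suc r - 1) div 2 = r + r * (r - 1) div 2"
      by (cases r) (auto simp: algebra_simps)
    moreover have "q ^ N = q ^ r * q ^ (N - r)" using that by (subst power_add[symmetric]) simp
    ultimately show ?thesis by (simp add: c_def power_add)
  qed
  have "(1 - q ^ Suc N) * S (Suc N) = S N + (\<Sum>r\<le>N. c (Suc r) * q ^ (N - r) * (g r * g (N - r)))"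
    unfolding S_def g_def by (rule qpoch_convolution_Suc)
  also have "(\<Sum>r\<le>N. c (Suc r) * q ^ (N - r) * (g r * g (N - r))) = - x * q ^ N * S N"
    unfolding S_def sum_distrib_left using c_Suc by (intro sum.cong) auto
  finally have "(1 - q ^ Suc N) * S (Suc N) = (1 - x * q ^ N) * S N"
    by (simp add: algebra_simps del: power_Suc)
  moreover have "S N = (\<Prod>i<N. 1 - x * q ^ i) * g N"
    using Suc.IH by (simp add: S_def c_def g_def)
  ultimately have "(1 - q ^ Suc N) * S (Suc N) = (1 - q ^ Suc N) * ((\<Prod>i<Suc N. 1 - x * q ^ i) * g (Suc N))"
    unfolding prod.lessThan_Suc inverse_qpoch_Suc[of N, folded g_def, symmetric] by (simp only: mult_ac)
  then have "S (Suc N) = (\<Prod>i<Suc N. 1 - x * q ^ i) * g (Suc N)"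
    using one_minus_power_nonzero[of N] by (simp del: power_Suc)
  then show ?case by (simp add: S_def c_def g_def)
qed simp

end

section \<open>Unordered sums over the integers and index shifts\<close>

lemma summable_on_int_of_nat:
  fixes f :: "int \<Rightarrow> 'b::banach"
  assumes "(\<lambda>n. f (int n)) summable_on UNIV" "(\<lambda>n. f (- int n)) summable_on UNIV"
  shows "f summable_on UNIV"
proof -
  have 1: "f summable_on range int" and 2: "f summable_on range (\<lambda>n. - int n)"
    using assms by (auto simp: summable_on_reindex inj_on_def o_def)
  have "f summable_on (range int - range (\<lambda>n. - int n)) \<union> range (\<lambda>n. - int n)"
    by (rule summable_on_Un_disjoint[OF summable_on_subset_banach[OF 1] 2]) auto
  moreover have "x \<in> range int \<union> range (\<lambda>n. - int n)" for x
    by (cases x rule: int_cases2) auto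
  then have "(range int - range (\<lambda>n. - int n)) \<union> range (\<lambda>n. - int n) = UNIV" by blast
  ultimately show ?thesis by simp
qed

text \<open>The term at n is the n-th power of r^n R, and r^n R tends to 0: a Gaussian beats every
  geometric factor.\<close>

lemma summable_on_gauss:
  fixes r R :: real
  assumes "0 \<le> r" "r < 1" "0 \<le> R"
  shows "(\<lambda>l::int. r powi (l\<^sup>2) * R ^ nat \<bar>l\<bar>) summable_on UNIV"
proof -
  have "(\<lambda>n. r ^ n * R) \<longlonglongrightarrow> 0 * R"
    using assms by (intro tendsto_intros LIMSEQ_realpow_zero)
  then have "\<forall>\<^sub>F n in sequentially. r ^ n * R < 1 / 2"
    by (rule order_tendstoD) simp
  then have ev: "\<forall>\<^sub>F n in sequentially. norm ((r ^ n * R) ^ n) \<le> (1 / 2) ^ n"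
    by eventually_elim (use assms in \<open>auto intro!: power_mono simp: norm_power\<close>)
  have "summable (\<lambda>n. (r ^ n * R) ^ n)"
    by (rule summable_comparison_test_ev[OF ev]) (simp add: summable_geometric)
  then have "(\<lambda>n. (r ^ n * R) ^ n) summable_on UNIV"
    using assms by (simp add: summable_on_UNIV_nonneg_real_iff)
  moreover have "(r ^ n * R) ^ n = r powi ((int n)\<^sup>2) * R ^ n" for n
    by (simp add: power_mult_distrib power_mult[symmetric] power2_eq_square power_int_def nat_mult_distrib)
  ultimately show ?thesis
    by (intro summable_on_int_of_nat) simp_all
qed

lemma has_sum_minus:
  fixes f g :: "'a \<Rightarrow> 'b::banach"
  assumes "(f has_sum a) A" "(g has_sum b) A"
  shows "((\<lambda>x. f x - g x) has_sum a - b) A"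
proof -
  have "((\<lambda>x. - g x) has_sum - b) A" using assms(2) by (subst has_sum_uminus) simp
  from has_sum_add[OF assms(1) this] show ?thesis by simp
qed

lemma has_sum_Suc:
  fixes f :: "nat \<Rightarrow> 'b::banach"
  assumes "f 0 = 0" "((\<lambda>n. f (Suc n)) has_sum S) UNIV"
  shows "(f has_sum S) UNIV"
proof -
  have "(f has_sum S) (range Suc)"
    using assms(2) by (subst has_sum_reindex) (auto simp: o_def)
  moreover have "(f has_sum S) (range Suc) \<longleftrightarrow> (f has_sum S) UNIV"
  proof (rule has_sum_cong_neutral)
    fix x assume "x \<in> UNIV - range Suc"
    then show "f x = 0" using assms(1) by (cases x) auto
  qed auto
  ultimately show ?thesis by simp
qed

lemma has_sum_Suc':
  fixes f :: "nat \<Rightarrow> 'b::banach"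
  assumes "f 0 = 0" "(f has_sum S) UNIV"
  shows "((\<lambda>n. f (Suc n)) has_sum S) UNIV"
proof -
  have "(f has_sum S) (range Suc) \<longleftrightarrow> (f has_sum S) UNIV"
  proof (rule has_sum_cong_neutral)
    fix x assume "x \<in> UNIV - range Suc"
    then show "f x = 0" using assms(1) by (cases x) auto
  qed auto
  then show ?thesis using assms(2) by (subst (asm) has_sum_reindex) (auto simp: o_def)
qed

section \<open>Continuous big \<open>q\<close>-Hermite polynomials and the Gaussian kernel\<close>

text \<open>The polynomials, normalised by \<open>1/(q)\<^sub>N\<close>, are Laurent polynomials in \<open>z\<close>. They are represented by
  their action on sequences, with \<open>z\<close> acting as the shift.\<close>
definition rogers_szego :: "complex \<Rightarrow> nat \<Rightarrow> (int \<Rightarrow> complex) \<Rightarrow> int \<Rightarrow> complex" where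
  "rogers_szego q N s k = (\<Sum>r\<le>N. s (k + 2 * int r - int N) / (qpoch q q r * qpoch q q (N - r)))"

text \<open>The factors p^(m^2)/(q)_m, q = p^2, are the coefficients in Euler's expansion of
  (-pt)_\<infinity>, so the generating function in t is (-pt)_\<infinity> / ((zt)_\<infinity>
  (t/z)_\<infinity>): the big q-Hermite parameter is -p.\<close>

definition big_hermite :: "complex \<Rightarrow> nat \<Rightarrow> (int \<Rightarrow> complex) \<Rightarrow> int \<Rightarrow> complex" where
  "big_hermite p a s k =
     (\<Sum>m\<le>a. p ^ (m\<^sup>2) / qpoch (p\<^sup>2) (p\<^sup>2) m * rogers_szego (p\<^sup>2) (a - m) s k)"

definition theta_op :: "complex \<Rightarrow> (int \<Rightarrow> complex) \<Rightarrow> int \<Rightarrow> complex" where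
  "theta_op p s k = (\<Sum>\<^sub>\<infinity>l. p powi (l\<^sup>2) * s (k + l))"

text \<open>The outer index \<open>a\<close> is an integer, because the recurrence refers to a - 1
  also when a = 0.\<close>

definition gauss_transform :: "complex \<Rightarrow> (int \<Rightarrow> complex) \<Rightarrow> int \<Rightarrow> int \<Rightarrow> complex" where
  "gauss_transform p s a k = (\<Sum>\<^sub>\<infinity>b. p powi ((a - int b)\<^sup>2) * big_hermite p b s k)"

text \<open>The three-term recurrence of the q-Hermite polynomials, z + 1/z acting as two opposite
  shifts. Of the two sums in \<open>qpoch_convolution_Suc\<close> one is the shift by -1; in the
  other, q^(N-r) = 1 - (1 - q^(N-r)) yields the shift by 1 and the polynomial of degree N -
  1.\<close>

lemma rogers_szego_Suc:
  assumes "norm q < 1"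
  shows "(1 - q ^ Suc N) * rogers_szego q (Suc N) s k =
     rogers_szego q N s (k + 1) + rogers_szego q N s (k - 1)
       - (if N = 0 then 0 else rogers_szego q (N - 1) s k)"
proof -
  define g where "g m = 1 / qpoch q q m" for m
  have g_Suc: "g (Suc m) * (1 - q ^ Suc m) = g m" for m
    unfolding g_def by (rule inverse_qpoch_Suc[OF assms])
  have X: "rogers_szego q N s k = (\<Sum>r\<le>N. s (k + 2 * int r - int N) * (g r * g (N - r)))" for N k
    by (simp add: rogers_szego_def g_def)
  define u where "u r = s (k + 1 + 2 * int r - int N)" for r
  have "(1 - q ^ Suc N) * rogers_szego q (Suc N) s k =
     (\<Sum>r\<le>N. s (k + 2 * int r - int (Suc N)) * (g r * g (N - r)))
       + (\<Sum>r\<le>N. s (k + 2 * int (Suc r) - int (Suc N)) * q ^ (N - r) * (g r * g (N - r)))"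
    unfolding X g_def by (rule qpoch_convolution_Suc[OF assms])
  also have "(\<Sum>r\<le>N. s (k + 2 * int r - int (Suc N)) * (g r * g (N - r))) = rogers_szego q N s (k - 1)"
    unfolding X by (simp add: algebra_simps)
  also have "(\<Sum>r\<le>N. s (k + 2 * int (Suc r) - int (Suc N)) * q ^ (N - r) * (g r * g (N - r)))
      = (\<Sum>r\<le>N. u r * (g r * g (N - r))) - (\<Sum>r\<le>N. u r * (g r * (g (N - r) * (1 - q ^ (N - r)))))"
    unfolding sum_subtractf[symmetric] by (intro sum.cong) (auto simp: u_def algebra_simps)
  also have "(\<Sum>r\<le>N. u r * (g r * g (N - r))) = rogers_szego q N s (k + 1)"
    unfolding X by (simp add: u_def)
  also have "(\<Sum>r\<le>N. u r * (g r * (g (N - r) * (1 - q ^ (N - r))))) = (if N = 0 then 0 else rogers_szego q (N - 1) s k)"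
  proof (cases N)
    case (Suc M)
    have "u i = s (k + 2 * int i - int M)" for i by (simp add: u_def Suc algebra_simps)
    then show ?thesis
      unfolding X Suc using g_Suc by (simp add: Suc_diff_le del: power_Suc)
  qed simp
  finally show ?thesis by simp
qed

context
  fixes p :: complex
  assumes norm_p: "norm p < 1" and p_nz: "p \<noteq> 0"
begin

lemma norm_p2: "norm (p\<^sup>2) < 1"
  using norm_p by (simp add: norm_power power_less_one_iff)

text \<open>The factor 1 - q^(a+1) is split as in \<open>qpoch_convolution_Suc\<close>. One part is
  the recurrence of the q-Hermite polynomials; in the other, (m+1)^2 + 2(a-m) = 2a + 1 + m^2 turns
  the sum into p^(2a+1) times the polynomial of degree a.\<close>

lemma big_hermite_Suc:
  "(1 - p ^ (2 * Suc a)) * big_hermite p (Suc a) s k =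
     big_hermite p a s (k + 1) + big_hermite p a s (k - 1)
       - (if a = 0 then 0 else big_hermite p (a - 1) s k) + p ^ (2 * a + 1) * big_hermite p a s k"
proof -
  define q where "q = p\<^sup>2"
  have q: "norm q < 1" using norm_p2 by (simp add: q_def)
  define g where "g m = 1 / qpoch q q m" for m
  have g_Suc: "g (Suc m) * (1 - q ^ Suc m) = g m" for m
    using one_minus_power_nonzero[OF q, of m] by (simp add: g_def qpoch_Suc del: power_Suc)
  define e where "e m = p ^ (m\<^sup>2)" for m
  define x where "x n k = rogers_szego q n s k" for n k
  have Y: "big_hermite p a s k = (\<Sum>m\<le>a. e m * g m * x (a - m) k)" for a k
    by (simp add: big_hermite_def g_def e_def x_def q_def)
  have x_Suc: "(1 - q ^ Suc n) * x (Suc n) k = x n (k + 1) + x n (k - 1) - (if n = 0 then 0 else x (n - 1) k)" for n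
    using rogers_szego_Suc[OF q] by (simp add: x_def)
  have "(1 - q ^ Suc a) * big_hermite p (Suc a) s k =
     (\<Sum>m\<le>Suc a. e m * g m * ((1 - q ^ (Suc a - m)) * x (Suc a - m) k)
        + e m * q ^ (Suc a - m) * (g m * (1 - q ^ m)) * x (Suc a - m) k)"
    unfolding Y sum_distrib_left
  proof (intro sum.cong refl)
    fix r assume "r \<in> {..Suc a}"
    then have *: "q ^ Suc a = q ^ (Suc a - r) * q ^ r" by (subst power_add[symmetric]) simp
    show "(1 - q ^ Suc a) * (e r * g r * x (Suc a - r) k) =
       e r * g r * ((1 - q ^ (Suc a - r)) * x (Suc a - r) k)
        + e r * q ^ (Suc a - r) * (g r * (1 - q ^ r)) * x (Suc a - r) k"
      unfolding * by (simp only: algebra_simps mult_1_left)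
  qed
  also have "\<dots> = (\<Sum>m\<le>Suc a. e m * g m * ((1 - q ^ (Suc a - m)) * x (Suc a - m) k))
     + (\<Sum>m\<le>Suc a. e m * q ^ (Suc a - m) * (g m * (1 - q ^ m)) * x (Suc a - m) k)"
    by (rule sum.distrib)
  also have "(\<Sum>m\<le>Suc a. e m * g m * ((1 - q ^ (Suc a - m)) * x (Suc a - m) k))
      = (\<Sum>m\<le>a. e m * g m * (x (a - m) (k + 1) + x (a - m) (k - 1) - (if a - m = 0 then 0 else x (a - m - 1) k)))"
    using x_Suc by (simp add: Suc_diff_le del: power_Suc)
  also have "\<dots> = big_hermite p a s (k + 1) + big_hermite p a s (k - 1)
      - (\<Sum>m\<le>a. e m * g m * (if a - m = 0 then 0 else x (a - m - 1) k))"
    unfolding Y by (simp add: sum_subtractf sum.distrib algebra_simps)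
  also have "(\<Sum>m\<le>a. e m * g m * (if a - m = 0 then 0 else x (a - m - 1) k))
      = (if a = 0 then 0 else big_hermite p (a - 1) s k)"
  proof (cases a)
    case (Suc b)
    then show ?thesis unfolding Y by (auto intro!: sum.cong simp: Suc_diff_le)
  qed simp
  also have "(\<Sum>m\<le>Suc a. e m * q ^ (Suc a - m) * (g m * (1 - q ^ m)) * x (Suc a - m) k)
      = (\<Sum>m\<le>a. e (Suc m) * q ^ (a - m) * g m * x (a - m) k)"
    using g_Suc by (subst sum.atMost_Suc_shift) (simp del: power_Suc)
  also have "\<dots> = p ^ (2 * a + 1) * big_hermite p a s k"
    unfolding Y sum_distrib_left
  proof (intro sum.cong refl)
    fix m assume "m \<in> {..a}"
    then have *: "(Suc m)\<^sup>2 + 2 * (a - m) = 2 * a + 1 + m\<^sup>2"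
      by (simp add: power2_eq_square algebra_simps)
    have "e (Suc m) * q ^ (a - m) = p ^ ((Suc m)\<^sup>2 + 2 * (a - m))"
      by (simp only: e_def q_def power_add power_mult)
    also have "\<dots> = p ^ (2 * a + 1) * e m"
      by (simp only: * e_def power_add)
    finally show "e (Suc m) * q ^ (a - m) * g m * x (a - m) k = p ^ (2 * a + 1) * (e m * g m * x (a - m) k)"
      by (simp only: mult.assoc)
  qed
  finally show ?thesis by (simp only: q_def power_mult[symmetric])
qed

text \<open>A double sum with at most (a+1)^2 bounded terms. Any polynomial growth suffices against
  the Gaussian weights.\<close>

lemma big_hermite_bound:
  assumes B: "\<And>k. norm (s k) \<le> B"
  shows "\<exists>C\<ge>0. \<forall>a k. norm (big_hermite p a s k) \<le> C * real (a + 1) ^ 2"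
proof -
  obtain C where C: "C \<ge> 1" "\<And>m. norm (1 / qpoch (p\<^sup>2) (p\<^sup>2) m) \<le> C"
    using inverse_qpoch_bounded[OF norm_p2] by blast
  have B0: "B \<ge> 0" using B[of 0] norm_ge_zero order_trans by blast
  have x: "norm (rogers_szego (p\<^sup>2) N s k) \<le> (real N + 1) * (B * (C * C))" for N k
  proof -
    have "norm (rogers_szego (p\<^sup>2) N s k) \<le> (\<Sum>r\<le>N. B * (C * C))"
      unfolding rogers_szego_def
    proof (rule sum_norm_le)
      fix r
      have "norm (s (k + 2 * int r - int N) / (qpoch (p\<^sup>2) (p\<^sup>2) r * qpoch (p\<^sup>2) (p\<^sup>2) (N - r)))
        = norm (s (k + 2 * int r - int N)) * (norm (1 / qpoch (p\<^sup>2) (p\<^sup>2) r) * norm (1 / qpoch (p\<^sup>2) (p\<^sup>2) (N - r)))"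
        by (simp add: norm_mult norm_divide)
      also have "\<dots> \<le> B * (C * C)"
        using B C B0 by (intro mult_mono) auto
      finally show "norm (s (k + 2 * int r - int N) / (qpoch (p\<^sup>2) (p\<^sup>2) r * qpoch (p\<^sup>2) (p\<^sup>2) (N - r))) \<le> B * (C * C)" .
    qed
    then show ?thesis by (simp add: add.commute)
  qed
  have "norm (big_hermite p a s k) \<le> (C * B * (C * C)) * real (a + 1) ^ 2" for a k
  proof -
    have "norm (big_hermite p a s k) \<le> (\<Sum>m\<le>a. C * (real (a + 1) * (B * (C * C))))"
      unfolding big_hermite_def
    proof (rule sum_norm_le)
      fix m assume "m \<in> {..a}"
      have p1: "norm p ^ (m\<^sup>2) \<le> 1" using norm_p by (intro power_le_one) auto
      have "norm (p ^ (m\<^sup>2) / qpoch (p\<^sup>2) (p\<^sup>2) m * rogers_szego (p\<^sup>2) (a - m) s k)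
         = norm p ^ (m\<^sup>2) * norm (1 / qpoch (p\<^sup>2) (p\<^sup>2) m) * norm (rogers_szego (p\<^sup>2) (a - m) s k)"
        by (simp add: norm_mult norm_divide norm_power)
      also have "\<dots> \<le> 1 * C * ((real (a - m) + 1) * (B * (C * C)))"
        using p1 C x B0 by (intro mult_mono) auto
      also have "\<dots> \<le> 1 * C * (real (a + 1) * (B * (C * C)))"
        using C(1) B0 by (intro mult_left_mono mult_right_mono) auto
      finally show "norm (p ^ (m\<^sup>2) / qpoch (p\<^sup>2) (p\<^sup>2) m * rogers_szego (p\<^sup>2) (a - m) s k)
          \<le> C * (real (a + 1) * (B * (C * C)))" by simp
    qed
    then show ?thesis by (simp add: power2_eq_square algebra_simps)
  qed
  then show ?thesis using C(1) B0 by (intro exI[of _ "C * B * (C * C)"]) auto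
qed

lemma gauss_weight_summable:
  "(\<lambda>b. norm p powi ((a - int b)\<^sup>2) * real (b + 1) ^ 2) summable_on UNIV"
proof -
  have r: "0 \<le> norm p" "norm p < 1" using norm_p by auto
  \<comment> \<open>The base 4 is the square of 2: with l = |a - b| one has b + 1 <= A (l + 1) <= A
    2^l for A = 1 + |a|, and the weight contains (b + 1)^2.\<close>
  have S: "(\<lambda>l::int. norm p powi (l\<^sup>2) * 4 ^ nat \<bar>l\<bar>) summable_on UNIV"
    by (rule summable_on_gauss[OF r]) simp
  have inj: "inj (\<lambda>b. a - int b)" by (auto simp: inj_on_def)
  have "(\<lambda>l::int. norm p powi (l\<^sup>2) * 4 ^ nat \<bar>l\<bar>) summable_on range (\<lambda>b. a - int b)"
    by (rule summable_on_subset_banach[OF S]) simp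
  then have S': "(\<lambda>b. norm p powi ((a - int b)\<^sup>2) * 4 ^ nat \<bar>a - int b\<bar>) summable_on UNIV"
    by (subst (asm) summable_on_reindex[OF inj]) (simp add: o_def)
  show ?thesis
  proof (rule summable_on_dominated[OF summable_on_cmult_right[OF S']])
    fix b :: nat
    define l where "l = nat \<bar>a - int b\<bar>"
    have "real l + 1 \<le> 2 ^ l" using of_nat_less_two_power[of l, where 'a = real]
      by (metis Suc_leI less_exp of_nat_Suc of_nat_le_iff of_nat_numeral of_nat_power add.commute)
    have "real b \<le> \<bar>a\<bar> + real l" by (simp add: l_def)
    define A where "A = 1 + real_of_int \<bar>a\<bar>"
    have "A * (real l + 1) = A + real l + real_of_int \<bar>a\<bar> * real l"
      by (simp add: A_def algebra_simps)
    moreover have "0 \<le> real_of_int \<bar>a\<bar> * real l" by simp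
    ultimately have "real (b + 1) \<le> A * (real l + 1)"
      using \<open>real b \<le> \<bar>a\<bar> + real l\<close> unfolding A_def of_nat_add of_nat_1 by linarith
    also have "\<dots> \<le> A * 2 ^ l"
      using \<open>real l + 1 \<le> 2 ^ l\<close> by (intro mult_left_mono) (auto simp: A_def)
    finally have "real (b + 1) ^ 2 \<le> (A * 2 ^ l) ^ 2" by (intro power_mono) auto
    also have "\<dots> = A\<^sup>2 * 4 ^ l"
      by (simp add: power_mult_distrib power_mult[symmetric] mult.commute[of l] power_mult)
    finally have "norm p powi ((a - int b)\<^sup>2) * real (b + 1) ^ 2
        \<le> norm p powi ((a - int b)\<^sup>2) * (A\<^sup>2 * 4 ^ l)"
      by (intro mult_left_mono) auto
    then show "norm (norm p powi ((a - int b)\<^sup>2) * real (b + 1) ^ 2)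
        \<le> (1 + real_of_int \<bar>a\<bar>)\<^sup>2 * (norm p powi ((a - int b)\<^sup>2) * 4 ^ nat \<bar>a - int b\<bar>)"
      by (simp add: l_def A_def algebra_simps)
  qed
qed

lemma gauss_transform_summable:
  assumes B: "\<And>k. norm (s k) \<le> B"
  shows "(\<lambda>b. p powi ((a - int b)\<^sup>2) * big_hermite p b s k) summable_on UNIV"
proof -
  obtain C where C: "C \<ge> 0" "\<And>a k. norm (big_hermite p a s k) \<le> C * real (a + 1) ^ 2"
    using big_hermite_bound[of s, OF B] by blast
  show ?thesis
  proof (rule summable_on_dominated[OF summable_on_cmult_right[OF gauss_weight_summable[of a]]])
    fix b
    show "norm (p powi ((a - int b)\<^sup>2) * big_hermite p b s k)
        \<le> C * (norm p powi ((a - int b)\<^sup>2) * real (b + 1) ^ 2)"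
    proof -
      have "norm (p powi ((a - int b)\<^sup>2) * big_hermite p b s k)
          \<le> norm p powi ((a - int b)\<^sup>2) * (C * real (b + 1) ^ 2)"
        unfolding norm_mult norm_power_int by (intro mult_left_mono C(2)) auto
      then show ?thesis by (simp only: mult_ac)
    qed
  qed
qed

text \<open>Replacing b + 1 by b changes the weight to that of a + 1; the new term b = 0 vanishes
  because of its factor 1 - p^0. The part with p^(2b) is then a multiple of the transform at a,
  since (a+1-b)^2 + 2b = 2a + 1 + (a-b)^2.\<close>

lemma gauss_transform_shift:
  assumes B: "\<And>k. norm (s k) \<le> B"
  shows "((\<lambda>b. p powi ((a - int b)\<^sup>2) * ((1 - p ^ (2 * Suc b)) * big_hermite p (Suc b) s k))
     has_sum gauss_transform p s (a + 1) k - p powi (2 * a + 1) * gauss_transform p s a k) UNIV"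
proof -
  define y where "y b k = big_hermite p b s k" for b k
  define W where "W x = p powi (x\<^sup>2)" for x :: int
  define L where "L a k = gauss_transform p s a k" for a k
  have L: "((\<lambda>b. W (a - int b) * y b k) has_sum L a k) UNIV" for a k
    unfolding W_def y_def L_def gauss_transform_def
    by (rule has_sum_infsum) (rule gauss_transform_summable[OF B])
  have W1: "W (a - int b + 1) * p ^ (2 * b) = p powi (2 * a + 1) * W (a - int b)" for b
  proof -
    have "W (a - int b + 1) * p ^ (2 * b) = p powi ((a - int b + 1)\<^sup>2 + int (2 * b))"
      by (simp only: W_def power_int_add[OF disjI1[OF p_nz]] power_int_of_nat)
    also have "(a - int b + 1)\<^sup>2 + int (2 * b) = 2 * a + 1 + (a - int b)\<^sup>2"
      by (simp add: power2_eq_square algebra_simps)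
    finally show ?thesis by (simp only: W_def power_int_add[OF disjI1[OF p_nz]])
  qed
  have "((\<lambda>b. W (a + 1 - int b) * y b k - p powi (2 * a + 1) * (W (a - int b) * y b k))
     has_sum L (a + 1) k - p powi (2 * a + 1) * L a k) UNIV"
    by (rule has_sum_minus[OF L has_sum_cmult_right[OF L]])
  moreover have "W (a + 1 - int b) * y b k - p powi (2 * a + 1) * (W (a - int b) * y b k)
      = W (a + 1 - int b) * ((1 - p ^ (2 * b)) * y b k)" for b
  proof -
    have "a + 1 - int b = a - int b + 1" by simp
    moreover have "p powi (2 * a + 1) * (W (a - int b) * y b k) = W (a - int b + 1) * p ^ (2 * b) * y b k"
      by (simp only: W1 mult.assoc)
    ultimately show ?thesis by (simp only: algebra_simps mult_1_left)
  qed
  ultimately have "((\<lambda>b. W (a + 1 - int b) * ((1 - p ^ (2 * b)) * y b k))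
     has_sum L (a + 1) k - p powi (2 * a + 1) * L a k) UNIV" by (simp only:)
  then have 1: "((\<lambda>b. W (a - int b) * ((1 - p ^ (2 * Suc b)) * y (Suc b) k))
     has_sum L (a + 1) k - p powi (2 * a + 1) * L a k) UNIV"
  proof -
    assume *: "((\<lambda>b. W (a + 1 - int b) * ((1 - p ^ (2 * b)) * y b k))
     has_sum L (a + 1) k - p powi (2 * a + 1) * L a k) UNIV"
    have "a + 1 - int (Suc b) = a - int b" for b by simp
    then show ?thesis using has_sum_Suc'[OF _ *] by (simp only: mult_0_right power_0 diff_self mult_zero_left mult_zero_right)
  qed
  then show ?thesis unfolding L_def y_def W_def .
qed

text \<open>\<open>big_hermite_Suc\<close> summed against the Gaussian weight. Both the term of
  degree b - 1 and the term with p^(2b+1) become transforms at a - 1. Their joint coefficient 1 -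
  p^(2a) vanishes at a = 0, so the value at 0 determines all values at positive indices.\<close>

lemma gauss_transform_rec:
  assumes B: "\<And>k. norm (s k) \<le> B"
  shows "gauss_transform p s (a + 1) k = gauss_transform p s a (k + 1) + gauss_transform p s a (k - 1)
    + p powi (2 * a + 1) * gauss_transform p s a k - (1 - p powi (2 * a)) * gauss_transform p s (a - 1) k"
proof -
  define y where "y b k = big_hermite p b s k" for b k
  define W where "W x = p powi (x\<^sup>2)" for x :: int
  define L where "L a k = gauss_transform p s a k" for a k
  have L: "((\<lambda>b. W (a - int b) * y b k) has_sum L a k) UNIV" for a k
    unfolding W_def y_def L_def gauss_transform_def
    by (rule has_sum_infsum) (rule gauss_transform_summable[OF B])
  have W2: "W (a - int b) * p ^ (2 * b + 1) = p powi (2 * a) * W (a - 1 - int b)" for b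
  proof -
    have "W (a - int b) * p ^ (2 * b + 1) = p powi ((a - int b)\<^sup>2 + int (2 * b + 1))"
      by (simp only: W_def power_int_add[OF disjI1[OF p_nz]] power_int_of_nat)
    also have "(a - int b)\<^sup>2 + int (2 * b + 1) = 2 * a + (a - 1 - int b)\<^sup>2"
      by (simp add: power2_eq_square algebra_simps)
    finally show ?thesis by (simp only: W_def power_int_add[OF disjI1[OF p_nz]])
  qed
  have 1: "((\<lambda>b. W (a - int b) * ((1 - p ^ (2 * Suc b)) * y (Suc b) k))
     has_sum L (a + 1) k - p powi (2 * a + 1) * L a k) UNIV"
    unfolding L_def y_def W_def by (rule gauss_transform_shift[OF B])
  have "((\<lambda>b. W (a - int (Suc b)) * y b k) has_sum L (a - 1) k) UNIV"
  proof -
    have "a - int (Suc b) = a - 1 - int b" for b by simp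
    then show ?thesis using L[of "a - 1" k] by (simp only:)
  qed
  then have 2: "((\<lambda>b. W (a - int b) * (if b = 0 then 0 else y (b - 1) k)) has_sum L (a - 1) k) UNIV"
    by (intro has_sum_Suc[where f = "\<lambda>b. W (a - int b) * (if b = 0 then 0 else y (b - 1) k)"])
       simp_all
  have "((\<lambda>b. p powi (2 * a) * (W (a - 1 - int b) * y b k)) has_sum p powi (2 * a) * L (a - 1) k) UNIV"
    by (rule has_sum_cmult_right[OF L])
  then have 3: "((\<lambda>b. W (a - int b) * (p ^ (2 * b + 1) * y b k)) has_sum p powi (2 * a) * L (a - 1) k) UNIV"
    by (simp only: mult.assoc[symmetric] W2)
  have "((\<lambda>b. W (a - int b) * ((1 - p ^ (2 * Suc b)) * y (Suc b) k)
      + W (a - int b) * (if b = 0 then 0 else y (b - 1) k) - W (a - int b) * (p ^ (2 * b + 1) * y b k))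
     has_sum L (a + 1) k - p powi (2 * a + 1) * L a k + L (a - 1) k - p powi (2 * a) * L (a - 1) k) UNIV"
    by (rule has_sum_minus[OF has_sum_add[OF 1 2] 3])
  moreover have "W (a - int b) * ((1 - p ^ (2 * Suc b)) * y (Suc b) k)
      + W (a - int b) * (if b = 0 then 0 else y (b - 1) k) - W (a - int b) * (p ^ (2 * b + 1) * y b k)
      = W (a - int b) * y b (k + 1) + W (a - int b) * y b (k - 1)" for b
  proof -
    have *: "(1 - p ^ (2 * Suc b)) * y (Suc b) k = y b (k + 1) + y b (k - 1)
       - (if b = 0 then 0 else y (b - 1) k) + p ^ (2 * b + 1) * y b k"
      unfolding y_def by (rule big_hermite_Suc)
    show ?thesis unfolding * by (simp only: algebra_simps)
  qed
  ultimately have "((\<lambda>b. W (a - int b) * y b (k + 1) + W (a - int b) * y b (k - 1))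
     has_sum L (a + 1) k - p powi (2 * a + 1) * L a k + L (a - 1) k - p powi (2 * a) * L (a - 1) k) UNIV"
    by (simp only:)
  moreover have "((\<lambda>b. W (a - int b) * y b (k + 1) + W (a - int b) * y b (k - 1))
     has_sum L a (k + 1) + L a (k - 1)) UNIV"
    by (rule has_sum_add[OF L L])
  ultimately have "L (a + 1) k - p powi (2 * a + 1) * L a k + L (a - 1) k - p powi (2 * a) * L (a - 1) k
      = L a (k + 1) + L a (k - 1)"
    by (rule has_sum_unique)
  then have "L (a + 1) k = L a (k + 1) + L a (k - 1)
    + p powi (2 * a + 1) * L a k - (1 - p powi (2 * a)) * L (a - 1) k"
    by (simp add: algebra_simps)
  then show ?thesis unfolding L_def .
qed

end

section \<open>The Gaussian transform at index zero and the eigenvalue\<close>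

lemma summable_on_nat_Times_geometric:
  fixes r :: real
  assumes "0 \<le> r" "r < 1"
  shows "(\<lambda>(m::nat, n::nat). r ^ m * r ^ n) summable_on UNIV"
proof -
  have g: "((\<lambda>n. r ^ n) has_sum (1 / (1 - r))) UNIV"
    using assms summable_geometric[of r] geometric_sums[of r]
    by (intro norm_summable_imp_has_sum) (simp_all add: norm_power)
  have "(\<lambda>(m::nat, n::nat). r ^ m * r ^ n) summable_on (SIGMA m:UNIV. UNIV)"
  proof (rule summable_on_SigmaI)
    show "((\<lambda>n. case (m, n) of (m, n) \<Rightarrow> r ^ m * r ^ n) has_sum r ^ m * (1 / (1 - r))) UNIV" for m :: nat
      using has_sum_cmult_right[OF g] by simp
    show "(\<lambda>m. r ^ m * (1 / (1 - r))) summable_on UNIV"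
      using g by (rule summable_on_cmult_left[OF has_sum_imp_summable])
  qed (use assms in auto)
  then show ?thesis by simp
qed

context
  fixes p :: complex
  assumes norm_p: "norm p < 1" and p_nz: "p \<noteq> 0"
begin

private abbreviation "qq \<equiv> p\<^sup>2"
private abbreviation "g m \<equiv> 1 / qpoch (p\<^sup>2) (p\<^sup>2) m"

text \<open>The summand after expanding both polynomials in the transform at 0: the degree is b = m
  + r + t, the big q-Hermite index is m, and r and t count the powers of z and 1/z.\<close>

private definition pentagon_term :: "(int \<Rightarrow> complex) \<Rightarrow> int \<Rightarrow> nat \<times> nat \<times> nat \<Rightarrow> complex" where
  "pentagon_term s k = (\<lambda>(m, r, t). p ^ ((m + r + t)\<^sup>2 + m\<^sup>2) * g m * g r * g t * s (k + int r - int t))"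

private lemma pentagon_term_summable:
  assumes B: "\<And>k. norm (s k) \<le> B"
  shows "pentagon_term s k summable_on UNIV"
proof -
  note qq = norm_p2[OF norm_p p_nz]
  obtain C where C: "C \<ge> 1" "\<And>m. norm (g m) \<le> C"
    using inverse_qpoch_bounded[OF qq] by blast
  have B0: "B \<ge> 0" using B[of 0] norm_ge_zero order_trans by blast
  define r where "r = norm p"
  have r: "0 \<le> r" "r < 1" using norm_p by (auto simp: r_def)
  have gs: "((\<lambda>n. r ^ n) has_sum (1 / (1 - r))) (UNIV :: nat set)"
    using r summable_geometric[of r] geometric_sums[of r]
    by (intro norm_summable_imp_has_sum) (simp_all add: norm_power)
  have "(\<lambda>(m::nat, rt). r ^ m * (case rt of (x, y) \<Rightarrow> r ^ x * r ^ y)) summable_on (SIGMA m:UNIV. UNIV)"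
  proof (rule summable_on_SigmaI)
    show "((\<lambda>n. case (m, n) of (m, rt) \<Rightarrow> r ^ m * (case rt of (x, y) \<Rightarrow> r ^ x * r ^ y)) has_sum
      r ^ m * (\<Sum>\<^sub>\<infinity>(x, y)\<in>UNIV. r ^ x * r ^ y)) UNIV" for m :: nat
      using has_sum_cmult_right[OF has_sum_infsum[OF summable_on_nat_Times_geometric[OF r]], of "r ^ m"]
      by (simp add: case_prod_unfold)
    show "(\<lambda>m. r ^ m * (\<Sum>\<^sub>\<infinity>(x, y)\<in>UNIV. r ^ x * r ^ y)) summable_on (UNIV :: nat set)"
      using gs by (rule summable_on_cmult_left[OF has_sum_imp_summable])
  qed (use r in auto)
  then have S: "(\<lambda>(m::nat, x::nat, y::nat). r ^ m * (r ^ x * r ^ y)) summable_on UNIV"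
    by (simp add: case_prod_unfold)
  show ?thesis
  proof (rule summable_on_dominated[OF summable_on_cmult_right[OF S]])
    fix x :: "nat \<times> nat \<times> nat"
    obtain m a b where x: "x = (m, a, b)" by (cases x)
    have "m + a + b \<le> (m + a + b)\<^sup>2 + m\<^sup>2" by (rule trans_le_add1) (cases "m + a + b", auto simp: power2_eq_square)
    then have "r ^ ((m + a + b)\<^sup>2 + m\<^sup>2) \<le> r ^ (m + a + b)" using r by (intro power_decreasing) auto
    then have "norm (pentagon_term s k x) \<le> r ^ (m + a + b) * C * C * C * B"
      unfolding pentagon_term_def x prod.case norm_mult norm_power r_def[symmetric]
      using C B B0 r by (intro mult_mono) auto
    then show "norm (pentagon_term s k x) \<le> (C * C * C * B) * (case x of (m, x, y) \<Rightarrow> r ^ m * (r ^ x * r ^ y))"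
      by (simp add: x power_add mult_ac)
  qed
qed

private lemma gauss_transform_0_eq_infsum:
  assumes B: "\<And>k. norm (s k) \<le> B"
  shows "gauss_transform p s 0 k = infsum (pentagon_term s k) UNIV"
proof -
  let ?T = "SIGMA b:(UNIV::nat set). (SIGMA m:{..b}. {..b - m})"
  let ?G = "\<lambda>(b, m, r). pentagon_term s k (m, r, b - m - r)"
  have bij: "bij_betw (\<lambda>(b, m, r). (m, r, b - m - r)) ?T UNIV"
    by (rule bij_betw_byWitness[where f' = "\<lambda>(m, r, t). (m + r + t, m, r)"]) auto
  have "infsum (pentagon_term s k) UNIV = infsum (\<lambda>x. pentagon_term s k ((\<lambda>(b, m, r). (m, r, b - m - r)) x)) ?T"
    by (rule infsum_reindex_bij_betw[OF bij, symmetric])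
  also have "(\<lambda>x. pentagon_term s k ((\<lambda>(b, m, r). (m, r, b - m - r)) x)) = ?G"
    by (simp add: case_prod_unfold)
  finally have 1: "infsum (pentagon_term s k) UNIV = infsum ?G ?T" .
  have "(\<lambda>x. pentagon_term s k ((\<lambda>(b, m, r). (m, r, b - m - r)) x)) summable_on ?T"
    using pentagon_term_summable[of s, OF B] by (subst summable_on_reindex_bij_betw[OF bij])
  then have "?G summable_on ?T" by (simp add: case_prod_unfold)
  then have "infsum ?G ?T = (\<Sum>\<^sub>\<infinity>b. \<Sum>\<^sub>\<infinity>x\<in>(SIGMA m:{..b}. {..b - m}). ?G (b, x))"
    by (rule infsum_Sigma_banach[symmetric])
  also have "\<dots> = (\<Sum>\<^sub>\<infinity>b. p powi ((0 - int b)\<^sup>2) * big_hermite p b s k)"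
  proof (rule infsum_cong)
    fix b :: nat
    have "(\<Sum>\<^sub>\<infinity>x\<in>(SIGMA m:{..b}. {..b - m}). ?G (b, x)) = (\<Sum>x\<in>(SIGMA m:{..b}. {..b - m}). ?G (b, x))"
      by (rule infsum_finite) auto
    also have "\<dots> = (\<Sum>m\<le>b. \<Sum>r\<le>b - m. pentagon_term s k (m, r, b - m - r))"
      by (subst sum.Sigma) (auto simp: case_prod_unfold)
    also have "\<dots> = p ^ (b\<^sup>2) * big_hermite p b s k"
      unfolding big_hermite_def rogers_szego_def sum_distrib_left
    proof (intro sum.cong refl)
      fix m r assume mr: "m \<in> {..b}" "r \<in> {..b - m}"
      then have e: "m + r + (b - m - r) = b" "k + int r - int (b - m - r) = k + 2 * int r - int (b - m)"
        by auto
      show "pentagon_term s k (m, r, b - m - r) = p ^ (b\<^sup>2) * (p ^ (m\<^sup>2) / qpoch (p\<^sup>2) (p\<^sup>2) m *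
          (s (k + 2 * int r - int (b - m)) / (qpoch (p\<^sup>2) (p\<^sup>2) r * qpoch (p\<^sup>2) (p\<^sup>2) (b - m - r))))"
        unfolding pentagon_term_def prod.case e by (simp add: power_add mult_ac)
    qed
    finally show "(\<Sum>\<^sub>\<infinity>x\<in>(SIGMA m:{..b}. {..b - m}). ?G (b, x)) = p powi ((0 - int b)\<^sup>2) * big_hermite p b s k"
      by (simp add: power_int_def nat_power_eq)
  qed
  finally show ?thesis using 1 by (simp add: gauss_transform_def)
qed

text \<open>With R = m + r and S = m + t the exponent is R^2 + S^2 + 2rt, and the sum over m is
  \<open>qpoch_pentagon\<close>. With l = R - S and j = min R S it becomes l^2 + 2j(j + |l|), and
  the sum over j is \<open>qpoch_durfee\<close>; what remains is the theta series in l.\<close>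

private lemma infsum_pentagon_term:
  assumes B: "\<And>k. norm (s k) \<le> B"
  shows "infsum (pentagon_term s k) UNIV = theta_op p s k / qpoch_inf (p\<^sup>2) (p\<^sup>2)"
proof -
  note qq = norm_p2[OF norm_p p_nz]
  let ?T = "SIGMA x:(UNIV::(nat \<times> nat) set). {..min (fst x) (snd x)}"
  let ?h = "\<lambda>((R, S), m). (m, R - m, S - m)"
  have bij: "bij_betw ?h ?T UNIV"
    by (rule bij_betw_byWitness[where f' = "\<lambda>(m, r, t). ((m + r, m + t), m)"]) auto
  define H where "H = (\<lambda>(R, S). p ^ (R\<^sup>2 + S\<^sup>2) * s (k + int R - int S) * g R * g S)"
  have inner: "(\<Sum>\<^sub>\<infinity>m\<in>{..min (fst x) (snd x)}. pentagon_term s k (?h (x, m))) = H x" for x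
  proof -
    obtain R S where x: "x = (R, S)" by (cases x)
    have "(\<Sum>\<^sub>\<infinity>m\<in>{..min (fst x) (snd x)}. pentagon_term s k (?h (x, m))) = (\<Sum>m\<le>min R S. pentagon_term s k (m, R - m, S - m))"
      by (simp add: x)
    also have "\<dots> = (\<Sum>m\<le>min R S. p ^ (R\<^sup>2 + S\<^sup>2) * s (k + int R - int S) *
        (qq ^ ((R - m) * (S - m)) / (qpoch qq qq m * qpoch qq qq (R - m) * qpoch qq qq (S - m))))"
    proof (intro sum.cong refl)
      fix m assume "m \<in> {..min R S}"
      then have "R = m + (R - m)" "S = m + (S - m)" by auto
      then obtain a b where ab: "R = m + a" "S = m + b" by blast
      have "(m + a + b)\<^sup>2 + m\<^sup>2 = (m + a)\<^sup>2 + (m + b)\<^sup>2 + 2 * (a * b)"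
        by (simp add: power2_eq_square algebra_simps)
      moreover have "qq ^ (a * b) = p ^ (2 * (a * b))" by (simp add: power_mult)
      ultimately have "p ^ ((m + a + b)\<^sup>2 + m\<^sup>2) = p ^ ((m + a)\<^sup>2 + (m + b)\<^sup>2) * qq ^ (a * b)"
        by (simp only: power_add)
      then show "pentagon_term s k (m, R - m, S - m) = p ^ (R\<^sup>2 + S\<^sup>2) * s (k + int R - int S) *
        (qq ^ ((R - m) * (S - m)) / (qpoch qq qq m * qpoch qq qq (R - m) * qpoch qq qq (S - m)))"
        unfolding pentagon_term_def ab prod.case by (simp add: diff_add_eq[symmetric] add_diff_eq)
    qed
    also have "\<dots> = p ^ (R\<^sup>2 + S\<^sup>2) * s (k + int R - int S) * (\<Sum>m\<le>min R S.
        (qq ^ ((R - m) * (S - m)) / (qpoch qq qq m * qpoch qq qq (R - m) * qpoch qq qq (S - m))))"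
      by (rule sum_distrib_left[symmetric])
    also have "(\<Sum>m\<le>min R S. (qq ^ ((R - m) * (S - m)) / (qpoch qq qq m * qpoch qq qq (R - m) * qpoch qq qq (S - m))))
      = (\<Sum>m\<le>R. if m \<le> S then qq ^ ((R - m) * (S - m)) / (qpoch qq qq m * qpoch qq qq (R - m) * qpoch qq qq (S - m)) else 0)"
      by (rule sum.mono_neutral_cong_left) auto
    also have "\<dots> = 1 / (qpoch qq qq R * qpoch qq qq S)"
      by (rule qpoch_pentagon[OF qq])
    finally show ?thesis by (simp add: H_def x)
  qed
  have sumT: "(\<lambda>x. pentagon_term s k (?h x)) summable_on ?T"
    using pentagon_term_summable[of s, OF B] by (subst summable_on_reindex_bij_betw[OF bij])
  have "infsum (pentagon_term s k) UNIV = infsum (\<lambda>x. pentagon_term s k (?h x)) ?T"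
    by (rule infsum_reindex_bij_betw[OF bij, symmetric])
  also have "\<dots> = (\<Sum>\<^sub>\<infinity>x. \<Sum>\<^sub>\<infinity>m\<in>{..min (fst x) (snd x)}. pentagon_term s k (?h (x, m)))"
    by (rule infsum_Sigma_banach[OF sumT, symmetric])
  also have "\<dots> = infsum H UNIV" unfolding inner ..
  finally have 1: "infsum (pentagon_term s k) UNIV = infsum H UNIV" .
  have "(\<lambda>x. \<Sum>\<^sub>\<infinity>m\<in>{..min (fst x) (snd x)}. pentagon_term s k (?h (x, m))) summable_on UNIV"
  proof (rule summable_on_Sigma_banach)
    show "(\<lambda>(x, m). pentagon_term s k (?h (x, m))) summable_on ?T"
      by (rule summable_on_cong[THEN iffD1, OF _ sumT]) auto
  qed
  then have sumH: "H summable_on UNIV" unfolding inner .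
  let ?v = "\<lambda>(l::int, j::nat). (j + nat l, j + nat (- l))"
  have bij2: "bij_betw ?v (SIGMA l:UNIV. UNIV) UNIV"
    by (rule bij_betw_byWitness[where f' = "\<lambda>(R, S). (int R - int S, min R S)"]) auto
  have Hv: "H (?v (l, j)) = p powi (l\<^sup>2) * s (k + l) *
      (qq ^ (j * (j + nat \<bar>l\<bar>)) / (qpoch qq qq j * qpoch qq qq (j + nat \<bar>l\<bar>)))" for l j
  proof -
    define a where "a = nat \<bar>l\<bar>"
    have "(j + a)\<^sup>2 + j\<^sup>2 = a\<^sup>2 + 2 * (j * (j + a))" by (simp add: power2_eq_square algebra_simps)
    moreover have "qq ^ (j * (j + a)) = p ^ (2 * (j * (j + a)))" by (simp add: power_mult)
    moreover have "p powi (l\<^sup>2) = p ^ (a\<^sup>2)"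
    proof -
      have "l\<^sup>2 = int (a\<^sup>2)" by (simp add: a_def)
      then show ?thesis by (simp only: power_int_of_nat)
    qed
    ultimately have e: "p ^ ((j + a)\<^sup>2 + j\<^sup>2) = p powi (l\<^sup>2) * qq ^ (j * (j + a))"
      by (simp only: power_add)
    show ?thesis
    proof (cases "l \<ge> 0")
      case True
      then have "nat l = a" "nat (- l) = 0" "l = int a" by (auto simp: a_def)
      then show ?thesis using e unfolding a_def[symmetric] H_def by (simp add: mult_ac)
    next
      case False
      then have "nat l = 0" "nat (- l) = a" "l = - int a" by (auto simp: a_def)
      then show ?thesis using e unfolding a_def[symmetric] H_def by (simp add: add.commute mult_ac)
    qed
  qed
  have sumv: "(\<lambda>x. H (?v x)) summable_on (SIGMA l:UNIV. UNIV)"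
    using sumH by (subst summable_on_reindex_bij_betw[OF bij2])
  have "infsum H UNIV = infsum (\<lambda>x. H (?v x)) (SIGMA l:UNIV. UNIV)"
    by (rule infsum_reindex_bij_betw[OF bij2, symmetric])
  also have "\<dots> = (\<Sum>\<^sub>\<infinity>l. \<Sum>\<^sub>\<infinity>j. H (?v (l, j)))"
    by (rule infsum_Sigma_banach[OF sumv, symmetric])
  also have "\<dots> = (\<Sum>\<^sub>\<infinity>l. p powi (l\<^sup>2) * s (k + l) * (1 / qpoch_inf qq qq))"
    unfolding Hv infsum_cmult_right' infsumI[OF qpoch_durfee[OF qq]] ..
  also have "\<dots> = theta_op p s k / qpoch_inf qq qq"
    unfolding infsum_cmult_left' theta_op_def by simp
  finally show ?thesis using 1 by simp
qed

lemma gauss_transform_0: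
  assumes "\<And>k. norm (s k) \<le> B"
  shows "gauss_transform p s 0 k = theta_op p s k / qpoch_inf (p\<^sup>2) (p\<^sup>2)"
  using gauss_transform_0_eq_infsum[of s, OF assms] infsum_pentagon_term[of s, OF assms] by simp

text \<open>The three-term recurrence makes the continuous big \<open>q\<close>-Hermite polynomials eigenfunctions
  of the Gaussian kernel, with the theta function as eigenvalue.\<close>
theorem gauss_transform_eigen:
  assumes B: "\<And>k. norm (s k) \<le> B"
  shows "gauss_transform p s (int a) k =
    qpoch (p\<^sup>2) (p\<^sup>2) a * big_hermite p a (theta_op p s) k / qpoch_inf (p\<^sup>2) (p\<^sup>2)"
proof (induction a arbitrary: k rule: less_induct)
  case (less a)
  show ?case
  proof (cases a)
    case 0
    then show ?thesis
      using gauss_transform_0[of s, OF B] by (simp add: big_hermite_def rogers_szego_def)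
  next
    case (Suc b)
    define Q where "Q = qpoch_inf (p\<^sup>2) (p\<^sup>2)"
    define c where "c n = qpoch (p\<^sup>2) (p\<^sup>2) n" for n
    define y where "y n k = big_hermite p n (theta_op p s) k" for n k
    have IH: "gauss_transform p s (int n) k = c n * y n k / Q" if "n < a" for n k
      using less.IH[OF that] by (simp add: c_def y_def Q_def)
    have cS: "c (Suc n) = c n * (1 - p ^ (2 * Suc n))" for n
      by (simp only: c_def qpoch_Suc power_mult)
    have pp: "p powi (2 * int b + 1) = p ^ (2 * b + 1)" "p powi (2 * int b) = p ^ (2 * b)"
      by (simp_all add: power_int_def nat_add_distrib nat_mult_distrib)
    \<comment> \<open>For b = 0 the transform stands at index -1, outside the induction hypothesis;
      the factor 1 - p^0 removes it.\<close>
    have last: "(1 - p ^ (2 * b)) * gauss_transform p s (int b - 1) k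
        = c b * (if b = 0 then 0 else y (b - 1) k) / Q"
    proof (cases b)
      case (Suc d)
      then show ?thesis using IH[of d] \<open>a = Suc b\<close> cS[of d] by simp
    qed simp
    have "gauss_transform p s (int a) k = gauss_transform p s (int b) (k + 1) + gauss_transform p s (int b) (k - 1)
      + p ^ (2 * b + 1) * gauss_transform p s (int b) k - c b * (if b = 0 then 0 else y (b - 1) k) / Q"
      using gauss_transform_rec[OF norm_p p_nz, of s, OF B, of "int b" k]
      unfolding pp last Suc of_nat_Suc add.commute[of 1 "int b"] .
    also have "\<dots> = c b * (y b (k + 1) + y b (k - 1) - (if b = 0 then 0 else y (b - 1) k) + p ^ (2 * b + 1) * y b k) / Q"
      using IH[of b] Suc by (simp add: add_divide_distrib diff_divide_distrib algebra_simps)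
    also have "y b (k + 1) + y b (k - 1) - (if b = 0 then 0 else y (b - 1) k) + p ^ (2 * b + 1) * y b k
        = (1 - p ^ (2 * Suc b)) * y (Suc b) k"
      unfolding y_def by (rule big_hermite_Suc[OF norm_p p_nz, symmetric])
    finally show ?thesis
      unfolding Suc Q_def[symmetric] c_def[symmetric] y_def[symmetric] cS by (simp only: mult.assoc)
  qed
qed

end

section \<open>The odd theta function as a functional on the polynomials\<close>

lemma has_sum_sum:
  fixes f :: "'i \<Rightarrow> 'a \<Rightarrow> 'b::banach"
  assumes "finite I" "\<And>i. i \<in> I \<Longrightarrow> (f i has_sum S i) A"
  shows "((\<lambda>x. \<Sum>i\<in>I. f i x) has_sum (\<Sum>i\<in>I. S i)) A"
  using assms by (induction I rule: finite_induct) (auto intro!: has_sum_add)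

text \<open>Coefficients of Jacobi's theta series with signs and exponents k(k+1)/2 in q = p^2. They
  are antisymmetric about k = -1/2, which is why moments are later taken in k + 1/2.\<close>

definition theta_seq :: "complex \<Rightarrow> int \<Rightarrow> complex" where
  "theta_seq p k = (if even k then 1 else -1) * p powi (k * (k + 1))"

text \<open>The coefficients of z times the theta series in z^2; this places the centre of
  antisymmetry at 0.\<close>

definition odd_theta_seq :: "complex \<Rightarrow> int \<Rightarrow> complex" where
  "odd_theta_seq p l = (if odd l then theta_seq p ((l - 1) div 2) else 0)"

lemma int_mult_Suc_nonneg: "0 \<le> k * (k + 1)" for k :: int
  by (cases "k \<ge> 0") (auto simp: zero_le_mult_iff)

lemma norm_theta_seq_le: "norm p < 1 \<Longrightarrow> norm (theta_seq p k) \<le> 1"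
  unfolding theta_seq_def norm_mult norm_power_int
  using int_mult_Suc_nonneg[of k] by (auto simp: power_int_def power_le_one)

lemma norm_odd_theta_seq_le: "norm p < 1 \<Longrightarrow> norm (odd_theta_seq p k) \<le> 1"
  by (simp add: odd_theta_seq_def norm_theta_seq_le)

lemma odd_theta_seq_minus: "odd_theta_seq p (- l) = - odd_theta_seq p l"
proof (cases "odd l")
  case True
  then obtain j where j: "l = 2 * j + 1" by (auto elim: oddE)
  have "(- l - 1) div 2 = - j - 1" "(l - 1) div 2 = j" by (auto simp: j)
  moreover have "(- j - 1) * (- j - 1 + 1) = j * (j + 1)" by (simp add: algebra_simps)
  ultimately show ?thesis using True by (auto simp: odd_theta_seq_def theta_seq_def)
qed (simp add: odd_theta_seq_def)

definition cheb_sum :: "nat \<Rightarrow> (int \<Rightarrow> complex) \<Rightarrow> int \<Rightarrow> complex" where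
  "cheb_sum j s k = (\<Sum>i<j. s (k + int j - 1 - 2 * int i))"

text \<open>\<open>cheb_sum (j + 1)\<close> is the Chebyshev polynomial \<open>U\<^sub>j\<close> in the operator of two opposite shifts.\<close>
lemma cheb_sum_Suc_Suc:
  "cheb_sum (Suc (Suc j)) s k = cheb_sum (Suc j) s (k + 1) + cheb_sum (Suc j) s (k - 1) - cheb_sum j s k"
proof -
  have "cheb_sum (Suc j) s (k - 1) = (\<Sum>i<j. s (k + int j - 1 - 2 * int i)) + s (k - 1 - int j)"
    by (simp add: cheb_sum_def algebra_simps)
  moreover have "cheb_sum (Suc (Suc j)) s k = cheb_sum (Suc j) s (k + 1) + s (k - 1 - int j)"
    by (simp add: cheb_sum_def algebra_simps)
  ultimately show ?thesis by (simp add: cheb_sum_def)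
qed

context
  fixes p :: complex
  assumes norm_p: "norm p < 1" and p_nz: "p \<noteq> 0"
begin

lemma theta_op_summable:
  assumes B: "\<And>k. norm (s k) \<le> B"
  shows "(\<lambda>l. p powi (l\<^sup>2) * s (k + l)) summable_on UNIV"
proof -
  have "(\<lambda>l::int. norm p powi (l\<^sup>2) * 1 ^ nat \<bar>l\<bar>) summable_on UNIV"
    by (rule summable_on_gauss) (use norm_p in auto)
  from summable_on_cmult_left[OF this, of B] show ?thesis
    by (rule summable_on_dominated) (use B in \<open>auto simp: norm_mult norm_power_int intro!: mult_left_mono\<close>)
qed

lemma theta_op_bounded:
  assumes B: "\<And>k. norm (s k) \<le> B"
  shows "\<exists>B'. \<forall>k. norm (theta_op p s k) \<le> B'"
proof -
  have S: "(\<lambda>l::int. norm p powi (l\<^sup>2) * 1 ^ nat \<bar>l\<bar>) summable_on UNIV"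
    by (rule summable_on_gauss) (use norm_p in auto)
  have "norm (theta_op p s k) \<le> (\<Sum>\<^sub>\<infinity>l. norm p powi (l\<^sup>2) * 1 ^ nat \<bar>l\<bar> * B)" for k
    unfolding theta_op_def
    by (rule norm_infsum_le[OF has_sum_infsum[OF theta_op_summable[OF B]] has_sum_infsum[OF summable_on_cmult_left[OF S]]])
       (use B in \<open>auto simp: norm_mult norm_power_int intro!: mult_left_mono\<close>)
  then show ?thesis by blast
qed

lemma theta_op_shift: "theta_op p (\<lambda>k. s (k + j)) k = theta_op p s (k + j)"
  by (simp add: theta_op_def algebra_simps)

lemma theta_op_sum:
  assumes "\<And>i k. i \<in> I \<Longrightarrow> norm (s i k) \<le> B" "finite I"
  shows "theta_op p (\<lambda>k. \<Sum>i\<in>I. s i k) k = (\<Sum>i\<in>I. theta_op p (s i) k)"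
proof -
  have "((\<lambda>l. \<Sum>i\<in>I. p powi (l\<^sup>2) * s i (k + l)) has_sum (\<Sum>i\<in>I. theta_op p (s i) k)) UNIV"
    unfolding theta_op_def
    by (rule has_sum_sum) (use assms in \<open>auto intro!: has_sum_infsum theta_op_summable\<close>)
  then show ?thesis unfolding theta_op_def[of p "\<lambda>k. \<Sum>i\<in>I. s i k"]
    by (intro infsumI) (simp add: sum_distrib_left)
qed

lemma theta_op_cheb_sum:
  assumes "\<And>k. norm (s k) \<le> B"
  shows "theta_op p (cheb_sum j s) k = cheb_sum j (theta_op p s) k"
proof -
  have "theta_op p (\<lambda>k. \<Sum>i<j. s (k + (int j - 1 - 2 * int i))) k
      = (\<Sum>i<j. theta_op p (\<lambda>k. s (k + (int j - 1 - 2 * int i))) k)"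
    by (rule theta_op_sum[of _ _ B]) (use assms in auto)
  then show ?thesis unfolding theta_op_shift cheb_sum_def[abs_def] by (simp add: algebra_simps)
qed

text \<open>The map z^k to \<open>odd_theta_seq\<close> at k + 1 is the orthogonality functional of
  the q-Hermite polynomials on symmetric Laurent polynomials. In odd degree only zero entries are
  met. In degree 2M the value is a q-binomial sum at x = q^(1-M), and the product contains the
  factor 1 - x q^(M-1) = 0.\<close>

lemma rogers_szego_moment:
  "rogers_szego (p\<^sup>2) N (\<lambda>k. odd_theta_seq p (k + 1)) 0 = (if N = 0 then 1 else 0)"
proof -
  define q where "q = p\<^sup>2"
  have q: "norm q < 1" "q \<noteq> 0" using norm_p2[OF norm_p p_nz] p_nz by (auto simp: q_def)
  show ?thesis
  proof (cases "even N")
    case False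
    then have "odd_theta_seq p (0 + 2 * int r - int N + 1) = 0" for r
      by (simp add: odd_theta_seq_def)
    then show ?thesis using False by (cases N) (simp_all add: rogers_szego_def)
  next
    case True
    then obtain M where M: "N = 2 * M" by (auto elim: evenE)
    show ?thesis
    proof (cases M)
      case 0
      then show ?thesis by (simp add: M rogers_szego_def odd_theta_seq_def theta_seq_def)
    next
      case (Suc M')
      define x where "x = q powi (- int M')"
      have t: "odd_theta_seq p (0 + 2 * int r - int N + 1)
          = (-1) ^ M * p powi (int M * int M') * ((-1) ^ r * q ^ (r * (r - 1) div 2) * x ^ r)" for r
      proof -
        have "(0 + 2 * int r - int N + 1 - 1) div 2 = int r - int M" by (simp add: M)
        then have "odd_theta_seq p (0 + 2 * int r - int N + 1) = theta_seq p (int r - int M)"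
          by (simp add: odd_theta_seq_def M)
        also have "\<dots> = (-1) ^ M * (-1) ^ r * p powi ((int r - int M) * (int r - int M + 1))"
          by (simp add: theta_seq_def minus_one_power_iff)
        also have "(int r - int M) * (int r - int M + 1)
            = int M * int M' + (int (r * (r - 1)) + - (2 * int M') * int r)"
          by (cases r) (simp_all add: Suc algebra_simps)
        also have "p powi \<dots> = p powi (int M * int M') * (p powi (int (r * (r - 1))) * p powi (- (2 * int M') * int r))"
          by (simp only: power_int_add[OF disjI1[OF p_nz]])
        also have "p powi (int (r * (r - 1))) = q ^ (r * (r - 1) div 2)"
        proof -
          have "even (r * (r - 1))" by (cases r) auto
          then show ?thesis unfolding q_def power_mult[symmetric] power_int_of_nat by simp
        qed
        also have "p powi (- (2 * int M') * int r) = x ^ r"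
        proof -
          have "x = p powi (- (2 * int M'))"
            unfolding x_def q_def by (simp add: power_int_minus power_int_def nat_mult_distrib power_mult power_inverse)
          then show ?thesis by (simp only: power_int_mult power_int_of_nat)
        qed
        finally show ?thesis by (simp only: mult_ac)
      qed
      have "rogers_szego q N (\<lambda>k. odd_theta_seq p (k + 1)) 0 = (-1) ^ M * p powi (int M * int M') *
        (\<Sum>r\<le>N. (-1) ^ r * q ^ (r * (r - 1) div 2) * x ^ r / (qpoch q q r * qpoch q q (N - r)))"
        unfolding rogers_szego_def sum_distrib_left t by (simp add: mult.assoc)
      also have "(\<Sum>r\<le>N. (-1) ^ r * q ^ (r * (r - 1) div 2) * x ^ r / (qpoch q q r * qpoch q q (N - r)))
          = (\<Prod>i<N. 1 - x * q ^ i) / qpoch q q N"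
        by (rule qbinomial_theorem[OF q(1)])
      also have "(\<Prod>i<N. 1 - x * q ^ i) = 0"
      proof -
        have "1 - x * q ^ M' = 0" using q(2) by (simp add: x_def power_int_minus)
        moreover have "M' < N" by (simp add: M Suc)
        ultimately show ?thesis by (intro prod_zero) auto
      qed
      finally show ?thesis by (simp add: q_def M Suc)
    qed
  qed
qed

text \<open>Only the term of q-Hermite degree 0 survives the functional. The value p^(a^2) is the
  weight of the last edge of the chain, which is how the functional replaces the end of the
  sum.\<close>

lemma big_hermite_moment:
  "qpoch (p\<^sup>2) (p\<^sup>2) a * big_hermite p a (\<lambda>k. odd_theta_seq p (k + 1)) 0 = p ^ (a\<^sup>2)"
proof -
  have "big_hermite p a (\<lambda>k. odd_theta_seq p (k + 1)) 0
      = (\<Sum>m\<le>a. if m = a then p ^ (a\<^sup>2) / qpoch (p\<^sup>2) (p\<^sup>2) a else 0)"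
    unfolding big_hermite_def rogers_szego_moment by (intro sum.cong) auto
  also have "\<dots> = p ^ (a\<^sup>2) / qpoch (p\<^sup>2) (p\<^sup>2) a" by simp
  finally show ?thesis using qpoch_nonzero[OF norm_p2[OF norm_p p_nz]] by simp
qed

end

text \<open>The weights p^(l^2) are even in l, so \<open>theta_op\<close> preserves oddness.\<close>

lemma funpow_theta_op_minus:
  assumes "\<And>k. s (- k) = - s k"
  shows "(theta_op p ^^ j) s (- k) = - (theta_op p ^^ j) s k"
proof (induction j arbitrary: k)
  case (Suc j)
  let ?t = "(theta_op p ^^ j) s"
  have "theta_op p ?t (- k) = (\<Sum>\<^sub>\<infinity>l. p powi (l\<^sup>2) * ?t (- k + l))"
    by (simp add: theta_op_def)
  also have "\<dots> = (\<Sum>\<^sub>\<infinity>l. p powi ((- l)\<^sup>2) * ?t (- k + - l))"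
    by (rule infsum_reindex_bij_witness[of _ uminus uminus]) auto
  also have "\<dots> = (\<Sum>\<^sub>\<infinity>l. - (p powi (l\<^sup>2) * ?t (k + l)))"
    using Suc.IH[of "k + _"] by (intro infsum_cong) (simp add: add.commute)
  also have "\<dots> = - theta_op p ?t k"
    by (simp add: theta_op_def infsum_uminus)
  finally show ?case by simp
qed (use assms in simp)

lemma sum_antisymmetric_eq_0:
  fixes e :: "int \<Rightarrow> complex"
  assumes "\<And>k. e (- k) = - e k"
  shows "(\<Sum>i<n. e (int n - 1 - 2 * int i)) = 0"
proof -
  have "(\<Sum>i<n. e (int n - 1 - 2 * int i)) = (\<Sum>i<n. e (- (int n - 1 - 2 * int i)))"
    by (rule sum.reindex_bij_witness[of _ "\<lambda>i. n - 1 - i" "\<lambda>i. n - 1 - i"])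
       (auto simp: of_nat_diff algebra_simps intro!: arg_cong[of _ _ e])
  also have "\<dots> = - (\<Sum>i<n. e (int n - 1 - 2 * int i))"
    by (simp only: assms sum_negf)
  finally show ?thesis by simp
qed

section \<open>The sum over \<open>m\<close> as an iterated kernel\<close>

text \<open>Edge i joins the entries m_i and m_(i+1), with m_0 = m_(2n+1) = 0. The cross terms of
  the shifts by 1 on odd edges add up to the alternating sum of m.\<close>

definition edge_weight :: "complex \<Rightarrow> nat \<Rightarrow> nat \<Rightarrow> nat \<Rightarrow> complex" where
  "edge_weight p i a b = p powi ((int a - int b + (if odd i then 1 else 0))\<^sup>2)"

text \<open>Here i is the current edge, a the entry before it, d the number of entries still to
  come; the final edge leads to the entry 0. The whole vector is passed along although only entries
  beyond i are read, so one entry can be split off by a function update.\<close>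

fun chain_weight :: "complex \<Rightarrow> nat \<Rightarrow> nat \<Rightarrow> nat \<Rightarrow> (nat \<Rightarrow> nat) \<Rightarrow> complex" where
  "chain_weight p 0 i a m = edge_weight p i a 0"
| "chain_weight p (Suc d) i a m =
     edge_weight p i a (m (Suc i)) / qpoch (p\<^sup>2) (p\<^sup>2) (m (Suc i)) * chain_weight p d (Suc i) (m (Suc i)) m"

definition chain_sum :: "complex \<Rightarrow> nat \<Rightarrow> nat \<Rightarrow> nat \<Rightarrow> complex" where
  "chain_sum p d i a = (\<Sum>\<^sub>\<infinity>m\<in>PiE {Suc i..i + d} (\<lambda>_. UNIV). chain_weight p d i a m)"

lemma chain_weight_cong:
  assumes "\<And>t. t > i \<Longrightarrow> m t = m' t"
  shows "chain_weight p d i a m = chain_weight p d i a m'"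
  using assms
proof (induction d arbitrary: i a)
  case (Suc d)
  have "m (Suc i) = m' (Suc i)" using Suc.prems by simp
  then show ?case using Suc.IH[of "Suc i"] Suc.prems by simp
qed simp

lemma bij_betw_PiE_insert:
  assumes "j \<notin> S"
  shows "bij_betw (\<lambda>(b, m). m(j := b)) (UNIV \<times> PiE S (\<lambda>_. UNIV)) (PiE (insert j S) (\<lambda>_. UNIV))"
  by (rule bij_betw_byWitness[where f' = "\<lambda>m. (m j, m(j := undefined))"])
     (use assms in \<open>auto simp: PiE_iff extensional_def fun_eq_iff split: if_splits\<close>)

lemma bij_betw_chain:
  "bij_betw (\<lambda>(b, m). m(Suc i := b)) (UNIV \<times> PiE {Suc (Suc i)..Suc i + d} (\<lambda>_. UNIV))
     (PiE {Suc i..i + Suc d} (\<lambda>_. UNIV))"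
proof -
  have "{Suc i..i + Suc d} = insert (Suc i) {Suc (Suc i)..Suc i + d}" by auto
  then show ?thesis using bij_betw_PiE_insert[of "Suc i" "{Suc (Suc i)..Suc i + d}"] by simp
qed

lemma chain_weight_Suc_upd:
  "chain_weight p (Suc d) i a (m(Suc i := b)) =
     edge_weight p i a b / qpoch (p\<^sup>2) (p\<^sup>2) b * chain_weight p d (Suc i) b m"
  using chain_weight_cong[of "Suc i" "m(Suc i := b)" m] by simp

context
  fixes p :: complex
  assumes norm_p: "norm p < 1" and p_nz: "p \<noteq> 0"
begin

text \<open>The bound G is the full theta series at |p|, independent of edge and starting value. In
  the induction along the chain each summation variable therefore costs only a constant
  factor.\<close>

lemma edge_weight_has_sum:
  "\<exists>G. \<forall>i a. \<exists>S\<le>G. ((\<lambda>b. norm (edge_weight p i a b)) has_sum S) UNIV"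
proof -
  have S: "(\<lambda>l::int. norm p powi (l\<^sup>2)) summable_on UNIV"
    using summable_on_gauss[of "norm p" 1] norm_p by simp
  define G where "G = (\<Sum>\<^sub>\<infinity>l. norm p powi (l\<^sup>2))"
  show ?thesis
  proof (rule exI[of _ G], intro allI)
    fix i a :: nat
    define c where "c = int a + (if odd i then 1 else 0)"
    have inj: "inj (\<lambda>b. c - int b)" by (auto simp: inj_on_def)
    have S': "(\<lambda>l::int. norm p powi (l\<^sup>2)) summable_on range (\<lambda>b. c - int b)"
      by (rule summable_on_subset_banach[OF S]) simp
    have eq: "(\<lambda>b. norm (edge_weight p i a b)) = (\<lambda>l. norm p powi (l\<^sup>2)) \<circ> (\<lambda>b. c - int b)"
      by (auto simp: edge_weight_def c_def norm_power_int algebra_simps)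
    have "((\<lambda>b. norm (edge_weight p i a b)) has_sum infsum (\<lambda>l. norm p powi (l\<^sup>2)) (range (\<lambda>b. c - int b))) UNIV"
      unfolding eq using has_sum_infsum[OF S'] by (subst (asm) has_sum_reindex[OF inj])
    moreover have "infsum (\<lambda>l. norm p powi (l\<^sup>2)) (range (\<lambda>b. c - int b)) \<le> G"
      unfolding G_def by (rule infsum_mono2[OF S' S]) auto
    ultimately show "\<exists>S\<le>G. ((\<lambda>b. norm (edge_weight p i a b)) has_sum S) UNIV" by blast
  qed
qed

lemma chain_weight_norm_has_sum:
  "\<exists>M. \<forall>i a. \<exists>S\<le>M. ((\<lambda>m. norm (chain_weight p d i a m)) has_sum S) (PiE {Suc i..i + d} (\<lambda>_. UNIV))"
proof (induction d)
  case 0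
  have "norm (edge_weight p i a 0) \<le> 1" for i a
  proof -
    have "norm p ^ nat x \<le> 1" for x using norm_p by (intro power_le_one) auto
    then show ?thesis by (simp add: edge_weight_def norm_power_int norm_power power_int_def)
  qed
  then have "\<exists>S\<le>1. ((\<lambda>m. norm (chain_weight p 0 i a m)) has_sum S) (PiE {Suc i..i + 0} (\<lambda>_. UNIV))" for i a
    by (intro exI[of _ "norm (edge_weight p i a 0)"]) (auto intro!: has_sum_finiteI)
  then show ?case by blast
next
  case (Suc d)
  then obtain M where M: "\<And>i a. \<exists>S\<le>M. ((\<lambda>m. norm (chain_weight p d i a m)) has_sum S) (PiE {Suc i..i + d} (\<lambda>_. UNIV))"
    by blast
  obtain G where G: "\<And>i a. \<exists>S\<le>G. ((\<lambda>b. norm (edge_weight p i a b)) has_sum S) UNIV"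
    using edge_weight_has_sum by blast
  obtain C where C: "C \<ge> 1" "\<And>m. norm (1 / qpoch (p\<^sup>2) (p\<^sup>2) m) \<le> C"
    using inverse_qpoch_bounded[OF norm_p2[OF norm_p p_nz]] by blast
  have M0: "M \<ge> 0" using M[of 0 0] has_sum_nonneg by (metis norm_ge_zero order_trans)
  show ?case
  proof (rule exI[of _ "G * (C * M)"], intro allI)
    fix i a
    obtain S where S: "\<And>b. S b \<le> M"
      "\<And>b. ((\<lambda>m. norm (chain_weight p d (Suc i) b m)) has_sum S b) (PiE {Suc (Suc i)..Suc i + d} (\<lambda>_. UNIV))"
      using M[of "Suc i"] by metis
    have S0: "S b \<ge> 0" for b by (rule has_sum_nonneg[OF S(2)]) auto
    obtain E where E: "E \<le> G" "((\<lambda>b. norm (edge_weight p i a b)) has_sum E) UNIV" using G by blast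
    define h where "h b = norm (edge_weight p i a b) * norm (1 / qpoch (p\<^sup>2) (p\<^sup>2) b) * S b" for b
    have h: "h b \<le> norm (edge_weight p i a b) * (C * M)" for b
      unfolding h_def mult.assoc using C S(1)[of b] S0[of b] by (intro mult_left_mono mult_mono) auto
    have h0: "h b \<ge> 0" for b using S0 by (simp add: h_def)
    let ?f = "\<lambda>(b, m). norm (edge_weight p i a b) * norm (1 / qpoch (p\<^sup>2) (p\<^sup>2) b) * norm (chain_weight p d (Suc i) b m)"
    let ?D = "PiE {Suc (Suc i)..Suc i + d} (\<lambda>_. UNIV :: nat set)"
    have hs: "h summable_on UNIV"
      by (rule summable_on_dominated[OF summable_on_cmult_left[OF has_sum_imp_summable[OF E(2)]]])
         (use h h0 in auto)
    have inner: "((\<lambda>m. ?f (b, m)) has_sum h b) ?D" for b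
      unfolding prod.case h_def by (rule has_sum_cmult_right[OF S(2)])
    have fs: "?f summable_on UNIV \<times> ?D"
      by (rule summable_on_SigmaI[OF inner hs]) auto
    have "(?f has_sum infsum ?f (UNIV \<times> ?D)) (UNIV \<times> ?D)"
      by (rule has_sum_infsum[OF fs])
    moreover have "infsum ?f (UNIV \<times> ?D) = infsum h UNIV"
      unfolding infsum_Sigma_banach[OF fs, symmetric] using infsumI[OF inner] by simp
    moreover have "?f = (\<lambda>m. norm (chain_weight p (Suc d) i a m)) \<circ> (\<lambda>(b, m). m(Suc i := b))"
      unfolding comp_def case_prod_beta chain_weight_Suc_upd
      by (simp add: fun_eq_iff norm_mult norm_divide)
    ultimately have "((\<lambda>m. norm (chain_weight p (Suc d) i a m)) has_sum infsum h UNIV) (PiE {Suc i..i + Suc d} (\<lambda>_. UNIV))"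
      using has_sum_reindex_bij_betw[OF bij_betw_chain[of i d], of "\<lambda>m. norm (chain_weight p (Suc d) i a m)" "infsum h UNIV"]
      by (simp only: comp_def)
    moreover have "infsum h UNIV \<le> E * (C * M)"
      by (rule has_sum_mono[OF has_sum_infsum[OF hs] has_sum_cmult_left[OF E(2)]]) (rule h)
    moreover have "E * (C * M) \<le> G * (C * M)"
      using E(1) C(1) M0 by (intro mult_right_mono) auto
    ultimately show "\<exists>S\<le>G * (C * M). ((\<lambda>m. norm (chain_weight p (Suc d) i a m)) has_sum S) (PiE {Suc i..i + Suc d} (\<lambda>_. UNIV))"
      by (intro exI[of _ "infsum h UNIV"] conjI) (rule order_trans)
  qed
qed

lemma chain_weight_summable: "(\<lambda>m. chain_weight p d i a m) summable_on PiE {Suc i..i + d} (\<lambda>_. UNIV)"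
proof -
  obtain S where "((\<lambda>m. norm (chain_weight p d i a m)) has_sum S) (PiE {Suc i..i + d} (\<lambda>_. UNIV))"
    using chain_weight_norm_has_sum[of d] by blast
  then show ?thesis by (rule abs_summable_summable[OF has_sum_imp_summable])
qed

lemma chain_sum_Suc:
  "chain_sum p (Suc d) i a =
     (\<Sum>\<^sub>\<infinity>b. edge_weight p i a b / qpoch (p\<^sup>2) (p\<^sup>2) b * chain_sum p d (Suc i) b)"
proof -
  let ?D = "PiE {Suc (Suc i)..Suc i + d} (\<lambda>_. UNIV :: nat set)"
  let ?f = "\<lambda>(b, m). edge_weight p i a b / qpoch (p\<^sup>2) (p\<^sup>2) b * chain_weight p d (Suc i) b m"
  have eq: "(\<lambda>x. chain_weight p (Suc d) i a ((\<lambda>(b, m). m(Suc i := b)) x)) = ?f"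
    unfolding case_prod_beta chain_weight_Suc_upd ..
  have "(\<lambda>x. chain_weight p (Suc d) i a ((\<lambda>(b, m). m(Suc i := b)) x)) summable_on UNIV \<times> ?D"
    using chain_weight_summable[of "Suc d" i a] by (subst summable_on_reindex_bij_betw[OF bij_betw_chain])
  then have fs: "?f summable_on UNIV \<times> ?D" unfolding eq .
  have "chain_sum p (Suc d) i a = infsum ?f (UNIV \<times> ?D)"
    unfolding chain_sum_def infsum_reindex_bij_betw[OF bij_betw_chain, symmetric] eq ..
  also have "\<dots> = (\<Sum>\<^sub>\<infinity>b. \<Sum>\<^sub>\<infinity>m\<in>?D. ?f (b, m))"
    by (rule infsum_Sigma_banach[OF fs, symmetric])
  finally show ?thesis unfolding prod.case infsum_cmult_right' chain_sum_def .
qed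

section \<open>Evaluating the chain by alternating odd and even edges\<close>

private abbreviation "Qinf \<equiv> qpoch_inf (p\<^sup>2) (p\<^sup>2)"

private definition P :: "nat \<Rightarrow> (int \<Rightarrow> complex) \<Rightarrow> complex" where
  "P a s = qpoch (p\<^sup>2) (p\<^sup>2) a * big_hermite p a s 0"

text \<open>The companion of \<open>P\<close> of degree one lower. Its normalisation by (q)_a
  instead of (q)_(a-1) absorbs the coefficient 1 - q^a of the three-term recurrence.\<close>

private definition P' :: "nat \<Rightarrow> (int \<Rightarrow> complex) \<Rightarrow> complex" where
  "P' a s = (if a = 0 then 0 else qpoch (p\<^sup>2) (p\<^sup>2) a * big_hermite p (a - 1) s 0)"

text \<open>The shift on an odd edge means that the Gaussian transform is taken at a + 1. For the
  companion of degree b - 1 the shift cancels against the index and leaves a.\<close>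

private lemma odd_edge_sum:
  assumes s: "\<And>k. norm (s k) \<le> B" and t: "\<And>k. norm (t k) \<le> B'" and i: "odd i"
  shows "(\<Sum>\<^sub>\<infinity>b. edge_weight p i a b / qpoch (p\<^sup>2) (p\<^sup>2) b * (P b s - P' b t))
     = (P (Suc a) (theta_op p s) - P a (theta_op p t)) / Qinf"
proof -
  note q = norm_p2[OF norm_p p_nz]
  define W where "W b = p powi ((int a + 1 - int b)\<^sup>2)" for b
  have 1: "((\<lambda>b. W b * big_hermite p b s 0) has_sum gauss_transform p s (int a + 1) 0) UNIV"
    unfolding gauss_transform_def W_def
    by (rule has_sum_infsum[OF gauss_transform_summable[OF norm_p p_nz s]])
  have "((\<lambda>b. p powi ((int a - int b)\<^sup>2) * big_hermite p b t 0) has_sum gauss_transform p t (int a) 0) UNIV"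
    unfolding gauss_transform_def
    by (rule has_sum_infsum[OF gauss_transform_summable[OF norm_p p_nz t]])
  then have 2: "((\<lambda>b. W b * (if b = 0 then 0 else big_hermite p (b - 1) t 0)) has_sum gauss_transform p t (int a) 0) UNIV"
    by (intro has_sum_Suc[where f = "\<lambda>b. W b * (if b = 0 then 0 else big_hermite p (b - 1) t 0)"])
       (simp_all add: W_def)
  have "edge_weight p i a b / qpoch (p\<^sup>2) (p\<^sup>2) b * (P b s - P' b t)
      = W b * big_hermite p b s 0 - W b * (if b = 0 then 0 else big_hermite p (b - 1) t 0)" for b
  proof -
    have "edge_weight p i a b = W b" using i by (simp add: edge_weight_def W_def algebra_simps)
    then show ?thesis using qpoch_nonzero[OF q, of b] by (simp add: P_def P'_def field_simps)
  qed
  then have "(\<Sum>\<^sub>\<infinity>b. edge_weight p i a b / qpoch (p\<^sup>2) (p\<^sup>2) b * (P b s - P' b t))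
    = gauss_transform p s (int (Suc a)) 0 - gauss_transform p t (int a) 0"
    using infsumI[OF has_sum_minus[OF 1 2]] by (simp add: add.commute)
  also have "\<dots> = (P (Suc a) (theta_op p s) - P a (theta_op p t)) / Qinf"
    unfolding gauss_transform_eigen[OF norm_p p_nz s] gauss_transform_eigen[OF norm_p p_nz t] P_def
    by (simp add: diff_divide_distrib)
  finally show ?thesis .
qed

text \<open>The quotient (q)_(b+1)/(q)_b = 1 - q^(b+1) leads to
  \<open>gauss_transform_shift\<close>, and the recurrence then lowers the degree a + 1 to a. The
  price is the operator z + 1/z and a companion term, so the pair has the shape required by the next
  odd edge.\<close>

private lemma even_edge_sum:
  assumes s: "\<And>k. norm (s k) \<le> B" and t: "\<And>k. norm (t k) \<le> B'" and i: "even i"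
  shows "(\<Sum>\<^sub>\<infinity>b. edge_weight p i a b / qpoch (p\<^sup>2) (p\<^sup>2) b * (P (Suc b) s - P b t))
     = (P a (\<lambda>k. theta_op p s (k + 1) + theta_op p s (k - 1) - theta_op p t k) - P' a (theta_op p s)) / Qinf"
proof -
  note q = norm_p2[OF norm_p p_nz]
  define W where "W b = p powi ((int a - int b)\<^sup>2)" for b
  define c where "c n = qpoch (p\<^sup>2) (p\<^sup>2) n" for n
  have c: "c n \<noteq> 0" "c (Suc n) = c n * (1 - p ^ (2 * Suc n))" for n
    using qpoch_nonzero[OF q, of n] by (simp_all only: c_def qpoch_Suc power_mult) simp
  have 1: "((\<lambda>b. W b * ((1 - p ^ (2 * Suc b)) * big_hermite p (Suc b) s 0))
    has_sum gauss_transform p s (int a + 1) 0 - p powi (2 * int a + 1) * gauss_transform p s (int a) 0) UNIV"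
    unfolding W_def by (rule gauss_transform_shift[OF norm_p p_nz s])
  have 2: "((\<lambda>b. W b * big_hermite p b t 0) has_sum gauss_transform p t (int a) 0) UNIV"
    unfolding gauss_transform_def W_def
    by (rule has_sum_infsum[OF gauss_transform_summable[OF norm_p p_nz t]])
  have "edge_weight p i a b / qpoch (p\<^sup>2) (p\<^sup>2) b * (P (Suc b) s - P b t)
      = W b * ((1 - p ^ (2 * Suc b)) * big_hermite p (Suc b) s 0) - W b * big_hermite p b t 0" for b
  proof -
    have "edge_weight p i a b = W b" using i by (simp add: edge_weight_def W_def)
    then show ?thesis using c(1)[of b] unfolding P_def c_def[symmetric] c(2) by (simp add: field_simps)
  qed
  then have "(\<Sum>\<^sub>\<infinity>b. edge_weight p i a b / qpoch (p\<^sup>2) (p\<^sup>2) b * (P (Suc b) s - P b t))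
    = gauss_transform p s (int a + 1) 0 - p powi (2 * int a + 1) * gauss_transform p s (int a) 0
        - gauss_transform p t (int a) 0"
    using infsumI[OF has_sum_minus[OF 1 2]] by simp
  also have "\<dots> = gauss_transform p s (int a) 1 + gauss_transform p s (int a) (-1)
      - gauss_transform p t (int a) 0 - (1 - p powi (2 * int a)) * gauss_transform p s (int a - 1) 0"
    using gauss_transform_rec[OF norm_p p_nz s, where a = "int a" and k = 0] by simp
  also have "(1 - p powi (2 * int a)) * gauss_transform p s (int a - 1) 0 = P' a (theta_op p s) / Qinf"
  proof (cases a)
    case (Suc d)
    have "p powi (2 * int a) = p ^ (2 * Suc d)" by (simp add: Suc power_int_def nat_add_distrib nat_mult_distrib)
    moreover have "int a - 1 = int d" by (simp add: Suc)
    ultimately show ?thesis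
      using gauss_transform_eigen[OF norm_p p_nz s, where a = d and k = 0] c(2)[of d] by (simp add: P'_def Suc c_def)
  qed (simp add: P'_def)
  also have "gauss_transform p s (int a) 1 + gauss_transform p s (int a) (-1) - gauss_transform p t (int a) 0
     = P a (\<lambda>k. theta_op p s (k + 1) + theta_op p s (k - 1) - theta_op p t k) / Qinf"
    unfolding gauss_transform_eigen[OF norm_p p_nz s] gauss_transform_eigen[OF norm_p p_nz t] P_def
    by (simp add: big_hermite_def rogers_szego_def sum.distrib sum_subtractf sum_distrib_left
        add_divide_distrib diff_divide_distrib algebra_simps)
  finally show ?thesis by (simp add: diff_divide_distrib)
qed

private definition T :: "nat \<Rightarrow> int \<Rightarrow> complex" where
  "T j = (theta_op p ^^ (2 * j)) (\<lambda>k. odd_theta_seq p (k + 1))"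

lemma funpow_theta_op_bounded:
  assumes "\<And>k. norm (s k) \<le> B"
  shows "\<exists>B'. \<forall>k. norm ((theta_op p ^^ j) s k) \<le> B'"
proof (induction j)
  case (Suc j)
  then obtain B' where "\<And>k. norm ((theta_op p ^^ j) s k) \<le> B'" by blast
  from theta_op_bounded[OF norm_p p_nz this] show ?case by simp
qed (use assms in auto)

lemma cheb_sum_bounded:
  assumes "\<And>k. norm (s k) \<le> B"
  shows "norm (cheb_sum j s k) \<le> real j * B"
proof -
  have "norm (cheb_sum j s k) \<le> (\<Sum>i<j. B)" unfolding cheb_sum_def by (rule sum_norm_le) (rule assms)
  then show ?thesis by simp
qed

text \<open>Two more edges multiply by the square of \<theta> and replace the pair (U_j, U_(j-1)) of
  Chebyshev polynomials by ((z + 1/z) U_j - U_(j-1), U_j). The start is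
  \<open>big_hermite_moment\<close>. Only the parity of the edge i matters, hence the generalisation
  over i.\<close>

private lemma chain_sum_even:
  "even i \<Longrightarrow> chain_sum p (2 * j) i a = (P a (cheb_sum (Suc j) (T j)) - P' a (cheb_sum j (T j))) / Qinf ^ (2 * j)"
proof (induction j arbitrary: i a)
  case 0
  have "cheb_sum (Suc 0) (T 0) = (\<lambda>k. odd_theta_seq p (k + 1))" "cheb_sum 0 (T 0) = (\<lambda>k. 0)"
    by (auto simp: cheb_sum_def T_def)
  moreover have "P' a (\<lambda>k. 0) = 0" by (simp add: P'_def big_hermite_def rogers_szego_def)
  ultimately show ?case
    using 0 big_hermite_moment[OF norm_p p_nz, of a]
    by (simp add: chain_sum_def edge_weight_def P_def power_int_def nat_power_eq)
next
  case (Suc j)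
  obtain B where B: "\<And>k. norm (T j k) \<le> B"
    using funpow_theta_op_bounded[of "\<lambda>k. odd_theta_seq p (k + 1)" 1 "2 * j"] norm_odd_theta_seq_le[OF norm_p]
    unfolding T_def by blast
  obtain B1 where B1: "\<And>k. norm (theta_op p (T j) k) \<le> B1"
    using theta_op_bounded[OF norm_p p_nz, of "T j" B] B by blast
  have T_Suc: "T (Suc j) = theta_op p (theta_op p (T j))" by (simp add: T_def)
  let ?s = "cheb_sum (Suc j) (T j)" and ?t = "cheb_sum j (T j)"
  have th: "theta_op p (cheb_sum l (T j)) = cheb_sum l (theta_op p (T j))"
     "theta_op p (cheb_sum l (theta_op p (T j))) = cheb_sum l (T (Suc j))" for l
    using theta_op_cheb_sum[OF norm_p p_nz B] theta_op_cheb_sum[OF norm_p p_nz B1] by (auto simp: T_Suc)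
  have 1: "chain_sum p (Suc (2 * j)) (Suc i) b =
      (P (Suc b) (theta_op p ?s) - P b (theta_op p ?t)) / Qinf / Qinf ^ (2 * j)" for b
  proof -
    have "chain_sum p (Suc (2 * j)) (Suc i) b = (\<Sum>\<^sub>\<infinity>c. edge_weight p (Suc i) b c / qpoch (p\<^sup>2) (p\<^sup>2) c *
        (P c ?s - P' c ?t) * (1 / Qinf ^ (2 * j)))"
      unfolding chain_sum_Suc using Suc by simp
    also have "\<dots> = (P (Suc b) (theta_op p ?s) - P b (theta_op p ?t)) / Qinf * (1 / Qinf ^ (2 * j))"
      unfolding infsum_cmult_left' using Suc.prems
      by (subst odd_edge_sum[OF cheb_sum_bounded[OF B] cheb_sum_bounded[OF B]]) simp_all
    finally show ?thesis by simp
  qed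
  have "chain_sum p (2 * Suc j) i a = (\<Sum>\<^sub>\<infinity>b. edge_weight p i a b / qpoch (p\<^sup>2) (p\<^sup>2) b *
      (P (Suc b) (theta_op p ?s) - P b (theta_op p ?t)) * (1 / Qinf / Qinf ^ (2 * j)))"
    using chain_sum_Suc[of "Suc (2 * j)" i a] 1 by simp
  also have "\<dots> = (P a (\<lambda>k. theta_op p (theta_op p ?s) (k + 1) + theta_op p (theta_op p ?s) (k - 1)
      - theta_op p (theta_op p ?t) k) - P' a (theta_op p (theta_op p ?s))) / Qinf * (1 / Qinf / Qinf ^ (2 * j))"
    unfolding infsum_cmult_left' th(1)
    by (subst even_edge_sum[OF cheb_sum_bounded[OF B1] cheb_sum_bounded[OF B1] Suc.prems]) simp
  also have "\<dots> = (P a (cheb_sum (Suc (Suc j)) (T (Suc j))) - P' a (cheb_sum (Suc j) (T (Suc j)))) / Qinf ^ (2 * Suc j)"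
    unfolding th cheb_sum_Suc_Suc[abs_def] by (simp add: power2_eq_square)
  finally show ?case .
qed

text \<open>At a = 0 the companion vanishes and U_n becomes the sum of the coefficients at n + 1, n
  - 1, ..., 1 - n. Oddness cancels all of them but the first.\<close>

theorem chain_sum_eq:
  "chain_sum p (2 * n) 0 0 = (theta_op p ^^ (2 * n)) (odd_theta_seq p) (int n + 1) / Qinf ^ (2 * n)"
proof -
  define e where "e = (theta_op p ^^ (2 * n)) (odd_theta_seq p)"
  have shift: "(theta_op p ^^ j) (\<lambda>k. s (k + 1)) = (\<lambda>k. (theta_op p ^^ j) s (k + 1))" for j s
    by (induction j) (auto simp: theta_op_shift[OF norm_p p_nz])
  have e: "e (- k) = - e k" for k
    unfolding e_def by (rule funpow_theta_op_minus) (rule odd_theta_seq_minus)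
  have "chain_sum p (2 * n) 0 0 = cheb_sum (Suc n) (T n) 0 / Qinf ^ (2 * n)"
    by (simp add: chain_sum_even P_def P'_def big_hermite_def rogers_szego_def)
  also have "cheb_sum (Suc n) (T n) 0 = (\<Sum>i<Suc n. e (int n + 1 - 2 * int i))"
    by (simp add: cheb_sum_def T_def shift e_def algebra_simps)
  also have "\<dots> = e (int n + 1) + (\<Sum>i<n. e (int n - 1 - 2 * int i))"
    by (subst sum.lessThan_Suc_shift) (simp add: algebra_simps)
  also have "(\<Sum>i<n. e (int n - 1 - 2 * int i)) = 0"
    by (rule sum_antisymmetric_eq_0[of e n]) (rule e)
  finally show ?thesis by (simp add: e_def)
qed

end

section \<open>Matching the chain exponent with the quadratic form\<close>

lemma lhs_exponent_partial:
  fixes y :: "nat \<Rightarrow> int"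
  assumes "y 0 = 0"
  shows "(\<Sum>t<k. (y t - y (Suc t) + (if odd t then 1 else 0))\<^sup>2) =
     2 * ((\<Sum>i=1..k. (y i)\<^sup>2) - (\<Sum>i=1..<k. y i * y (i + 1))) - (y k)\<^sup>2
      + 2 * (\<Sum>i=1..k. (-1) ^ (i - 1) * y i) - 2 * (if odd k then y k else 0) + int (k div 2)"
\<comment> \<open>The terms in y k alone describe the open end of the partial chain. For k = 2n they
  leave only -(y k)^2, which the last edge to 0 restores, and the squared shifts add n.\<close>
proof (induction k)
  case (Suc k)
  have "(\<Sum>i=1..<Suc k. y i * y (i + 1)) = (\<Sum>i=1..<k. y i * y (i + 1)) + y k * y (Suc k)"
    using assms by (cases k) auto
  then show ?case using Suc.IH
    by (cases "even k") (auto elim!: evenE oddE simp: power2_eq_square algebra_simps)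
qed (simp add: assms)

fun chain_exponent :: "nat \<Rightarrow> nat \<Rightarrow> nat \<Rightarrow> (nat \<Rightarrow> nat) \<Rightarrow> int" where
  "chain_exponent 0 i a m = (int a + (if odd i then 1 else 0))\<^sup>2"
| "chain_exponent (Suc d) i a m =
     (int a - int (m (Suc i)) + (if odd i then 1 else 0))\<^sup>2 + chain_exponent d (Suc i) (m (Suc i)) m"

lemma chain_weight_eq:
  assumes "p \<noteq> 0"
  shows "chain_weight p d i a m = p powi chain_exponent d i a m / (\<Prod>t=Suc i..i + d. qpoch (p\<^sup>2) (p\<^sup>2) (m t))"
proof (induction d arbitrary: i a)
  case (Suc d)
  have "{Suc i..i + Suc d} = insert (Suc i) {Suc (Suc i)..Suc i + d}" by auto
  then have "(\<Prod>t=Suc i..i + Suc d. qpoch (p\<^sup>2) (p\<^sup>2) (m t))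
     = qpoch (p\<^sup>2) (p\<^sup>2) (m (Suc i)) * (\<Prod>t=Suc (Suc i)..Suc i + d. qpoch (p\<^sup>2) (p\<^sup>2) (m t))"
    by simp
  then show ?case using assms Suc.IH[of "Suc i" "m (Suc i)"]
    by (simp add: edge_weight_def power_int_add)
qed (simp add: edge_weight_def)

lemma chain_exponent_eq:
  assumes "\<And>t. i < t \<Longrightarrow> t \<le> i + d \<Longrightarrow> y t = int (m t)" "y i = int a" "y (Suc (i + d)) = 0"
  shows "chain_exponent d i a m = (\<Sum>t=i..<Suc (i + d). (y t - y (Suc t) + (if odd t then 1 else 0))\<^sup>2)"
  using assms
proof (induction d arbitrary: i a)
  case (Suc d)
  have "chain_exponent d (Suc i) (m (Suc i)) m
     = (\<Sum>t=Suc i..<Suc (Suc i + d). (y t - y (Suc t) + (if odd t then 1 else 0))\<^sup>2)"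
    using Suc.prems by (intro Suc.IH) auto
  moreover have "y (Suc i) = int (m (Suc i))" using Suc.prems by simp
  ultimately show ?case using Suc.prems by (simp add: sum.atLeast_Suc_lessThan)
qed simp

lemma chain_exponent_0: "chain_exponent (2 * n) 0 0 m = 2 * lhs_exponent (2 * n) m + int n"
proof -
  define y where "y t = (if 1 \<le> t \<and> t \<le> 2 * n then int (m t) else 0)" for t
  have lhs: "lhs_exponent (2 * n) m = (\<Sum>i=1..2 * n. (y i)\<^sup>2) - (\<Sum>i=1..<2 * n. y i * y (i + 1))
      + (\<Sum>i=1..2 * n. (-1) ^ (i - 1) * y i)"
  proof -
    have "(\<Sum>i=1..2 * n. (int (m i))\<^sup>2) = (\<Sum>i=1..2 * n. (y i)\<^sup>2)"
      "(\<Sum>i=1..<2 * n. int (m i) * int (m (i + 1))) = (\<Sum>i=1..<2 * n. y i * y (i + 1))"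
      "alt_sum (2 * n) m = (\<Sum>i=1..2 * n. (-1) ^ (i - 1) * y i)"
      unfolding alt_sum_def by (auto simp: y_def intro!: sum.cong)
    then show ?thesis by (simp add: lhs_exponent_def cartan_form_eq)
  qed
  have "chain_exponent (2 * n) 0 0 m = (\<Sum>t=0..<Suc (0 + 2 * n). (y t - y (Suc t) + (if odd t then 1 else 0))\<^sup>2)"
    by (rule chain_exponent_eq) (auto simp: y_def)
  also have "\<dots> = (\<Sum>t<2 * n. (y t - y (Suc t) + (if odd t then 1 else 0))\<^sup>2) + (y (2 * n))\<^sup>2"
    by (simp add: atLeast0LessThan y_def)
  also have "\<dots> = 2 * lhs_exponent (2 * n) m + int n"
    unfolding lhs by (subst lhs_exponent_partial) (auto simp: y_def)
  finally show ?thesis .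
qed

text \<open>Every integer is at most its square. The differences telescope to 0 and the shifts add
  up to n, which is precisely the constant in \<open>chain_exponent_0\<close>. Hence
  \<open>powi\<close> is an ordinary power, also at q = 0.\<close>

lemma lhs_exponent_nonneg: "lhs_exponent (2 * n) m \<ge> 0"
proof -
  define y where "y t = (if 1 \<le> t \<and> t \<le> 2 * n then int (m t) else 0)" for t
  define o' where "o' t = (if odd t then 1 else 0 :: int)" for t :: nat
  have "chain_exponent (2 * n) 0 0 m = (\<Sum>t=0..<Suc (0 + 2 * n). (y t - y (Suc t) + (if odd t then 1 else 0))\<^sup>2)"
    by (rule chain_exponent_eq) (auto simp: y_def)
  also have "\<dots> \<ge> (\<Sum>t<Suc (2 * n). (y t - y (Suc t)) + o' t)"
  proof -
    have "x \<le> x\<^sup>2" for x :: int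
      using mult_left_mono[of 1 x x] by (cases "x \<ge> 1") (auto simp: power2_eq_square intro: order_trans[OF _ zero_le_square])
    then show ?thesis unfolding atLeast0LessThan add_0 by (intro sum_mono) (auto simp: o'_def)
  qed
  moreover have "(\<Sum>t<Suc (2 * n). (y t - y (Suc t)) + o' t) = int n"
  proof -
    have "(\<Sum>t<Suc (2 * n). y t - y (Suc t)) = 0"
      by (subst sum_lessThan_telescope') (auto simp: y_def)
    moreover have "(\<Sum>t<Suc (2 * n). o' t) = int n" by (induction n) (auto simp: o'_def)
    ultimately show ?thesis unfolding sum.distrib by simp
  qed
  ultimately show ?thesis using chain_exponent_0[of n m] by simp
qed

theorem fermionic_sum:
  assumes norm_p: "norm p < 1" and p_nz: "p \<noteq> 0"
  shows "((\<lambda>m. (p\<^sup>2) powi lhs_exponent (2 * n) m / qpoch_vec (2 * n) (p\<^sup>2) m) has_sum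
     (theta_op p ^^ (2 * n)) (odd_theta_seq p) (int n + 1) / (p ^ n * qpoch_inf (p\<^sup>2) (p\<^sup>2) ^ (2 * n)))
     (nat_vecs (2 * n))"
proof -
  have "(p\<^sup>2) powi lhs_exponent (2 * n) m / qpoch_vec (2 * n) (p\<^sup>2) m
      = 1 / p ^ n * chain_weight p (2 * n) 0 0 m" for m
  proof -
    have "p powi chain_exponent (2 * n) 0 0 m = (p\<^sup>2) powi lhs_exponent (2 * n) m * p ^ n"
      using p_nz unfolding chain_exponent_0 by (simp add: power_int_add power_int_mult)
    then show ?thesis using p_nz chain_weight_eq[OF p_nz, of "2 * n" 0 0 m]
      by (simp add: qpoch_vec_def)
  qed
  moreover have "((\<lambda>m. 1 / p ^ n * chain_weight p (2 * n) 0 0 m) has_sum 1 / p ^ n * chain_sum p (2 * n) 0 0)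
     (nat_vecs (2 * n))"
    using has_sum_cmult_right[OF has_sum_infsum[OF chain_weight_summable[OF norm_p p_nz, of "2 * n" 0 0]],
        where c = "1 / p ^ n"]
    unfolding chain_sum_def by simp
  ultimately show ?thesis
    unfolding chain_sum_eq[OF norm_p p_nz] by simp
qed


section \<open>Moments of theta series\<close>

text \<open>Absolute convergence of the Laurent series on the whole punctured plane. All moments
  then exist, and the class is closed under convolution.\<close>

definition rapidly_decreasing :: "(int \<Rightarrow> complex) \<Rightarrow> bool" where
  "rapidly_decreasing s \<longleftrightarrow> (\<forall>R\<ge>0. (\<lambda>k. norm (s k) * R ^ nat \<bar>k\<bar>) summable_on UNIV)"

definition conv_seq :: "(int \<Rightarrow> complex) \<Rightarrow> (int \<Rightarrow> complex) \<Rightarrow> int \<Rightarrow> complex" where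
  "conv_seq t s k = (\<Sum>\<^sub>\<infinity>l. t l * s (k - l))"

text \<open>The Taylor series at u = 0 of e^(cu) times the Laurent series at z = e^u. Thus
  convolution becomes multiplication while the centres c add, and a zero at z = 1 becomes a run of
  vanishing coefficients.\<close>

definition moment_fps :: "complex \<Rightarrow> (int \<Rightarrow> complex) \<Rightarrow> complex fps" where
  "moment_fps c s = Abs_fps (\<lambda>j. (\<Sum>\<^sub>\<infinity>k. s k * (of_int k + c) ^ j) / fact j)"

lemma summable_on_Times_mult:
  fixes f :: "'a \<Rightarrow> real" and g :: "'b \<Rightarrow> real"
  assumes "f summable_on A" "g summable_on B" "\<And>x. f x \<ge> 0" "\<And>y. g y \<ge> 0"
  shows "(\<lambda>(x, y). f x * g y) summable_on A \<times> B"
proof (rule summable_on_SigmaI)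
  show "((\<lambda>y. case (x, y) of (x, y) \<Rightarrow> f x * g y) has_sum f x * infsum g B) B" for x
    using has_sum_cmult_right[OF has_sum_infsum[OF assms(2)]] by simp
  show "(\<lambda>x. f x * infsum g B) summable_on A"
    by (rule summable_on_cmult_left[OF assms(1)])
qed (use assms in auto)

lemma power_le_fact_exp:
  fixes x :: real
  assumes "x \<ge> 0"
  shows "x ^ j \<le> fact j * exp x"
proof -
  have "(\<Sum>n\<in>{j}. x ^ n /\<^sub>R fact n) \<le> (\<Sum>n. x ^ n /\<^sub>R fact n)"
    using assms by (intro sum_le_suminf summable_exp_generic) auto
  then show ?thesis by (simp add: exp_def field_simps)
qed

lemma moment_summable:
  assumes "rapidly_decreasing s"
  shows "(\<lambda>k. s k * (of_int k + c) ^ j) summable_on UNIV"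
proof -
  have S: "(\<lambda>k. norm (s k) * exp 1 ^ nat \<bar>k\<bar>) summable_on UNIV"
    using assms by (auto simp: rapidly_decreasing_def)
  show ?thesis
  proof (rule summable_on_dominated[OF summable_on_cmult_right[OF S]])
    fix k :: int
    have "norm (of_int k + c) ^ j \<le> fact j * exp (norm (of_int k + c))"
      by (rule power_le_fact_exp) simp
    also have "\<dots> \<le> fact j * exp (norm c + real (nat \<bar>k\<bar>))"
      using norm_triangle_ineq[of "of_int k" c] by simp
    also have "\<dots> = fact j * exp (norm c) * exp 1 ^ nat \<bar>k\<bar>"
      by (simp add: exp_add exp_of_nat_mult[symmetric])
    finally have "norm (s k) * norm (of_int k + c) ^ j \<le> norm (s k) * (fact j * exp (norm c) * exp 1 ^ nat \<bar>k\<bar>)"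
      by (intro mult_left_mono) auto
    then show "norm (s k * (of_int k + c) ^ j) \<le> fact j * exp (norm c) * (norm (s k) * exp 1 ^ nat \<bar>k\<bar>)"
      by (simp add: norm_mult norm_power mult_ac)
  qed
qed

lemma bij_betw_shear: "bij_betw (\<lambda>(l, k). (l, k - l)) (UNIV :: (int \<times> int) set) UNIV"
  by (rule bij_betw_byWitness[where f' = "\<lambda>(l, k). (l, k + l)"]) auto

lemma rapidly_decreasing_conv_aux:
  assumes "rapidly_decreasing t" "rapidly_decreasing s" "R \<ge> 1"
  shows "(\<lambda>(l, k). norm (t l * s (k - l)) * R ^ nat \<bar>k\<bar>) summable_on UNIV"
proof -
  have "(\<lambda>(l, k). (norm (t l) * R ^ nat \<bar>l\<bar>) * (norm (s k) * R ^ nat \<bar>k\<bar>)) summable_on UNIV \<times> UNIV"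
    by (rule summable_on_Times_mult) (use assms in \<open>auto simp: rapidly_decreasing_def\<close>)
  then have "(\<lambda>x. (\<lambda>(l, k). (norm (t l) * R ^ nat \<bar>l\<bar>) * (norm (s k) * R ^ nat \<bar>k\<bar>)) ((\<lambda>(l, k). (l, k - l)) x)) summable_on UNIV"
    by (subst summable_on_reindex_bij_betw[OF bij_betw_shear]) simp
  then show ?thesis
  proof (rule summable_on_dominated)
    fix x :: "int \<times> int"
    obtain l k where x: "x = (l, k)" by (cases x)
    have "R ^ nat \<bar>k\<bar> \<le> R ^ (nat \<bar>l\<bar> + nat \<bar>k - l\<bar>)" using assms(3) by (intro power_increasing) auto
    then have "norm (t l) * norm (s (k - l)) * R ^ nat \<bar>k\<bar>
        \<le> norm (t l) * norm (s (k - l)) * (R ^ nat \<bar>l\<bar> * R ^ nat \<bar>k - l\<bar>)"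
      by (intro mult_left_mono) (auto simp: power_add)
    then show "norm (case x of (l, k) \<Rightarrow> norm (t l * s (k - l)) * R ^ nat \<bar>k\<bar>)
        \<le> (\<lambda>(l, k). (norm (t l) * R ^ nat \<bar>l\<bar>) * (norm (s k) * R ^ nat \<bar>k\<bar>)) ((\<lambda>(l, k). (l, k - l)) x)"
      using assms(3) by (simp add: x norm_mult mult_ac)
  qed
qed

lemma conv_seq_summable:
  assumes "rapidly_decreasing t" "rapidly_decreasing s"
  shows "(\<lambda>l. t l * s (k - l)) summable_on UNIV"
proof -
  have "(\<lambda>(l, k). norm (t l * s (k - l)) * 1 ^ nat \<bar>k\<bar>) summable_on UNIV"
    by (rule rapidly_decreasing_conv_aux[OF assms]) simp
  then have "(\<lambda>(l, k). norm (t l * s (k - l))) summable_on (\<lambda>l. (l, k)) ` UNIV"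
    by (simp add: summable_on_subset_banach[OF _ subset_UNIV])
  then have "(\<lambda>l. norm (t l * s (k - l))) summable_on UNIV"
    by (subst (asm) summable_on_reindex) (auto simp: inj_on_def o_def)
  then show ?thesis by (rule abs_summable_summable)
qed

lemma rapidly_decreasing_conv:
  assumes "rapidly_decreasing t" "rapidly_decreasing s"
  shows "rapidly_decreasing (conv_seq t s)"
  unfolding rapidly_decreasing_def
proof (intro allI impI)
  fix R :: real assume R: "R \<ge> 0"
  have "(\<lambda>(l, k). norm (t l * s (k - l)) * max R 1 ^ nat \<bar>k\<bar>) summable_on UNIV"
    by (rule rapidly_decreasing_conv_aux[OF assms]) simp
  then have S: "(\<lambda>(k, l). norm (t l * s (k - l)) * max R 1 ^ nat \<bar>k\<bar>) summable_on UNIV \<times> UNIV"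
    by (subst summable_on_swap) simp
  have "(\<lambda>k. \<Sum>\<^sub>\<infinity>l. norm (t l * s (k - l)) * max R 1 ^ nat \<bar>k\<bar>) summable_on UNIV"
    by (rule summable_on_Sigma_banach[OF S])
  then show "(\<lambda>k. norm (conv_seq t s k) * R ^ nat \<bar>k\<bar>) summable_on UNIV"
  proof (rule summable_on_dominated)
    fix k
    have "norm (conv_seq t s k) \<le> (\<Sum>\<^sub>\<infinity>l. norm (t l * s (k - l)))"
      unfolding conv_seq_def
      by (rule norm_infsum_bound) (use conv_seq_summable[OF assms] in \<open>simp add: summable_on_iff_abs_summable_on_complex\<close>)
    then have "norm (conv_seq t s k) * R ^ nat \<bar>k\<bar> \<le> (\<Sum>\<^sub>\<infinity>l. norm (t l * s (k - l))) * max R 1 ^ nat \<bar>k\<bar>"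
      using R by (intro mult_mono power_mono) (auto intro: infsum_nonneg)
    then show "norm (norm (conv_seq t s k) * R ^ nat \<bar>k\<bar>) \<le> (\<Sum>\<^sub>\<infinity>l. norm (t l * s (k - l)) * max R 1 ^ nat \<bar>k\<bar>)"
      using R unfolding infsum_cmult_left' by simp
  qed
qed

lemma moment_fps_conv:
  assumes t: "rapidly_decreasing t" and s: "rapidly_decreasing s"
  shows "moment_fps (c + d) (conv_seq t s) = moment_fps c t * moment_fps d s"
proof (rule fps_ext)
  fix j
  define A where "A i = (\<Sum>\<^sub>\<infinity>l. t l * (of_int l + c) ^ i)" for i
  define B where "B i = (\<Sum>\<^sub>\<infinity>k. s k * (of_int k + d) ^ i)" for i
  have AB: "((\<lambda>(l, k). t l * (of_int l + c) ^ i * (s k * (of_int k + d) ^ i')) has_sum A i * B i') (UNIV \<times> UNIV)" for i i'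
  proof -
    let ?f = "\<lambda>l. t l * (of_int l + c) ^ i" and ?g = "\<lambda>k. s k * (of_int k + d) ^ i'"
    have "(\<lambda>(l, k). norm (?f l) * norm (?g k)) summable_on UNIV \<times> UNIV"
      by (rule summable_on_Times_mult)
         (use moment_summable[OF t] moment_summable[OF s] in \<open>simp_all flip: summable_on_iff_abs_summable_on_complex\<close>)
    then have S: "(\<lambda>(l, k). ?f l * ?g k) summable_on UNIV \<times> UNIV"
      by (rule summable_on_dominated) (auto simp: norm_mult)
    have "infsum (\<lambda>(l, k). ?f l * ?g k) (UNIV \<times> UNIV) = (\<Sum>\<^sub>\<infinity>l. \<Sum>\<^sub>\<infinity>k. ?f l * ?g k)"
      by (rule infsum_Sigma'_banach[OF S, symmetric])
    also have "\<dots> = A i * B i'" unfolding infsum_cmult_right' infsum_cmult_left' A_def B_def ..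
    finally show ?thesis using has_sum_infsum[OF S] by simp
  qed
  have bin: "(\<Sum>i=0..j. x ^ i * y ^ (j - i) / (fact i * fact (j - i))) = (x + y) ^ j / fact j" for x y :: complex
    unfolding binomial_ring sum_divide_distrib atLeast0AtMost
    by (intro sum.cong refl) (auto simp: binomial_fact field_simps)
  have "((\<lambda>x. \<Sum>i=0..j. 1 / (fact i * fact (j - i)) * (\<lambda>(l, k). t l * (of_int l + c) ^ i * (s k * (of_int k + d) ^ (j - i))) x)
      has_sum (\<Sum>i=0..j. 1 / (fact i * fact (j - i)) * (A i * B (j - i)))) (UNIV \<times> UNIV)"
    by (rule has_sum_sum[OF finite_atLeastAtMost has_sum_cmult_right[OF AB]])
  moreover have "(\<Sum>i=0..j. 1 / (fact i * fact (j - i)) * (\<lambda>(l, k). t l * (of_int l + c) ^ i * (s k * (of_int k + d) ^ (j - i))) x)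
      = (\<lambda>(l, k). t l * s k * (of_int (k + l) + (c + d)) ^ j / fact j) x" for x
  proof -
    obtain l k where x: "x = (l, k)" by (cases x)
    have "(\<Sum>i=0..j. 1 / (fact i * fact (j - i)) * (t l * (of_int l + c) ^ i * (s k * (of_int k + d) ^ (j - i))))
      = t l * s k * (\<Sum>i=0..j. (of_int l + c) ^ i * (of_int k + d) ^ (j - i) / (fact i * fact (j - i)))"
      unfolding sum_distrib_left by (intro sum.cong refl) simp
    also have "\<dots> = t l * s k * (of_int (k + l) + (c + d)) ^ j / fact j"
      unfolding bin by (simp add: algebra_simps)
    finally show ?thesis by (simp add: x)
  qed
  ultimately have 1: "((\<lambda>(l, k). t l * s k * (of_int (k + l) + (c + d)) ^ j / fact j)
      has_sum (moment_fps c t * moment_fps d s) $ j) UNIV"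
    by (simp add: fps_mult_nth moment_fps_def A_def B_def)
  have "((\<lambda>x. (\<lambda>(l, k). t l * s k * (of_int (k + l) + (c + d)) ^ j / fact j) ((\<lambda>(l, k). (l, k - l)) x))
      has_sum (moment_fps c t * moment_fps d s) $ j) UNIV"
    using 1 by (subst has_sum_reindex_bij_betw[OF bij_betw_shear])
  then have 2: "((\<lambda>(l, k). t l * s (k - l) * (of_int k + (c + d)) ^ j / fact j)
      has_sum (moment_fps c t * moment_fps d s) $ j) UNIV"
    by (simp add: case_prod_unfold)
  then have 3: "((\<lambda>(k, l). t l * s (k - l) * (of_int k + (c + d)) ^ j / fact j)
      has_sum (moment_fps c t * moment_fps d s) $ j) (UNIV \<times> UNIV)"
    by (subst has_sum_swap) simp
  have "infsum (\<lambda>(k, l). t l * s (k - l) * (of_int k + (c + d)) ^ j / fact j) (UNIV \<times> UNIV)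
     = (\<Sum>\<^sub>\<infinity>k. \<Sum>\<^sub>\<infinity>l. t l * s (k - l) * (of_int k + (c + d)) ^ j / fact j)"
    by (rule infsum_Sigma'_banach[OF has_sum_imp_summable[OF 3], symmetric])
  also have "\<dots> = (\<Sum>\<^sub>\<infinity>k. conv_seq t s k * (of_int k + (c + d)) ^ j * (1 / fact j))"
    unfolding conv_seq_def infsum_cmult_left'[symmetric] by simp
  also have "\<dots> = moment_fps (c + d) (conv_seq t s) $ j"
    unfolding infsum_cmult_left' by (simp add: moment_fps_def)
  finally show "moment_fps (c + d) (conv_seq t s) $ j = (moment_fps c t * moment_fps d s) $ j"
    using infsumI[OF 3] by simp
qed

section \<open>The product of theta functions and its quasi-periodicity\<close>

lemma rapidly_decreasing_theta_seq:
  assumes "norm p < 1" "p \<noteq> 0"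
  shows "rapidly_decreasing (theta_seq p)"
  unfolding rapidly_decreasing_def
proof (intro allI impI)
  fix R :: real assume R: "R \<ge> 0"
  define r where "r = norm p"
  have r: "0 < r" "r < 1" using assms by (auto simp: r_def)
  \<comment> \<open>The additional 1/r pays for the linear part k of the exponent k(k+1), which is
    negative for k < 0.\<close>
  have "(\<lambda>l::int. r powi (l\<^sup>2) * (R / r) ^ nat \<bar>l\<bar>) summable_on UNIV"
    by (rule summable_on_gauss) (use r R in auto)
  then show "(\<lambda>k. norm (theta_seq p k) * R ^ nat \<bar>k\<bar>) summable_on UNIV"
  proof (rule summable_on_dominated)
    fix k :: int
    have "k * (k + 1) = k\<^sup>2 + k" by (simp add: power2_eq_square algebra_simps)
    then have "norm (theta_seq p k) = r powi (k\<^sup>2) * r powi k"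
      using r by (simp add: theta_seq_def norm_mult norm_power_int r_def[symmetric] power_int_add)
    moreover have "r powi k \<le> (1 / r) ^ nat \<bar>k\<bar>"
    proof (cases "k \<ge> 0")
      case True
      have "r ^ nat k \<le> 1" "1 \<le> (1 / r) ^ nat k" using r by (auto intro: power_le_one one_le_power)
      then show ?thesis using True by (simp add: power_int_def)
    next
      case False
      then show ?thesis by (simp add: power_int_def power_one_over inverse_eq_divide power_divide)
    qed
    ultimately have "norm (theta_seq p k) * R ^ nat \<bar>k\<bar> \<le> r powi (k\<^sup>2) * (1 / r) ^ nat \<bar>k\<bar> * R ^ nat \<bar>k\<bar>"
      using r R by (intro mult_right_mono) (auto intro!: mult_left_mono)
    then show "norm (norm (theta_seq p k) * R ^ nat \<bar>k\<bar>) \<le> r powi (k\<^sup>2) * (R / r) ^ nat \<bar>k\<bar>"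
      using R by (simp add: power_divide)
  qed
qed

lemma odd_theta_seq_odd: "odd_theta_seq p (2 * k + 1) = theta_seq p k"
  by (simp add: odd_theta_seq_def)

lemma has_sum_odd_theta_seq:
  assumes "((\<lambda>k. theta_seq p k * g (2 * k + 1)) has_sum S) UNIV"
  shows "((\<lambda>l. odd_theta_seq p l * g l) has_sum S) UNIV"
proof -
  have inj: "inj (\<lambda>k::int. 2 * k + 1)" by (auto simp: inj_on_def)
  have "((\<lambda>l. odd_theta_seq p l * g l) has_sum S) (range (\<lambda>k. 2 * k + 1))"
    using assms by (subst has_sum_reindex[OF inj]) (simp add: o_def odd_theta_seq_odd)
  moreover have "((\<lambda>l. odd_theta_seq p l * g l) has_sum S) (range (\<lambda>k. 2 * k + 1)) \<longleftrightarrow>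
      ((\<lambda>l. odd_theta_seq p l * g l) has_sum S) UNIV"
    by (rule has_sum_cong_neutral) (auto simp: odd_theta_seq_def elim!: oddE)
  ultimately show ?thesis by simp
qed

lemma rapidly_decreasing_odd_theta_seq:
  assumes "norm p < 1" "p \<noteq> 0"
  shows "rapidly_decreasing (odd_theta_seq p)"
  unfolding rapidly_decreasing_def
proof (intro allI impI)
  fix R :: real assume R: "R \<ge> 0"
  define R' where "R' = max R 1"
  have "(\<lambda>k. norm (theta_seq p k) * (R'\<^sup>2) ^ nat \<bar>k\<bar>) summable_on UNIV"
    using rapidly_decreasing_theta_seq[OF assms] by (simp add: rapidly_decreasing_def)
  from summable_on_cmult_right[OF this, of R']
  have "(\<lambda>k. theta_seq p k * of_real (R' ^ nat \<bar>2 * k + 1\<bar>)) summable_on UNIV"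
  proof (rule summable_on_dominated)
    fix k :: int
    have "R' ^ nat \<bar>2 * k + 1\<bar> \<le> R' ^ (1 + 2 * nat \<bar>k\<bar>)" by (intro power_increasing) (auto simp: R'_def)
    then have "norm (theta_seq p k) * R' ^ nat \<bar>2 * k + 1\<bar> \<le> norm (theta_seq p k) * (R' * (R'\<^sup>2) ^ nat \<bar>k\<bar>)"
      by (intro mult_left_mono) (auto simp: power_mult[symmetric])
    then show "norm (theta_seq p k * of_real (R' ^ nat \<bar>2 * k + 1\<bar>)) \<le> R' * (norm (theta_seq p k) * (R'\<^sup>2) ^ nat \<bar>k\<bar>)"
      by (simp add: norm_mult norm_power R'_def mult_ac)
  qed
  then have "(\<lambda>l. odd_theta_seq p l * of_real (R' ^ nat \<bar>l\<bar>)) summable_on UNIV"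
    using has_sum_odd_theta_seq[of p "\<lambda>l. of_real (R' ^ nat \<bar>l\<bar>)"] by (auto simp: summable_on_def)
  then have "(\<lambda>l. norm (odd_theta_seq p l * of_real (R' ^ nat \<bar>l\<bar>))) summable_on UNIV"
    by (simp add: summable_on_iff_abs_summable_on_complex)
  then show "(\<lambda>k. norm (odd_theta_seq p k) * R ^ nat \<bar>k\<bar>) summable_on UNIV"
    by (rule summable_on_dominated)
       (use R in \<open>auto simp: norm_mult norm_power R'_def intro!: mult_left_mono power_mono\<close>)
qed

text \<open>\<open>theta_seq\<close> holds the coefficients of \<theta>(-pz), where \<theta> is the
  eigenvalue of the kernel. This substitution moves the zero of \<theta> to z = 1, where the odd
  factor vanishes too.\<close>

fun theta_product_seq :: "complex \<Rightarrow> nat \<Rightarrow> int \<Rightarrow> complex" where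
  "theta_product_seq p 0 = odd_theta_seq p"
| "theta_product_seq p (Suc i) = conv_seq (theta_seq p) (theta_product_seq p i)"

lemma theta_seq_reflect: "theta_seq p (- 1 - k) = - theta_seq p k"
proof -
  have "(- 1 - k) * (- 1 - k + 1) = k * (k + 1)" by (simp add: algebra_simps)
  then show ?thesis by (simp only: theta_seq_def) simp
qed

lemma theta_seq_Suc:
  assumes "p \<noteq> 0"
  shows "theta_seq p (k + 1) = - (p powi (2 * (k + 1))) * theta_seq p k"
proof -
  have "(k + 1) * (k + 1 + 1) = 2 * (k + 1) + k * (k + 1)" by (simp add: algebra_simps)
  then show ?thesis using assms by (simp only: theta_seq_def power_int_add[OF disjI1[OF assms]]) simp
qed

lemma odd_theta_seq_add4:
  assumes "p \<noteq> 0"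
  shows "odd_theta_seq p (l + 4) = p powi (2 * (l + 2)) * odd_theta_seq p l"
proof (cases "odd l")
  case True
  then obtain k where k: "l = 2 * k + 1" by (auto elim: oddE)
  have "odd_theta_seq p (l + 4) = theta_seq p (k + 1 + 1)"
    using odd_theta_seq_odd[of p "k + 2"] by (simp add: k algebra_simps)
  also have "\<dots> = p powi (2 * (k + 1 + 1)) * p powi (2 * (k + 1)) * theta_seq p k"
    by (simp only: theta_seq_Suc[OF assms]) simp
  also have "p powi (2 * (k + 1 + 1)) * p powi (2 * (k + 1)) = p powi (2 * (l + 2))"
    unfolding power_int_add[OF disjI1[OF assms], symmetric] by (simp add: k algebra_simps)
  finally show ?thesis by (simp add: k odd_theta_seq_odd)
qed (simp add: odd_theta_seq_def)

lemma theta_product_seq_reflect: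
  "theta_product_seq p i (- int i - k) = (-1) ^ Suc i * theta_product_seq p i k"
proof (induction i arbitrary: k)
  case 0
  then show ?case by (simp add: odd_theta_seq_minus)
next
  case (Suc i)
  have "theta_product_seq p (Suc i) (- int (Suc i) - k)
      = (\<Sum>\<^sub>\<infinity>l. theta_seq p (- 1 - l) * theta_product_seq p i (- int (Suc i) - k - (- 1 - l)))"
    unfolding theta_product_seq.simps conv_seq_def
    by (rule infsum_reindex_bij_witness[of _ "\<lambda>l. - 1 - l" "\<lambda>l. - 1 - l"]) auto
  also have "\<dots> = (\<Sum>\<^sub>\<infinity>l. (-1) ^ Suc (Suc i) * (theta_seq p l * theta_product_seq p i (k - l)))"
  proof (rule infsum_cong)
    fix l
    have "- int (Suc i) - k - (- 1 - l) = - int i - (k - l)" by simp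
    then show "theta_seq p (- 1 - l) * theta_product_seq p i (- int (Suc i) - k - (- 1 - l))
       = (-1) ^ Suc (Suc i) * (theta_seq p l * theta_product_seq p i (k - l))"
      by (simp only: Suc.IH theta_seq_reflect) simp
  qed
  finally show ?case by (simp add: infsum_cmult_right' conv_seq_def)
qed

text \<open>Each theta factor contributes 1 to the index shift and the odd factor, a series in z^2,
  contributes 4. For i = 2n the total is 2n + 4, the modulus in the final sum.\<close>

lemma theta_product_seq_shift:
  assumes "p \<noteq> 0"
  shows "theta_product_seq p i (k + 4 + int i) = (-1) ^ i * p powi (2 * (k + int i + 2)) * theta_product_seq p i k"
proof (induction i arbitrary: k)
  case 0
  then show ?case using odd_theta_seq_add4[OF assms, of k] by simp
next
  case (Suc i)
  have "theta_product_seq p (Suc i) (k + 4 + int (Suc i))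
      = (\<Sum>\<^sub>\<infinity>l. theta_seq p (l + 1) * theta_product_seq p i (k + 4 + int (Suc i) - (l + 1)))"
    unfolding theta_product_seq.simps conv_seq_def
    by (rule infsum_reindex_bij_witness[of _ "\<lambda>l. l + 1" "\<lambda>l. l - 1"]) auto
  also have "\<dots> = (\<Sum>\<^sub>\<infinity>l. (-1) ^ Suc i * p powi (2 * (k + int (Suc i) + 2)) * (theta_seq p l * theta_product_seq p i (k - l)))"
  proof (rule infsum_cong)
    fix l
    have "k + 4 + int (Suc i) - (l + 1) = (k - l) + 4 + int i" by simp
    moreover have "2 * (k + int (Suc i) + 2) = 2 * (l + 1) + 2 * (k - l + int i + 2)" by simp
    ultimately show "theta_seq p (l + 1) * theta_product_seq p i (k + 4 + int (Suc i) - (l + 1))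
       = (-1) ^ Suc i * p powi (2 * (k + int (Suc i) + 2)) * (theta_seq p l * theta_product_seq p i (k - l))"
      by (simp only: Suc.IH theta_seq_Suc[OF assms] power_int_add[OF disjI1[OF assms]]) simp
  qed
  finally show ?case unfolding infsum_cmult_right' theta_product_seq.simps conv_seq_def .
qed

text \<open>Substituting -pz for z multiplies coefficient k by (-p)^k. The odd starting sequence is
  the same on both sides; its quasi-periodicity under the substitution costs the index shift 2 and
  the factor 1/p.\<close>

lemma theta_product_seq_eq_funpow:
  assumes p: "p \<noteq> 0"
  shows "theta_product_seq p i k = (- p) powi k / p * (theta_op p ^^ i) (odd_theta_seq p) (k - 2)"
proof (induction i arbitrary: k)
  case 0
  show ?case
  proof (cases "odd k")
    case True
    then obtain j where j: "k = 2 * j + 1" by (auto elim: oddE)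
    have "odd_theta_seq p (k - 2) = theta_seq p (j - 1)"
      using odd_theta_seq_odd[of p "j - 1"] by (simp add: j algebra_simps)
    moreover have "theta_seq p j = - (p powi (2 * j)) * theta_seq p (j - 1)"
      using theta_seq_Suc[OF p, of "j - 1"] by simp
    moreover have "(- p) powi k = - (p powi (2 * j) * p)"
      using p by (simp add: j power_int_add power_int_minus_left)
    ultimately show ?thesis using p by (simp add: j odd_theta_seq_odd)
  qed (simp add: odd_theta_seq_def)
next
  case (Suc i)
  let ?e = "(theta_op p ^^ i) (odd_theta_seq p)"
  have "theta_product_seq p (Suc i) k = (\<Sum>\<^sub>\<infinity>l. theta_seq p (- l) * theta_product_seq p i (k - (- l)))"
    unfolding theta_product_seq.simps conv_seq_def
    by (rule infsum_reindex_bij_witness[of _ uminus uminus]) auto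
  also have "\<dots> = (\<Sum>\<^sub>\<infinity>l. (- p) powi k / p * (p powi (l\<^sup>2) * ?e (k - 2 + l)))"
  proof (rule infsum_cong)
    fix l
    have 1: "(- p) powi (k - (- l)) = (- p) powi k * ((if even l then 1 else -1) * p powi l)"
      using p by (simp add: power_int_add power_int_minus_left)
    have 2: "theta_seq p (- l) * p powi l = (if even l then 1 else -1) * p powi (l\<^sup>2)"
    proof -
      have "l\<^sup>2 = - l * (- l + 1) + l" by (simp add: power2_eq_square algebra_simps)
      then show ?thesis by (simp only: theta_seq_def power_int_add[OF disjI1[OF p]]) simp
    qed
    have "theta_seq p (- l) * theta_product_seq p i (k - (- l))
        = (- p) powi k / p * ((if even l then 1 else -1) * (theta_seq p (- l) * p powi l)) * ?e (k - 2 + l)"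
      unfolding Suc.IH 1 by (simp add: algebra_simps)
    also have "\<dots> = (- p) powi k / p * (p powi (l\<^sup>2) * ?e (k - 2 + l))"
      unfolding 2 by simp
    finally show "theta_seq p (- l) * theta_product_seq p i (k - (- l)) = (- p) powi k / p * (p powi (l\<^sup>2) * ?e (k - 2 + l))" .
  qed
  also have "\<dots> = (- p) powi k / p * theta_op p ?e (k - 2)"
    unfolding infsum_cmult_right' theta_op_def ..
  finally show ?case by simp
qed

context
  fixes p :: complex
  assumes norm_p: "norm p < 1" and p_nz: "p \<noteq> 0"
begin

lemma rapidly_decreasing_theta_product_seq: "rapidly_decreasing (theta_product_seq p i)"
  by (induction i) (auto intro!: rapidly_decreasing_conv rapidly_decreasing_odd_theta_seq rapidly_decreasing_theta_seq norm_p p_nz)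

text \<open>Each theta factor is antisymmetric about -1/2 and the odd one about 0, so the product
  has its centre at -i/2.\<close>

lemma moment_fps_theta_product_seq:
  "moment_fps (of_nat i / 2) (theta_product_seq p i) = moment_fps 0 (odd_theta_seq p) * moment_fps (1 / 2) (theta_seq p) ^ i"
proof (induction i)
  case (Suc i)
  have "moment_fps (1 / 2 + of_nat i / 2) (theta_product_seq p (Suc i))
      = moment_fps (1 / 2) (theta_seq p) * moment_fps (of_nat i / 2) (theta_product_seq p i)"
    unfolding theta_product_seq.simps
    by (rule moment_fps_conv[OF rapidly_decreasing_theta_seq[OF norm_p p_nz] rapidly_decreasing_theta_product_seq])
  then show ?case by (simp add: Suc.IH add_divide_distrib mult_ac)
qed simp

lemma moment_fps_theta_seq_even:
  assumes "even j"
  shows "moment_fps (1 / 2) (theta_seq p) $ j = 0"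
proof -
  let ?f = "\<lambda>k::int. theta_seq p k * (of_int k + 1 / 2) ^ j"
  have "infsum ?f UNIV = (\<Sum>\<^sub>\<infinity>k. ?f (- 1 - k))"
    by (rule infsum_reindex_bij_witness[of _ "\<lambda>k. - 1 - k" "\<lambda>k. - 1 - k"]) auto
  also have "\<dots> = (\<Sum>\<^sub>\<infinity>k. - ?f k)"
  proof (rule infsum_cong)
    fix k :: int
    have "of_int (- 1 - k) + 1 / 2 = - (of_int k + 1 / 2 :: complex)" by simp
    then show "?f (- 1 - k) = - ?f k" using assms by (simp only: theta_seq_reflect power_minus_even) simp
  qed
  also have "\<dots> = - infsum ?f UNIV" by (rule infsum_uminus)
  finally show ?thesis by (simp add: moment_fps_def)
qed

lemma moment_fps_odd_theta_seq:
  "moment_fps 0 (odd_theta_seq p) $ j = 2 ^ j * moment_fps (1 / 2) (theta_seq p) $ j"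
proof -
  have "((\<lambda>k. 2 ^ j * (theta_seq p k * (of_int k + 1 / 2) ^ j)) has_sum 2 ^ j * (\<Sum>\<^sub>\<infinity>k. theta_seq p k * (of_int k + 1 / 2) ^ j)) UNIV"
    by (rule has_sum_cmult_right[OF has_sum_infsum[OF moment_summable[OF rapidly_decreasing_theta_seq[OF norm_p p_nz]]]])
  moreover have "2 ^ j * (theta_seq p k * (of_int k + 1 / 2) ^ j) = theta_seq p k * of_int (2 * k + 1) ^ j" for k
  proof -
    have "of_int (2 * k + 1) = 2 * (of_int k + 1 / 2 :: complex)" by simp
    then show ?thesis by (simp only: power_mult_distrib) simp
  qed
  ultimately have "((\<lambda>k. theta_seq p k * of_int (2 * k + 1) ^ j) has_sum 2 ^ j * (\<Sum>\<^sub>\<infinity>k. theta_seq p k * (of_int k + 1 / 2) ^ j)) UNIV"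
    by (simp only:)
  from infsumI[OF has_sum_odd_theta_seq[OF this]] show ?thesis by (simp add: moment_fps_def)
qed

text \<open>All factors are odd power series, and the odd theta factor is the common one with its
  argument doubled. The leading coefficient is therefore 2P P^(2n). Two orders later 8 T3 comes from
  the odd factor and 2 * 2n T3 from the others, which makes 4n + 8.\<close>

lemma theta_product_fps:
  fixes n :: nat
  defines "F \<equiv> moment_fps 0 (odd_theta_seq p) * moment_fps (1 / 2) (theta_seq p) ^ (2 * n)"
    and "P \<equiv> moment_fps (1 / 2) (theta_seq p) $ 1" and "T3 \<equiv> moment_fps (1 / 2) (theta_seq p) $ 3"
  shows "j < 2 * n + 1 \<Longrightarrow> F $ j = 0" "F $ (2 * n + 1) = 2 * P ^ (2 * n + 1)"
    "F $ (2 * n + 3) = (4 * of_nat n + 8) * T3 * P ^ (2 * n)"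
proof -
  define S where "S = fps_shift 1 (moment_fps (1 / 2) (theta_seq p))"
  define S' where "S' = fps_shift 1 (moment_fps 0 (odd_theta_seq p))"
  have T: "moment_fps (1 / 2) (theta_seq p) = S * fps_X"
    unfolding S_def by (rule fps_ext) (auto simp: fps_X_mult_right_nth moment_fps_theta_seq_even)
  have D: "moment_fps 0 (odd_theta_seq p) = S' * fps_X"
    unfolding S'_def by (rule fps_ext) (auto simp: fps_X_mult_right_nth moment_fps_odd_theta_seq moment_fps_theta_seq_even)
  have F: "F = S' * S ^ (2 * n) * fps_X ^ (2 * n + 1)"
    by (simp add: F_def T D power_mult_distrib mult_ac)
  have S: "S $ 0 = P" "S $ 1 = 0" "S $ 2 = T3"
    by (simp_all add: S_def P_def T3_def moment_fps_theta_seq_even numeral_2_eq_2[symmetric] numeral_3_eq_3[symmetric])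
  have S': "S' $ 0 = 2 * P" "S' $ 1 = 0" "S' $ 2 = 8 * T3"
    by (simp_all add: S'_def moment_fps_odd_theta_seq P_def T3_def moment_fps_theta_seq_even numeral_2_eq_2[symmetric] numeral_3_eq_3[symmetric])
  have pow: "(S ^ m) $ 0 = P ^ m \<and> (S ^ m) $ 1 = 0 \<and> (S ^ Suc m) $ 2 = of_nat (Suc m) * T3 * P ^ m" for m
  proof (induction m)
    case 0
    then show ?case by (simp add: S)
  next
    case (Suc m)
    have 1: "(S ^ Suc m) $ 0 = P ^ Suc m" "(S ^ Suc m) $ 1 = 0" using Suc S by (simp_all add: fps_mult_nth)
    have "(S ^ Suc (Suc m)) $ 2 = S $ 0 * (S ^ Suc m) $ 2 + S $ 1 * (S ^ Suc m) $ 1 + S $ 2 * (S ^ Suc m) $ 0"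
      unfolding power_Suc[of S "Suc m"] fps_mult_nth by (simp add: numeral_2_eq_2)
    also have "\<dots> = P * (of_nat (Suc m) * T3 * P ^ m) + T3 * P ^ Suc m"
      using Suc 1 S by simp
    also have "\<dots> = of_nat (Suc (Suc m)) * T3 * P ^ Suc m" by (simp add: algebra_simps)
    finally show ?case using 1 by blast
  qed
  \<comment> \<open>Multiplying by P avoids the exponent m - 1, which would be truncated at m =
    0.\<close>
  have pow2: "(S ^ m) $ 2 * P = of_nat m * T3 * P ^ m" for m
    using pow[of "m - 1"] by (cases m) (auto simp: mult_ac)
  show "j < 2 * n + 1 \<Longrightarrow> F $ j = 0" unfolding F fps_X_power_mult_right_nth by simp
  have "F $ (2 * n + 1) = (S' * S ^ (2 * n)) $ 0" unfolding F fps_X_power_mult_right_nth by simp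
  then show "F $ (2 * n + 1) = 2 * P ^ (2 * n + 1)" using pow[of "2 * n"] by (simp add: S')
  have "F $ (2 * n + 3) = (S' * S ^ (2 * n)) $ 2" unfolding F fps_X_power_mult_right_nth by simp
  also have "\<dots> = S' $ 0 * (S ^ (2 * n)) $ 2 + S' $ 1 * (S ^ (2 * n)) $ 1 + S' $ 2 * (S ^ (2 * n)) $ 0"
    unfolding fps_mult_nth by (simp add: numeral_2_eq_2)
  also have "\<dots> = (4 * of_nat n + 8) * T3 * P ^ (2 * n)"
    using pow[of "2 * n"] pow2[of "2 * n"] by (simp add: S' algebra_simps)
  finally show "F $ (2 * n + 3) = (4 * of_nat n + 8) * T3 * P ^ (2 * n)" .
qed

end

section \<open>Jacobi's identity\<close>

lemma filterlim_nat_int_add: "filterlim (\<lambda>m. nat (int m + c)) at_top at_top"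
  unfolding filterlim_at_top eventually_at_top_linorder
proof
  fix Z :: nat
  show "\<exists>N. \<forall>n\<ge>N. Z \<le> nat (int n + c)" by (intro exI[of _ "Z + nat \<bar>c\<bar>"]) auto
qed

context
  fixes p :: complex
  assumes norm_p: "norm p < 1" and p_nz: "p \<noteq> 0"
begin

text \<open>Differentiating the \<open>q\<close>-binomial theorem for \<open>(x; q)\<^bsub>2m+1\<^esub>\<close> at its zero \<open>x = q\<^bsup>-m\<^esup>\<close>.\<close>
lemma jacobi_finite:
  "(\<Sum>r\<le>2 * m + 1. (of_int (int r - int m - 1) + 1 / 2) * theta_seq p (int r - int m - 1) /
      (qpoch (p\<^sup>2) (p\<^sup>2) r * qpoch (p\<^sup>2) (p\<^sup>2) (2 * m + 1 - r)))
    = (qpoch (p\<^sup>2) (p\<^sup>2) m)\<^sup>2 / qpoch (p\<^sup>2) (p\<^sup>2) (2 * m + 1)"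
proof -
  define q where "q = p\<^sup>2"
  have q: "norm q < 1" "q \<noteq> 0" using norm_p2[OF norm_p p_nz] p_nz by (auto simp: q_def)
  define N where "N = 2 * m + 1"
  define x where "x = inverse q ^ m"
  have xq: "x * q ^ m = 1" using q(2) by (simp add: x_def power_mult_distrib[symmetric])
  define c where "c r = (-1) ^ r * q ^ (r * (r - 1) div 2) / (qpoch q q r * qpoch q q (N - r))" for r
  define R where "R z = (\<Prod>i\<in>{..<N} - {m}. 1 - z * q ^ i)" for z
  have prod: "(\<Prod>i<N. 1 - z * q ^ i) = (1 - z * q ^ m) * R z" for z
    unfolding R_def by (rule prod.remove) (auto simp: N_def)
  have qb: "(\<Sum>r\<le>N. c r * z ^ r) = (1 - z * q ^ m) * R z / qpoch q q N" for z
    using qbinomial_theorem[OF q(1), of z N] by (simp add: c_def prod)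
  have sum0: "(\<Sum>r\<le>N. c r * x ^ r) = 0" using xq by (simp add: qb)
  have D1: "((\<lambda>z. \<Sum>r\<le>N. c r * z ^ r) has_field_derivative (\<Sum>r\<le>N. c r * (of_nat r * x ^ (r - 1)))) (at x)"
    by (auto intro!: derivative_eq_intros sum.cong simp: mult_ac)
  \<comment> \<open>At a zero of the linear factor the product rule leaves only the derivative of
    that factor times R. Caratheodory's criterion gives this from the continuity of R alone.\<close>
  have D2: "((\<lambda>z. (1 - z * q ^ m) * R z / qpoch q q N) has_field_derivative (- (q ^ m) * R x / qpoch q q N)) (at x)"
    unfolding CARAT_DERIV
  proof (intro exI[of _ "\<lambda>z. - (q ^ m) * R z / qpoch q q N"] conjI allI)
    fix z
    have "1 - z * q ^ m = - (q ^ m) * (z - x)" using xq by (simp add: algebra_simps)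
    then show "(1 - z * q ^ m) * R z / qpoch q q N - (1 - x * q ^ m) * R x / qpoch q q N
        = - (q ^ m) * R z / qpoch q q N * (z - x)"
      using xq by simp
    show "isCont (\<lambda>z. - (q ^ m) * R z / qpoch q q N) x"
      unfolding R_def using q(1) by (intro continuous_intros) auto
  qed simp
  have "(\<Sum>r\<le>N. c r * (of_nat r * x ^ (r - 1))) = - (q ^ m) * R x / qpoch q q N"
    using DERIV_unique[OF D1[unfolded qb] D2] .
  then have "x * (\<Sum>r\<le>N. c r * (of_nat r * x ^ (r - 1))) = x * (- (q ^ m) * R x / qpoch q q N)" by (simp only:)
  also have "x * (- (q ^ m) * R x / qpoch q q N) = - R x / qpoch q q N" using xq by simp
  also have "x * (\<Sum>r\<le>N. c r * (of_nat r * x ^ (r - 1))) = (\<Sum>r\<le>N. of_nat r * (c r * x ^ r))"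
    unfolding sum_distrib_left
  proof (intro sum.cong refl)
    fix r show "x * (c r * (of_nat r * x ^ (r - 1))) = of_nat r * (c r * x ^ r)" by (cases r) auto
  qed
  finally have 1: "(\<Sum>r\<le>N. of_nat r * (c r * x ^ r)) = - R x / qpoch q q N" .
  have Rx: "R x = (-1) ^ m * inverse p ^ (m * (m + 1)) * (qpoch q q m)\<^sup>2"
  proof -
    have "R x = (\<Prod>i\<in>{..<m} \<union> {Suc m..<N}. 1 - x * q ^ i)"
      unfolding R_def by (rule arg_cong2[where f = prod]) (auto simp: N_def)
    also have "\<dots> = (\<Prod>i<m. 1 - x * q ^ i) * (\<Prod>i=Suc m..<N. 1 - x * q ^ i)"
      by (rule prod.union_disjoint) auto
    also have "(\<Prod>i=Suc m..<N. 1 - x * q ^ i) = qpoch q q m"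
    proof -
      have "(\<Prod>i=Suc m..<N. 1 - x * q ^ i) = (\<Prod>i<m. 1 - x * q ^ (i + Suc m))"
        by (rule prod.reindex_bij_witness[of _ "\<lambda>i. i + Suc m" "\<lambda>i. i - Suc m"]) (auto simp: N_def)
      also have "\<dots> = (\<Prod>i<m. 1 - q * q ^ i)"
        using xq by (intro prod.cong) (auto simp: power_add mult_ac)
      finally show ?thesis by (simp add: qpoch_eq_lessThan)
    qed
    also have "(\<Prod>i<m. 1 - x * q ^ i) = (\<Prod>i<m. 1 - inverse q ^ Suc i)"
    proof -
      have "(\<Prod>i<m. 1 - x * q ^ i) = (\<Prod>i<m. 1 - x * q ^ (m - Suc i))"
        by (rule prod.nat_diff_reindex[symmetric])
      also have "\<dots> = (\<Prod>i<m. 1 - inverse q ^ Suc i)"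
      proof (intro prod.cong refl)
        fix i assume "i \<in> {..<m}"
        then have "m = Suc i + (m - Suc i)" by simp
        then have "x = inverse q ^ Suc i * inverse q ^ (m - Suc i)" unfolding x_def by (metis power_add)
        then have "x * q ^ (m - Suc i) = inverse q ^ Suc i * (inverse q * q) ^ (m - Suc i)"
          by (simp only: power_mult_distrib mult.assoc)
        then show "1 - x * q ^ (m - Suc i) = 1 - inverse q ^ Suc i" using q(2) by simp
      qed
      finally show ?thesis .
    qed
    also have "\<dots> = (-1) ^ m * inverse p ^ (m * (m + 1)) * qpoch q q m"
    proof (induction m)
      case (Suc m)
      have e1: "inverse p ^ (Suc m * (Suc m + 1)) = inverse p ^ (m * (m + 1)) * inverse q ^ Suc m"
      proof -
        have "Suc m * (Suc m + 1) = m * (m + 1) + 2 * Suc m" by simp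
        moreover have "inverse q = inverse p ^ 2" by (simp add: q_def power_inverse)
        ultimately show ?thesis by (simp only: power_add power_mult)
      qed
      have e2: "1 - inverse q ^ Suc m = - (inverse q ^ Suc m) * (1 - q ^ Suc m)"
        using q(2) by (simp add: right_diff_distrib power_mult_distrib[symmetric] del: power_Suc)
      show ?case
        unfolding prod.lessThan_Suc Suc.IH e1 e2 qpoch_Suc power_Suc[of "-1 :: complex"] by (simp only: mult_ac mult_minus_left mult_minus_right mult_1_left minus_minus)
    qed simp
    finally show ?thesis by (simp add: power2_eq_square mult_ac)
  qed
  \<comment> \<open>Since r(r-1) - 2mr = (r-m-1)(r-m) - m(m+1), the q-binomial terms are theta
    coefficients of index r - m - 1, up to a factor independent of r.\<close>
  have cx: "c r * x ^ r = - ((-1) ^ m) * inverse p ^ (m * (m + 1)) *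
      (theta_seq p (int r - int m - 1) / (qpoch q q r * qpoch q q (N - r)))" for r
  proof -
    have "even (r * (r - 1))" by (cases r) auto
    then have 1: "q ^ (r * (r - 1) div 2) = p powi int (r * (r - 1))"
      unfolding q_def power_mult[symmetric] power_int_of_nat by simp
    have 2: "x ^ r = p powi (- 2 * int m * int r)"
    proof -
      have "- 2 * int m * int r = - int (2 * m * r)" by simp
      moreover have "inverse q = inverse p ^ 2" by (simp add: q_def power_inverse)
      ultimately show ?thesis
        by (simp only: x_def power_int_minus power_int_of_nat power_mult[symmetric] power_inverse mult.assoc)
    qed
    have 3: "inverse p ^ (m * (m + 1)) = p powi (- (int m * (int m + 1)))"
    proof -
      have "int m * (int m + 1) = int (m * (m + 1))" by (simp add: algebra_simps)
      then show ?thesis by (simp only: power_int_minus power_int_of_nat power_inverse)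
    qed
    have "int (r * (r - 1)) + (- 2 * int m * int r)
        = - (int m * (int m + 1)) + (int r - int m - 1) * (int r - int m - 1 + 1)"
      by (cases r) (simp_all add: algebra_simps)
    then have "p powi int (r * (r - 1)) * p powi (- 2 * int m * int r)
       = p powi (- (int m * (int m + 1))) * p powi ((int r - int m - 1) * (int r - int m - 1 + 1))"
      by (simp only: power_int_add[OF disjI1[OF p_nz], symmetric])
    moreover have "(-1) ^ r = - ((-1) ^ m) * (if even (int r - int m - 1) then 1 else -1 :: complex)"
      by (simp add: minus_one_power_iff)
    ultimately show ?thesis
      unfolding c_def 1 2 3 theta_seq_def by (simp add: mult_ac)
  qed
  let ?t = "\<lambda>r. theta_seq p (int r - int m - 1) / (qpoch q q r * qpoch q q (N - r))"
  define A where "A = - ((-1) ^ m) * inverse p ^ (m * (m + 1))"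
  have A: "A \<noteq> 0" using p_nz by (simp add: A_def)
  have "A * (\<Sum>r\<le>N. ?t r) = 0" using sum0 unfolding cx sum_distrib_left A_def .
  then have s0: "(\<Sum>r\<le>N. ?t r) = 0" using A by simp
  have "A * (\<Sum>r\<le>N. of_nat r * ?t r) = A * ((qpoch q q m)\<^sup>2 / qpoch q q N)"
    using 1 unfolding cx Rx sum_distrib_left A_def by (simp add: mult_ac)
  then have s1: "(\<Sum>r\<le>N. of_nat r * ?t r) = (qpoch q q m)\<^sup>2 / qpoch q q N"
    using mult_left_cancel[OF A] by blast
  \<comment> \<open>The plain sum s0 vanishes, so the weight r may be recentred at the point of
    antisymmetry.\<close>
  have "(\<Sum>r\<le>N. (of_int (int r - int m - 1) + 1 / 2) * ?t r)
      = (\<Sum>r\<le>N. of_nat r * ?t r) - (of_nat m + 1 / 2) * (\<Sum>r\<le>N. ?t r)"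
    unfolding sum_distrib_left sum_subtractf[symmetric]
  proof (intro sum.cong refl)
    fix r
    have "of_int (int r - int m - 1) + 1 / 2 = of_nat r - (of_nat m + 1 / 2 :: complex)" by simp
    then show "(of_int (int r - int m - 1) + 1 / 2) * ?t r = of_nat r * ?t r - (of_nat m + 1 / 2) * ?t r"
      by (simp only: left_diff_distrib)
  qed
  then show ?thesis unfolding s0 s1 by (simp add: N_def q_def)
qed

text \<open>The limit of \<open>jacobi_finite\<close>: the left side tends to the sum divided by
  (q)_\<infinity>^2, the right side to (q)_\<infinity>. Pairing k with -1 - k gives the one-sided
  form with coefficients 2k + 1.\<close>

theorem jacobi_theta_moment:
  "((\<lambda>k. theta_seq p k * (of_int k + 1 / 2)) has_sum qpoch_inf (p\<^sup>2) (p\<^sup>2) ^ 3) UNIV"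
proof -
  define q where "q = p\<^sup>2"
  define Q where "Q = qpoch_inf q q"
  have q: "norm q < 1" using norm_p2[OF norm_p p_nz] by (auto simp: q_def)
  have Q: "Q \<noteq> 0" using q by (simp add: Q_def)
  define g where "g m = 1 / qpoch q q m" for m
  obtain C where C: "C \<ge> 1" "\<And>m. norm (g m) \<le> C"
    using inverse_qpoch_bounded[OF q] unfolding g_def by blast
  define h where "h k = theta_seq p k * (of_int k + 1 / 2)" for k
  have hs: "h summable_on UNIV"
    using moment_summable[OF rapidly_decreasing_theta_seq[OF norm_p p_nz], of "1 / 2" 1] by (simp add: h_def[abs_def])
  define f where "f k m = (if - int m - 1 \<le> k \<and> k \<le> int m
      then h k * (g (nat (int m + (1 + k))) * g (nat (int m + (- k)))) else 0)" for k m
  have gl: "(\<lambda>m. g (nat (int m + c))) \<longlonglongrightarrow> 1 / Q" for c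
    using filterlim_compose[OF inverse_qpoch_tendsto[OF q] filterlim_nat_int_add[of c]]
    by (simp add: g_def Q_def)
  have "f k \<longlonglongrightarrow> h k * (1 / Q * (1 / Q))" for k
  proof (rule Lim_transform_eventually)
    show "(\<lambda>m. h k * (g (nat (int m + (1 + k))) * g (nat (int m + (- k))))) \<longlonglongrightarrow> h k * (1 / Q * (1 / Q))"
      by (intro tendsto_mult tendsto_const gl)
    show "\<forall>\<^sub>F m in sequentially. h k * (g (nat (int m + (1 + k))) * g (nat (int m + (- k)))) = f k m"
      using eventually_ge_at_top[of "nat \<bar>k\<bar>"] by eventually_elim (auto simp: f_def)
  qed
  moreover have "norm (f k m) \<le> norm (h k) * (C * C)" for k m
  proof -
    have "norm (h k * (g a * g b)) \<le> norm (h k) * (C * C)" for a b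
      unfolding norm_mult using C by (intro mult_left_mono mult_mono) auto
    then show ?thesis using C(1) by (auto simp: f_def)
  qed
  moreover have "(\<lambda>k. norm (h k) * (C * C)) summable_on UNIV"
    by (rule summable_on_cmult_left) (use hs in \<open>simp add: summable_on_iff_abs_summable_on_complex\<close>)
  ultimately have "(\<lambda>m. \<Sum>\<^sub>\<infinity>k. f k m) \<longlonglongrightarrow> (\<Sum>\<^sub>\<infinity>k. h k * (1 / Q * (1 / Q)))"
    by (intro tendsto_infsum_dominated) auto
  moreover have "(\<Sum>\<^sub>\<infinity>k. f k m) = (qpoch q q m)\<^sup>2 * g (2 * m + 1)" for m
  proof -
    have "(\<Sum>\<^sub>\<infinity>k. f k m) = (\<Sum>\<^sub>\<infinity>k\<in>{- int m - 1..int m}. f k m)"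
      by (rule infsum_cong_neutral) (auto simp: f_def)
    also have "\<dots> = (\<Sum>k=- int m - 1..int m. f k m)" by simp
    also have "\<dots> = (\<Sum>r\<le>2 * m + 1. (of_int (int r - int m - 1) + 1 / 2) * theta_seq p (int r - int m - 1) /
      (qpoch q q r * qpoch q q (2 * m + 1 - r)))"
    proof (rule sum.reindex_bij_witness[of _ "\<lambda>r. int r - int m - 1" "\<lambda>k. nat (k + int m + 1)"])
      fix k assume k: "k \<in> {- int m - 1..int m}"
      define r where "r = nat (k + int m + 1)"
      have "int r - int m - 1 = k" "nat (int m + (1 + k)) = r" "nat (int m + (- k)) = 2 * m + 1 - r"
        using k by (auto simp: r_def)
      then show "(of_int (int (nat (k + int m + 1)) - int m - 1) + 1 / 2) * theta_seq p (int (nat (k + int m + 1)) - int m - 1) /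
         (qpoch q q (nat (k + int m + 1)) * qpoch q q (2 * m + 1 - nat (k + int m + 1))) = f k m"
        using k unfolding r_def[symmetric] by (simp add: f_def g_def h_def)
    qed auto
    also have "\<dots> = (qpoch q q m)\<^sup>2 * g (2 * m + 1)"
      using jacobi_finite[of m] by (simp add: q_def g_def)
    finally show ?thesis .
  qed
  moreover have "(\<lambda>m. (qpoch q q m)\<^sup>2 * g (2 * m + 1)) \<longlonglongrightarrow> Q\<^sup>2 * (1 / Q)"
  proof (intro tendsto_mult tendsto_power)
    show "(\<lambda>m. qpoch q q m) \<longlonglongrightarrow> Q" unfolding Q_def by (rule qpoch_tendsto[OF q])
    have "filterlim (\<lambda>m. 2 * m + 1 :: nat) at_top at_top"
      by (rule filterlim_subseq) (auto simp: strict_mono_def)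
    from filterlim_compose[OF inverse_qpoch_tendsto[OF q] this]
    show "(\<lambda>m. g (2 * m + 1)) \<longlonglongrightarrow> 1 / Q" by (simp add: g_def Q_def)
  qed
  ultimately have "(\<Sum>\<^sub>\<infinity>k. h k * (1 / Q * (1 / Q))) = Q\<^sup>2 * (1 / Q)"
    using LIMSEQ_unique by fastforce
  then have "infsum h UNIV = Q ^ 3"
    unfolding infsum_cmult_left' using Q by (simp add: field_simps power2_eq_square power3_eq_cube)
  then show ?thesis using has_sum_infsum[OF hs] by (simp add: h_def[abs_def] Q_def q_def)
qed

end

section \<open>Holomorphy in q and Euler derivatives of sparse series\<close>

lemma qpoch_inf_holomorphic: "(\<lambda>q. qpoch_inf q q) holomorphic_on ball 0 1"
proof -
  have "(\<lambda>q. qpoch_inf q q) holomorphic_on ball 0 r" if r: "0 < r" "r < 1" for r :: real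
  proof -
    have "uniformly_convergent_on (cball 0 r) (\<lambda>N x. \<Sum>n<N. norm ((1 - x * x ^ n) - 1 :: complex))"
    proof (rule Weierstrass_m_test'[where M = "\<lambda>n. r ^ Suc n"])
      fix n and x :: complex assume "x \<in> cball 0 r"
      then have "norm x ^ Suc n \<le> r ^ Suc n" by (intro power_mono) auto
      then show "norm (norm ((1 - x * x ^ n) - 1)) \<le> r ^ Suc n" by (simp add: norm_mult norm_power)
    next
      show "summable (\<lambda>n. r ^ Suc n)" using r by (subst summable_Suc_iff) (simp add: summable_geometric)
    qed
    then have "uniformly_convergent_on (cball 0 r) (\<lambda>N x. \<Prod>n<N. 1 - x * x ^ n :: complex)"
      by (intro Infinite_Products.uniformly_convergent_on_prod') (auto intro!: continuous_intros)
    then obtain l where l: "uniform_limit (cball 0 r) (\<lambda>N x. \<Prod>n<N. 1 - x * x ^ n :: complex) l sequentially"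
      by (auto simp: uniformly_convergent_on_def)
    have "\<forall>\<^sub>F N in sequentially. continuous_on (cball 0 r) (\<lambda>x. \<Prod>n<N. 1 - x * x ^ n :: complex)
        \<and> (\<lambda>x. \<Prod>n<N. 1 - x * x ^ n :: complex) holomorphic_on ball 0 r"
      by (intro always_eventually allI conjI continuous_intros holomorphic_intros)
    from holomorphic_uniform_limit[OF this l]
    have "l holomorphic_on ball 0 r" by auto
    moreover have "l x = qpoch_inf x x" if "x \<in> ball 0 r" for x
    proof (rule LIMSEQ_unique)
      show "(\<lambda>N. \<Prod>n<N. 1 - x * x ^ n) \<longlonglongrightarrow> l x" using tendsto_uniform_limitI[OF l] that by auto
      show "(\<lambda>N. \<Prod>n<N. 1 - x * x ^ n) \<longlonglongrightarrow> qpoch_inf x x"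
        using qpoch_tendsto[of x] that r by (simp add: qpoch_eq_lessThan)
    qed
    ultimately show ?thesis by (rule holomorphic_transform)
  qed
  note * = this
  have "(\<lambda>q. qpoch_inf q q) holomorphic_on (\<Union>r\<in>{0<..<1}. ball 0 r)"
    by (rule holomorphic_on_UN_open) (use * in auto)
  moreover have "(\<Union>r\<in>{0<..<1::real}. ball (0::complex) r) = ball 0 1"
  proof (intro equalityI subsetI)
    fix x :: complex assume "x \<in> ball 0 1"
    then have "x \<in> ball 0 ((1 + norm x) / 2)" "(1 + norm x) / 2 \<in> {0<..<1}"
      by (auto intro: add_pos_nonneg)
    then show "x \<in> (\<Union>r\<in>{0<..<1::real}. ball 0 r)" by blast
  qed auto
  ultimately show ?thesis by simp
qed

text \<open>The index set is arbitrary since theta series run over the integers and exponents may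
  repeat. Partial sums converge locally uniformly, which allows termwise differentiation; the
  operator q d/dq keeps every exponent, so exponent 0 is no special case.\<close>

lemma sparse_power_series_deriv:
  fixes c :: "'a \<Rightarrow> complex" and e :: "'a \<Rightarrow> nat"
  assumes S: "\<And>r. 0 < r \<Longrightarrow> r < 1 \<Longrightarrow> (\<lambda>k. norm (c k) * r ^ e k) summable_on A"
  defines "f \<equiv> \<lambda>q. \<Sum>\<^sub>\<infinity>k\<in>A. c k * q ^ e k"
  shows "f holomorphic_on ball 0 1"
    "\<And>q. norm q < 1 \<Longrightarrow> q * deriv f q = (\<Sum>\<^sub>\<infinity>k\<in>A. of_nat (e k) * (c k * q ^ e k))"
proof -
  have lim: "uniform_limit (cball 0 r) (\<lambda>X q. \<Sum>k\<in>X. c k * q ^ e k) f (finite_subsets_at_top A)"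
    if r: "0 < r" "r < 1" for r
    unfolding f_def
  proof (rule Weierstrass_m_test_general[OF _ S[OF r]])
    fix k and q :: complex assume "q \<in> cball 0 r"
    then show "norm (c k * q ^ e k) \<le> norm (c k) * r ^ e k"
      by (auto simp: norm_mult norm_power intro!: mult_left_mono power_mono)
  qed
  have hol: "f holomorphic_on ball 0 r" if r: "0 < r" "r < 1" for r
  proof -
    have "\<forall>\<^sub>F X in finite_subsets_at_top A. continuous_on (cball 0 r) (\<lambda>q. \<Sum>k\<in>X. c k * q ^ e k)
        \<and> (\<lambda>q. \<Sum>k\<in>X. c k * q ^ e k) holomorphic_on ball 0 r"
      by (intro always_eventually allI conjI continuous_intros holomorphic_intros)
    from holomorphic_uniform_limit[OF this lim[OF r]] show ?thesis by auto
  qed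
  have rad: "\<exists>r. 0 < r \<and> r < 1 \<and> q \<in> ball 0 r" if "norm q < 1" for q :: complex
    using that by (intro exI[of _ "(1 + norm q) / 2"]) (auto intro: add_pos_nonneg)
  have "f holomorphic_on (\<Union>r\<in>{0<..<1}. ball 0 r)"
    by (rule holomorphic_on_UN_open) (use hol in auto)
  then show "f holomorphic_on ball 0 1"
    by (rule holomorphic_on_subset) (use rad in fastforce)
  fix q :: complex assume "norm q < 1"
  then obtain r where r: "0 < r" "r < 1" "q \<in> ball 0 r" using rad by blast
  have "uniform_limit (ball 0 r) (\<lambda>X q. \<Sum>k\<in>X. c k * q ^ e k) f (finite_subsets_at_top A)"
    by (rule uniform_limit_on_subset[OF lim[OF r(1,2)]]) auto
  moreover have "\<forall>\<^sub>F X in finite_subsets_at_top A. (\<lambda>q. \<Sum>k\<in>X. c k * q ^ e k) holomorphic_on ball 0 r"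
    by (intro always_eventually allI holomorphic_intros)
  ultimately have "((\<lambda>X. (deriv ^^ 1) (\<lambda>q. \<Sum>k\<in>X. c k * q ^ e k) q) \<longlongrightarrow> (deriv ^^ 1) f q) (finite_subsets_at_top A)"
    by (rule higher_deriv_complex_uniform_limit[OF _ _ finite_subsets_at_top_neq_bot open_ball r(3)])
  then have "((\<lambda>X. deriv (\<lambda>q. \<Sum>k\<in>X. c k * q ^ e k) q) \<longlongrightarrow> deriv f q) (finite_subsets_at_top A)"
    by simp
  then have "((\<lambda>X. q * deriv (\<lambda>q. \<Sum>k\<in>X. c k * q ^ e k) q) \<longlongrightarrow> q * deriv f q) (finite_subsets_at_top A)"
    by (rule tendsto_mult[OF tendsto_const])
  moreover have "q * deriv (\<lambda>q. \<Sum>k\<in>X. c k * q ^ e k) q = (\<Sum>k\<in>X. of_nat (e k) * (c k * q ^ e k))" for X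
  proof -
    have "((\<lambda>q. \<Sum>k\<in>X. c k * q ^ e k) has_field_derivative (\<Sum>k\<in>X. c k * (of_nat (e k) * q ^ (e k - 1)))) (at q)"
      by (auto intro!: derivative_eq_intros sum.cong simp: mult_ac)
    then have "q * deriv (\<lambda>q. \<Sum>k\<in>X. c k * q ^ e k) q = q * (\<Sum>k\<in>X. c k * (of_nat (e k) * q ^ (e k - 1)))"
      by (simp add: DERIV_imp_deriv)
    also have "\<dots> = (\<Sum>k\<in>X. of_nat (e k) * (c k * q ^ e k))"
      unfolding sum_distrib_left
    proof (intro sum.cong refl)
      fix k show "q * (c k * (of_nat (e k) * q ^ (e k - 1))) = of_nat (e k) * (c k * q ^ e k)"
        by (cases "e k") auto
    qed
    finally show ?thesis .
  qed
  ultimately have "((\<lambda>k. of_nat (e k) * (c k * q ^ e k)) has_sum q * deriv f q) A"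
    by (simp add: has_sum_def)
  then show "q * deriv f q = (\<Sum>\<^sub>\<infinity>k\<in>A. of_nat (e k) * (c k * q ^ e k))"
    by (simp add: infsumI)
qed

section \<open>Theta functions of level \<open>n + 2\<close>\<close>

text \<open>With v = r + (2n + 4)k the exponent is (v^2 - r^2)/(4(n + 2)), the contribution of one
  coordinate to the right-hand side. Subtracting r^2 makes the series start with q^0.\<close>

definition level_theta :: "nat \<Rightarrow> nat \<Rightarrow> nat \<Rightarrow> complex \<Rightarrow> complex" where
  "level_theta n r j q =
     (\<Sum>\<^sub>\<infinity>k. of_int (int r + (2 * int n + 4) * k) ^ j * q ^ nat (k * (int r + (int n + 2) * k)))"

text \<open>This lower bound shows that \<open>nat\<close> in \<open>level_theta\<close> cuts
  nothing off and that the series converges like a Gaussian.\<close>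

lemma level_theta_exponent_ge:
  assumes "r \<le> n + 1"
  shows "k\<^sup>2 \<le> k * (int r + (int n + 2) * k)"
proof -
  have "0 \<le> k * (int r + (int n + 1) * k)"
  proof (cases "k \<ge> 0")
    case False
    then have "(int n + 1) * k \<le> (int n + 1) * (-1)" by (intro mult_left_mono) auto
    then have "int r + (int n + 1) * k \<le> 0" using assms by simp
    then show ?thesis using False by (intro mult_nonpos_nonpos) auto
  qed auto
  then show ?thesis by (simp add: algebra_simps power2_eq_square)
qed

lemma level_theta_exponent_nonneg:
  assumes "r \<le> n + 1"
  shows "0 \<le> k * (int r + (int n + 2) * k)"
  using level_theta_exponent_ge[OF assms, of k] zero_le_power2[of k] by linarith

lemma level_theta_abs_summable:
  assumes r: "r \<le> n + 1" and x: "0 < x" "x < (1 :: real)"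
  shows "(\<lambda>k. norm (of_int (int r + (2 * int n + 4) * k) ^ j :: complex)
     * x ^ nat (k * (int r + (int n + 2) * k))) summable_on UNIV"
proof -
  define c where "c = real r"
  define d where "d = 2 * real n + 4"
  have S: "(\<lambda>k::int. x powi (k\<^sup>2) * exp d ^ nat \<bar>k\<bar>) summable_on UNIV"
    by (rule summable_on_gauss) (use x in auto)
  show ?thesis
  proof (rule summable_on_dominated[OF summable_on_cmult_right[OF S]])
    fix k :: int
    let ?v = "\<bar>real_of_int (int r + (2 * int n + 4) * k)\<bar>"
    have "?v ^ j \<le> fact j * exp ?v" by (rule power_le_fact_exp) simp
    also have "?v \<le> c + d * real (nat \<bar>k\<bar>)"
      using abs_triangle_ineq[of "real r" "(2 * real n + 4) * real_of_int k"]
      by (simp add: c_def d_def abs_mult)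
    then have "fact j * exp ?v \<le> fact j * exp (c + d * real (nat \<bar>k\<bar>))" by simp
    also have "\<dots> = fact j * exp c * exp d ^ nat \<bar>k\<bar>"
      by (simp add: exp_add exp_of_nat_mult[symmetric] mult_ac)
    finally have 1: "?v ^ j \<le> fact j * exp c * exp d ^ nat \<bar>k\<bar>" .
    have "nat (k\<^sup>2) \<le> nat (k * (int r + (int n + 2) * k))"
      using level_theta_exponent_ge[OF r, of k] by (rule nat_mono)
    then have 2: "x ^ nat (k * (int r + (int n + 2) * k)) \<le> x powi (k\<^sup>2)"
      using x by (simp add: power_int_def power_decreasing)
    have "?v ^ j * x ^ nat (k * (int r + (int n + 2) * k)) \<le> (fact j * exp c * exp d ^ nat \<bar>k\<bar>) * x powi (k\<^sup>2)"
      using 1 2 x by (intro mult_mono) auto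
    then show "norm (norm (of_int (int r + (2 * int n + 4) * k) ^ j :: complex)
         * x ^ nat (k * (int r + (int n + 2) * k))) \<le> fact j * exp c * (x powi (k\<^sup>2) * exp d ^ nat \<bar>k\<bar>)"
      using x by (simp add: norm_power mult_ac del: of_int_add of_int_mult)
  qed
qed

lemma level_theta_holomorphic: "r \<le> n + 1 \<Longrightarrow> level_theta n r j holomorphic_on ball 0 1"
  unfolding level_theta_def[abs_def]
  by (rule sparse_power_series_deriv(1)[OF level_theta_abs_summable])

lemma level_theta_summable:
  fixes q :: complex
  assumes "r \<le> n + 1" "norm q < 1"
  shows "(\<lambda>k. of_int (int r + (2 * int n + 4) * k) ^ j * q ^ nat (k * (int r + (int n + 2) * k))) summable_on UNIV"
proof -
  define x where "x = (1 + norm q) / 2"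
  have x: "0 < x" "x < 1" "norm q \<le> x"
    using assms(2) norm_ge_zero[of q] unfolding x_def by (auto simp: field_simps intro: add_pos_nonneg)
  show ?thesis
    by (rule summable_on_dominated[OF level_theta_abs_summable[OF assms(1) x(1,2), where j = j]])
       (use x(3) in \<open>auto simp: norm_mult norm_power intro!: mult_left_mono power_mono simp del: of_int_add of_int_mult\<close>)
qed

text \<open>The heat equation: 4(n + 2) times the exponent is v^2 - r^2, so the Euler derivative
  raises the moment order by two, up to a multiple of the series itself.\<close>

lemma level_theta_deriv:
  assumes r: "r \<le> n + 1" and q: "norm q < 1"
  shows "4 * (of_nat n + 2) * (q * deriv (level_theta n r j) q)
     = level_theta n r (j + 2) q - (of_nat r)\<^sup>2 * level_theta n r j q"
proof -
  let ?v = "\<lambda>k::int. int r + (2 * int n + 4) * k"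
  let ?e = "\<lambda>k::int. nat (k * (int r + (int n + 2) * k))"
  have e: "4 * (of_nat n + 2) * of_nat (?e k) = (of_int (?v k))\<^sup>2 - (of_nat r :: complex)\<^sup>2" for k
  proof -
    have "4 * (int n + 2) * int (?e k) = (?v k)\<^sup>2 - (int r)\<^sup>2"
      using level_theta_exponent_nonneg[OF r, of k] by (simp add: power2_eq_square algebra_simps)
    then have "of_int (4 * (int n + 2) * int (?e k)) = (of_int ((?v k)\<^sup>2 - (int r)\<^sup>2) :: complex)" by (simp only:)
    then show ?thesis
      by (simp only: of_int_of_nat_eq of_int_mult of_int_add of_int_diff of_int_power of_int_numeral)
  qed
  have "4 * (of_nat n + 2) * (q * deriv (level_theta n r j) q)
     = 4 * (of_nat n + 2) * (\<Sum>\<^sub>\<infinity>k. of_nat (?e k) * (of_int (?v k) ^ j * q ^ ?e k))"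
    unfolding level_theta_def[abs_def]
    by (subst sparse_power_series_deriv(2)[OF level_theta_abs_summable[OF r] q]) simp_all
  also have "\<dots> = (\<Sum>\<^sub>\<infinity>k. of_int (?v k) ^ (j + 2) * q ^ ?e k - (of_nat r)\<^sup>2 * (of_int (?v k) ^ j * q ^ ?e k))"
    unfolding infsum_cmult_right'[symmetric]
  proof (rule infsum_cong)
    fix k
    have "4 * (of_nat n + 2) * (of_nat (?e k) * (of_int (?v k) ^ j * q ^ ?e k))
      = (4 * (of_nat n + 2) * of_nat (?e k)) * (of_int (?v k) ^ j * q ^ ?e k)" by (simp only: mult.assoc)
    also have "\<dots> = of_int (?v k) ^ (j + 2) * q ^ ?e k - (of_nat r)\<^sup>2 * (of_int (?v k) ^ j * q ^ ?e k)"
      unfolding e power_add by (simp only: algebra_simps)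
    finally show "4 * (of_nat n + 2) * (of_nat (?e k) * (of_int (?v k) ^ j * q ^ ?e k))
      = of_int (?v k) ^ (j + 2) * q ^ ?e k - (of_nat r)\<^sup>2 * (of_int (?v k) ^ j * q ^ ?e k)" .
  qed
  also have "\<dots> = level_theta n r (j + 2) q - (of_nat r)\<^sup>2 * level_theta n r j q"
    unfolding level_theta_def
    by (intro infsumI has_sum_minus has_sum_cmult_right has_sum_infsum level_theta_summable r q)
  finally show ?thesis .
qed

context
  fixes p :: complex and n :: nat
  assumes norm_p: "norm p < 1" and p_nz: "p \<noteq> 0"
begin

text \<open>The centre of antisymmetry of the product with 2n theta factors lies at -n; recentring
  makes b an odd function.\<close>

private definition b :: "int \<Rightarrow> complex" where
  "b v = theta_product_seq p (2 * n) (v - int n)"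

private lemma b_minus: "b (- v) = - b v"
proof -
  have "- v - int n = - int (2 * n) - (v - int n)" by simp
  then show ?thesis unfolding b_def by (simp only: theta_product_seq_reflect) simp
qed

private lemma b_shift: "b (v + (2 * int n + 4)) = p powi (2 * (v + int n + 2)) * b v"
  using theta_product_seq_shift[OF p_nz, of "2 * n" "v - int n"] by (simp add: b_def algebra_simps)

private lemma b_period: "b (r + (2 * int n + 4) * k) = p powi (2 * (k * (r + (int n + 2) * k))) * b r"
proof -
  have step: "b (r + (2 * int n + 4) * (k + 1)) = p powi (2 * (r + (2 * int n + 4) * k + int n + 2)) * b (r + (2 * int n + 4) * k)" for k
    using b_shift[of "r + (2 * int n + 4) * k"] by (simp add: algebra_simps)
  have ex: "2 * ((k + 1) * (r + (int n + 2) * (k + 1))) = 2 * (r + (2 * int n + 4) * k + int n + 2) + 2 * (k * (r + (int n + 2) * k))" for k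
    by (simp add: algebra_simps)
  show ?thesis
  proof (induction k rule: int_induct[where k = 0])
    case (step1 i)
    show ?case unfolding step step1(2) ex power_int_add[OF disjI1[OF p_nz]] by (simp only: mult.assoc)
  next
    case (step2 i)
    have "p powi (2 * (r + (2 * int n + 4) * (i - 1) + int n + 2)) * b (r + (2 * int n + 4) * (i - 1))
      = p powi (2 * (r + (2 * int n + 4) * (i - 1) + int n + 2)) * (p powi (2 * ((i - 1) * (r + (int n + 2) * (i - 1)))) * b r)"
      using step[of "i - 1"] ex[of "i - 1"] step2(2) power_int_add[OF disjI1[OF p_nz]] by (simp only: mult.assoc diff_add_cancel)
    then show ?case using p_nz by simp
  qed simp
qed

private lemma b_0: "b 0 = 0"
  using b_minus[of 0] by simp

private lemma b_half_period: "b (int n + 2) = 0"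
  using b_minus[of "int n + 2"] b_shift[of "- (int n + 2)"] by (simp add: algebra_simps)

text \<open>The moment is split by classes modulo 2n + 4, on each of which b is one value times
  powers of q. Oddness and quasi-periodicity annihilate the classes 0 and n + 2. As j is odd, the
  classes r and -r contribute equally: n + 1 unknowns and the factor 1/2 remain.\<close>

lemma theta_product_linear_relation:
  assumes "odd j"
  shows "(\<Sum>r=1..n + 1. theta_product_seq p (2 * n) (int r - int n) * level_theta n r j (p\<^sup>2))
     = fact j * fps_nth (moment_fps (of_nat n) (theta_product_seq p (2 * n))) j / 2"
proof -
  define K where "K = 2 * int n + 4"
  define f where "f v = b v * of_int v ^ j" for v
  have S0: "(\<lambda>k. theta_product_seq p (2 * n) k * (of_int k + of_nat n) ^ j) summable_on UNIV"
    by (rule moment_summable[OF rapidly_decreasing_theta_product_seq[OF norm_p p_nz]])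
  have bij0: "bij_betw (\<lambda>v::int. v - int n) UNIV UNIV"
    by (rule bij_betw_byWitness[where f' = "\<lambda>v. v + int n"]) auto
  have feq: "f = (\<lambda>v. (\<lambda>k. theta_product_seq p (2 * n) k * (of_int k + of_nat n) ^ j) (v - int n))"
    by (simp add: f_def b_def fun_eq_iff)
  have S: "f summable_on UNIV"
    unfolding feq using S0 by (subst summable_on_reindex_bij_betw[OF bij0])
  have tot: "infsum f UNIV = fact j * fps_nth (moment_fps (of_nat n) (theta_product_seq p (2 * n))) j"
    unfolding feq by (subst infsum_reindex_bij_betw[OF bij0]) (simp add: moment_fps_def)
  have feven: "f (- v) = f v" for v
    using assms by (simp add: f_def b_minus)
  have bij: "bij_betw (\<lambda>(r, k). r + K * k) ({0..<K} \<times> UNIV) UNIV"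
    by (rule bij_betw_byWitness[where f' = "\<lambda>v. (v mod K, v div K)"]) (auto simp: K_def)
  define H where "H r = (\<Sum>\<^sub>\<infinity>k. f (r + K * k))" for r
  have S2: "(\<lambda>x. f ((\<lambda>(r, k). r + K * k) x)) summable_on ({0..<K} \<times> UNIV)"
    using S by (subst summable_on_reindex_bij_betw[OF bij])
  have "infsum f UNIV = infsum (\<lambda>x. f ((\<lambda>(r, k). r + K * k) x)) ({0..<K} \<times> UNIV)"
    by (rule infsum_reindex_bij_betw[OF bij, symmetric])
  also have "\<dots> = (\<Sum>\<^sub>\<infinity>r\<in>{0..<K}. \<Sum>\<^sub>\<infinity>k. f ((\<lambda>(r, k). r + K * k) (r, k)))"
    by (rule infsum_Sigma_banach[OF S2, symmetric])
  also have "\<dots> = (\<Sum>r\<in>{0..<K}. H r)" by (simp add: H_def)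
  also have "{0..<K} = insert 0 (insert (int n + 2) ({1..int n + 1} \<union> {int n + 3..<K}))"
    by (auto simp: K_def)
  also have "(\<Sum>r\<in>\<dots>. H r) = H 0 + (H (int n + 2) + ((\<Sum>r\<in>{1..int n + 1}. H r) + (\<Sum>r\<in>{int n + 3..<K}. H r)))"
    by (subst sum.insert, simp, simp, subst sum.insert, simp, simp, subst sum.union_disjoint) auto
  also have "H 0 = 0"
    using b_period[of 0] b_0 by (simp add: H_def f_def K_def)
  also have "H (int n + 2) = 0"
    using b_period[of "int n + 2"] b_half_period by (simp add: H_def f_def K_def)
  also have "(\<Sum>r\<in>{int n + 3..<K}. H r) = (\<Sum>r\<in>{1..int n + 1}. H r)"
  proof (rule sum.reindex_bij_witness[of _ "\<lambda>r. K - r" "\<lambda>r. K - r"])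
    fix r
    have "H r = (\<Sum>\<^sub>\<infinity>k. f (r + K * (- 1 - k)))"
      unfolding H_def by (rule infsum_reindex_bij_witness[of _ "\<lambda>k. - 1 - k" "\<lambda>k. - 1 - k"]) auto
    also have "\<dots> = H (K - r)"
      unfolding H_def
    proof (rule infsum_cong)
      fix k
      have "r + K * (- 1 - k) = - (K - r + K * k)" by (simp add: algebra_simps)
      then show "f (r + K * (- 1 - k)) = f (K - r + K * k)" by (simp only: feven)
    qed
    finally show "H (K - r) = H r" ..
  qed (auto simp: K_def)
  finally have "infsum f UNIV = 2 * (\<Sum>r\<in>{1..int n + 1}. H r)" by simp
  also have "(\<Sum>r\<in>{1..int n + 1}. H r) = (\<Sum>r=1..n + 1. H (int r))"
    by (rule sum.reindex_bij_witness[of _ int nat]) auto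
  also have "\<dots> = (\<Sum>r=1..n + 1. theta_product_seq p (2 * n) (int r - int n) * level_theta n r j (p\<^sup>2))"
  proof (intro sum.cong refl)
    fix r assume "r \<in> {1..n + 1}"
    then have r: "r \<le> n + 1" by simp
    have "H (int r) = (\<Sum>\<^sub>\<infinity>k. b (int r) * (of_int (int r + (2 * int n + 4) * k) ^ j * (p\<^sup>2) ^ nat (k * (int r + (int n + 2) * k))))"
      unfolding H_def
    proof (rule infsum_cong)
      fix k
      have "p powi (2 * (k * (int r + (int n + 2) * k))) = (p\<^sup>2) ^ nat (k * (int r + (int n + 2) * k))"
        using level_theta_exponent_nonneg[OF r, of k] by (simp add: power_int_def nat_mult_distrib power_mult)
      then show "f (int r + K * k) = b (int r) * (of_int (int r + (2 * int n + 4) * k) ^ j * (p\<^sup>2) ^ nat (k * (int r + (int n + 2) * k)))"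
        unfolding f_def K_def b_period by (simp only: mult_ac)
    qed
    then show "H (int r) = theta_product_seq p (2 * n) (int r - int n) * level_theta n r j (p\<^sup>2)"
      unfolding infsum_cmult_right' level_theta_def b_def .
  qed
  finally show ?thesis unfolding tot by simp
qed

end

section \<open>Determinants of theta series\<close>

text \<open>U is unipotent and its last column lists the coefficients of the polynomial P with roots
  x_0, ..., x_(n-1). In V * U the last column therefore consists of values of P, all zero except in
  the last row.\<close>

lemma det_vandermonde:
  fixes x :: "nat \<Rightarrow> 'a :: field"
  shows "det (mat n n (\<lambda>(i, j). x i ^ j)) = (\<Prod>j<n. \<Prod>i<j. x j - x i)"
proof (induction n)
  case 0
  show ?case by (simp add: det_dim_zero)
next
  case (Suc n)
  define P where "P = (\<Prod>i<n. [:- x i, 1:])"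
  have deg: "degree P = n" and lead: "coeff P n = 1"
  proof -
    show d: "degree P = n" unfolding P_def by (subst degree_prod_eq_sum_degree) auto
    have "lead_coeff P = 1" unfolding P_def by (simp add: lead_coeff_prod)
    then show "coeff P n = 1" by (simp add: d)
  qed
  define V where "V = mat (Suc n) (Suc n) (\<lambda>(i, j). x i ^ j)"
  define U where "U = mat (Suc n) (Suc n) (\<lambda>(i, j). if j = n then coeff P i else if i = j then 1 else 0)"
  have V: "V \<in> carrier_mat (Suc n) (Suc n)" and U: "U \<in> carrier_mat (Suc n) (Suc n)"
    by (auto simp: V_def U_def)
  have "det U = prod_list (diag_mat U)"
    by (rule det_upper_triangular[OF _ U]) (auto simp: upper_triangular_def U_def)
  also have "diag_mat U = replicate (Suc n) 1"
  proof (rule nth_equalityI)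
    show len: "length (diag_mat U) = length (replicate (Suc n) (1 :: 'a))" by (simp add: diag_mat_def U_def)
    fix i assume "i < length (diag_mat U)"
    then have "i < Suc n" using len by simp
    then show "diag_mat U ! i = replicate (Suc n) 1 ! i"
      by (simp add: diag_mat_def U_def lead del: upt_Suc replicate_Suc)
  qed
  finally have detU: "det U = 1" by simp
  have VU: "V * U \<in> carrier_mat (Suc n) (Suc n)" using V U by simp
  have entry: "(V * U) $$ (i, j) = (if j = n then poly P (x i) else x i ^ j)" if "i < Suc n" "j < Suc n" for i j
  proof -
    have "(V * U) $$ (i, j) = (\<Sum>k<Suc n. x i ^ k * U $$ (k, j))"
      using that V U by (simp add: scalar_prod_def V_def atLeast0LessThan)
    also have "\<dots> = (if j = n then (\<Sum>k<Suc n. x i ^ k * coeff P k) else (\<Sum>k<Suc n. if k = j then x i ^ j else 0))"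
    proof (cases "j = n")
      case False
      have "(\<Sum>k<Suc n. x i ^ k * U $$ (k, j)) = (\<Sum>k<Suc n. if k = j then x i ^ j else 0)"
        by (intro sum.cong) (use that False in \<open>auto simp: U_def\<close>)
      then show ?thesis using False by (simp del: sum.lessThan_Suc)
    qed (auto simp: U_def intro!: sum.cong)
    also have "\<dots> = (if j = n then poly P (x i) else x i ^ j)"
      using that by (auto simp: poly_altdef deg lessThan_Suc_atMost mult.commute intro!: sum.cong)
    finally show ?thesis .
  qed
  have root: "poly P (x i) = 0" if "i < n" for i
    using that by (auto simp: P_def poly_prod intro!: prod_zero)
  have "det V = det (V * U)"
    using det_mult[OF V U] detU by simp
  also have "\<dots> = (\<Sum>i<Suc n. (V * U) $$ (i, n) * cofactor (V * U) i n)"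
    by (rule laplace_expansion_column[OF VU]) simp
  also have "\<dots> = poly P (x n) * cofactor (V * U) n n"
    using entry root by simp
  also have "cofactor (V * U) n n = det (mat n n (\<lambda>(i, j). x i ^ j))"
  proof -
    have "mat_delete (V * U) n n = mat n n (\<lambda>(i, j). x i ^ j)"
    proof (rule eq_matI)
      fix i j assume "i < dim_row (mat n n (\<lambda>(i, j). x i ^ j))" "j < dim_col (mat n n (\<lambda>(i, j). x i ^ j))"
      then show "mat_delete (V * U) n n $$ (i, j) = mat n n (\<lambda>(i, j). x i ^ j) $$ (i, j)"
        using entry[of i j] U V unfolding mat_delete_def by simp
    qed (use U V in auto)
    then show ?thesis by (simp add: cofactor_def)
  qed
  also have "poly P (x n) = (\<Prod>i<n. x n - x i)" by (simp add: P_def poly_prod)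
  finally show ?case using Suc.IH by (simp add: V_def mult.commute)
qed

lemma det_mult_rows:
  fixes c :: "nat \<Rightarrow> 'a :: comm_ring_1"
  shows "det (mat n n (\<lambda>(i, j). c i * A i j)) = (\<Prod>i<n. c i) * det (mat n n (\<lambda>(i, j). A i j))"
proof -
  have "signof \<pi> * (\<Prod>i=0..<n. c i * A i (\<pi> i)) = (\<Prod>i<n. c i) * (signof \<pi> * (\<Prod>i=0..<n. A i (\<pi> i)))" for \<pi>
    by (simp add: prod.distrib atLeast0LessThan mult_ac)
  moreover have "(\<Prod>i=0..<n. mat n n (\<lambda>(i, j). B i j) $$ (i, \<pi> i)) = (\<Prod>i=0..<n. B i (\<pi> i))"
    if "\<pi> permutes {0..<n}" for \<pi> and B :: "nat \<Rightarrow> nat \<Rightarrow> 'a"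
    using permutes_in_image[OF that] by (intro prod.cong) auto
  ultimately show ?thesis
    by (simp add: det_def'[OF mat_carrier] sum_distrib_left)
qed

lemma det_odd_vandermonde:
  fixes x :: "nat \<Rightarrow> 'a :: field"
  shows "det (mat n n (\<lambda>(i, j). x i ^ (2 * j + 1))) = (\<Prod>i<n. x i) * (\<Prod>j<n. \<Prod>i<j. (x j)\<^sup>2 - (x i)\<^sup>2)"
proof -
  have "det (mat n n (\<lambda>(i, j). x i ^ (2 * j + 1))) = det (mat n n (\<lambda>(i, j). x i * ((x i)\<^sup>2) ^ j))"
    by (simp add: power_mult)
  also have "\<dots> = (\<Prod>i<n. x i) * (\<Prod>j<n. \<Prod>i<j. (x j)\<^sup>2 - (x i)\<^sup>2)"
    unfolding det_mult_rows det_vandermonde ..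
  finally show ?thesis .
qed

text \<open>The row relation x A = (0, ..., 0, c) multiplied by the adjugate. No division occurs, so
  nothing about \<open>det A\<close> has to be known.\<close>

lemma cramer_last:
  fixes A :: "'a :: comm_ring_1 mat"
  assumes A: "A \<in> carrier_mat (Suc n) (Suc n)"
    and x: "\<And>j. j < Suc n \<Longrightarrow> (\<Sum>i<Suc n. x i * A $$ (i, j)) = (if j = n then c else 0)"
    and k: "k < Suc n"
  shows "c * cofactor A k n = det A * x k"
proof -
  have adj: "adj_mat A $$ (j, k) = cofactor A k j" if "j < Suc n" for j
    using that k A by (simp add: adj_mat_def)
  have AA: "(A * adj_mat A) $$ (i, k) = (\<Sum>j<Suc n. A $$ (i, j) * cofactor A k j)" if "i < Suc n" for i
    using that k A adj_mat(1)[OF A] adj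
    by (simp add: scalar_prod_def atLeast0LessThan del: sum.lessThan_Suc)
  have "c * cofactor A k n = (\<Sum>j<Suc n. (\<Sum>i<Suc n. x i * A $$ (i, j)) * cofactor A k j)"
    by (subst sum.cong[OF refl, of _ _ "\<lambda>j. if j = n then c * cofactor A k n else 0"]) (use x in auto)
  also have "\<dots> = (\<Sum>i<Suc n. x i * (\<Sum>j<Suc n. A $$ (i, j) * cofactor A k j))"
    unfolding sum_distrib_right sum_distrib_left mult.assoc by (rule sum.swap)
  also have "\<dots> = (\<Sum>i<Suc n. x i * (if i = k then det A else 0))"
  proof (intro sum.cong refl)
    fix i assume i: "i \<in> {..<Suc n}"
    then have "(\<Sum>j<Suc n. A $$ (i, j) * cofactor A k j) = (det A \<cdot>\<^sub>m 1\<^sub>m (Suc n)) $$ (i, k)"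
      using AA[of i] adj_mat(2)[OF A] by simp
    also have "\<dots> = (if i = k then det A else 0)" using i k by simp
    finally show "x i * (\<Sum>j<Suc n. A $$ (i, j) * cofactor A k j) = x i * (if i = k then det A else 0)" by simp
  qed
  also have "\<dots> = (\<Sum>i<Suc n. if i = k then det A * x k else 0)"
    by (intro sum.cong) auto
  also have "\<dots> = det A * x k" using k by (subst sum.delta) auto
  finally show ?thesis .
qed

lemma det_replace_last_col:
  fixes A :: "'a :: comm_ring_1 mat"
  assumes A: "A \<in> carrier_mat (Suc n) (Suc n)"
  shows "det (mat (Suc n) (Suc n) (\<lambda>(i, j). if j = n then h i else A $$ (i, j)))
     = (\<Sum>i<Suc n. h i * cofactor A i n)"
proof -
  let ?B = "mat (Suc n) (Suc n) (\<lambda>(i, j). if j = n then h i else A $$ (i, j))"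
  have "cofactor ?B i n = cofactor A i n" if "i < Suc n" for i
  proof -
    have "mat_delete ?B i n = mat_delete A i n"
      by (rule eq_matI) (use A that in \<open>auto simp: mat_delete_def\<close>)
    then show ?thesis by (simp add: cofactor_def)
  qed
  then show ?thesis
    by (subst laplace_expansion_column[of ?B "Suc n" n]) (auto intro!: sum.cong)
qed

text \<open>With h the next column of moments, this expresses the determinant that arises by
  differentiation through \<open>det A\<close> itself.\<close>

lemma cramer_last_replace:
  fixes A :: "'a :: comm_ring_1 mat"
  assumes A: "A \<in> carrier_mat (Suc n) (Suc n)"
    and x: "\<And>j. j < Suc n \<Longrightarrow> (\<Sum>i<Suc n. x i * A $$ (i, j)) = (if j = n then c else 0)"
  shows "c * det (mat (Suc n) (Suc n) (\<lambda>(i, j). if j = n then h i else A $$ (i, j)))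
     = det A * (\<Sum>i<Suc n. x i * h i)"
proof -
  have "c * (h i * cofactor A i n) = det A * (x i * h i)" if "i < Suc n" for i
    using cramer_last[OF A x that] by (metis mult.assoc mult.commute)
  then show ?thesis
    unfolding det_replace_last_col[OF A] sum_distrib_left by (intro sum.cong) auto
qed

text \<open>Differentiating column \<open>j\<close> reproduces column \<open>j + 1\<close>, so by alternation only the last
  column contributes.\<close>
lemma det_euler_derivative:
  fixes g :: "nat \<Rightarrow> nat \<Rightarrow> complex \<Rightarrow> complex"
  assumes g': "\<And>i j. i < Suc n \<Longrightarrow> j < Suc n \<Longrightarrow> (g i j has_field_derivative g' i j) (at q)"
    and rec: "\<And>i j. i < Suc n \<Longrightarrow> j < Suc n \<Longrightarrow> c * (q * g' i j) = g i (Suc j) q - d i * g i j q"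
  shows "\<exists>D. ((\<lambda>q. det (mat (Suc n) (Suc n) (\<lambda>(i, j). g i j q))) has_field_derivative D) (at q) \<and>
    c * (q * D) = det (mat (Suc n) (Suc n) (\<lambda>(i, j). if j = n then g i (Suc n) q else g i j q))
      - (\<Sum>i<Suc n. d i) * det (mat (Suc n) (Suc n) (\<lambda>(i, j). g i j q))"
proof -
  let ?N = "Suc n"
  let ?S = "{\<pi>. \<pi> permutes {0..<?N}}"
  have det: "det (mat ?N ?N (\<lambda>(i, j). B i j)) = (\<Sum>\<pi>\<in>?S. signof \<pi> * (\<Prod>j<?N. B (\<pi> j) j))" for B :: "nat \<Rightarrow> nat \<Rightarrow> complex"
    by (subst det_col[OF mat_carrier]) (auto intro!: sum.cong prod.cong simp: permutes_in_image)
  have perm: "\<pi> j < ?N" if "\<pi> \<in> ?S" "j < ?N" for \<pi> j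
    using permutes_in_image[of \<pi> "{0..<?N}" j] that by auto
  define D where "D = (\<Sum>\<pi>\<in>?S. signof \<pi> * (\<Sum>j<?N. g' (\<pi> j) j * (\<Prod>k\<in>{..<?N} - {j}. g (\<pi> k) k q)))"
  have "((\<lambda>q. \<Sum>\<pi>\<in>?S. signof \<pi> * (\<Prod>j<?N. g (\<pi> j) j q)) has_field_derivative D) (at q)"
    unfolding D_def
    by (intro DERIV_sum DERIV_cmult has_field_derivative_prod g') (use perm in auto)
  then have 1: "((\<lambda>q. det (mat ?N ?N (\<lambda>(i, j). g i j q))) has_field_derivative D) (at q)"
    unfolding det .
  have rem: "(\<Prod>k<?N. B k) = B j * (\<Prod>k\<in>{..<?N} - {j}. B k)" if "j < ?N" for j and B :: "nat \<Rightarrow> complex"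
    using that by (intro prod.remove) auto
  have "c * (q * D) = (\<Sum>\<pi>\<in>?S. signof \<pi> * (\<Sum>j<?N. (c * (q * g' (\<pi> j) j)) * (\<Prod>k\<in>{..<?N} - {j}. g (\<pi> k) k q)))"
    unfolding D_def sum_distrib_left by (intro sum.cong refl) (simp only: mult_ac)
  also have "\<dots> = (\<Sum>\<pi>\<in>?S. signof \<pi> * (\<Sum>j<?N. (\<Prod>k<?N. if k = j then g (\<pi> k) (Suc k) q else g (\<pi> k) k q))
      - (\<Sum>i<?N. d i) * (signof \<pi> * (\<Prod>k<?N. g (\<pi> k) k q)))"
  proof (intro sum.cong refl)
    fix \<pi> assume \<pi>: "\<pi> \<in> ?S"
    have "(\<Sum>j<?N. d (\<pi> j)) = (\<Sum>i<?N. d i)"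
      using sum.permute[of \<pi> "{0..<?N}" d] \<pi> by (simp add: atLeast0LessThan o_def)
    moreover have "(c * (q * g' (\<pi> j) j)) * (\<Prod>k\<in>{..<?N} - {j}. g (\<pi> k) k q)
       = (\<Prod>k<?N. if k = j then g (\<pi> k) (Suc k) q else g (\<pi> k) k q) - d (\<pi> j) * (\<Prod>k<?N. g (\<pi> k) k q)"
      if j: "j < ?N" for j
    proof -
      have "(\<Prod>k<?N. if k = j then g (\<pi> k) (Suc k) q else g (\<pi> k) k q)
          = g (\<pi> j) (Suc j) q * (\<Prod>k\<in>{..<?N} - {j}. g (\<pi> k) k q)"
        unfolding rem[OF j] by (intro arg_cong2[where f = "(*)"] prod.cong) auto
      moreover have "(\<Prod>k<?N. g (\<pi> k) k q) = g (\<pi> j) j q * (\<Prod>k\<in>{..<?N} - {j}. g (\<pi> k) k q)"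
        by (rule rem[OF j])
      ultimately show ?thesis unfolding rec[OF perm[OF \<pi> j] j] by (simp only: algebra_simps)
    qed
    ultimately show "signof \<pi> * (\<Sum>j<?N. (c * (q * g' (\<pi> j) j)) * (\<Prod>k\<in>{..<?N} - {j}. g (\<pi> k) k q))
      = signof \<pi> * (\<Sum>j<?N. (\<Prod>k<?N. if k = j then g (\<pi> k) (Suc k) q else g (\<pi> k) k q))
      - (\<Sum>i<?N. d i) * (signof \<pi> * (\<Prod>k<?N. g (\<pi> k) k q))"
      by (simp add: sum_subtractf sum_distrib_right[symmetric] right_diff_distrib mult_ac del: sum.lessThan_Suc prod.lessThan_Suc)
  qed
  also have "\<dots> = (\<Sum>j<?N. det (mat ?N ?N (\<lambda>(i, k). if k = j then g i (Suc k) q else g i k q)))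
      - (\<Sum>i<?N. d i) * det (mat ?N ?N (\<lambda>(i, j). g i j q))"
    unfolding det sum_subtractf sum_distrib_left by (subst sum.swap) (rule refl)
  also have "(\<Sum>j<?N. det (mat ?N ?N (\<lambda>(i, k). if k = j then g i (Suc k) q else g i k q)))
      = (\<Sum>j<?N. if j = n then det (mat ?N ?N (\<lambda>(i, k). if k = n then g i (Suc n) q else g i k q)) else 0)"
  proof (intro sum.cong refl)
    fix j assume j: "j \<in> {..<?N}"
    show "det (mat ?N ?N (\<lambda>(i, k). if k = j then g i (Suc k) q else g i k q))
      = (if j = n then det (mat ?N ?N (\<lambda>(i, k). if k = n then g i (Suc n) q else g i k q)) else 0)"
    proof (cases "j = n")
      case True
      have "(\<lambda>(i, k). if k = n then g i (Suc k) q else g i k q) = (\<lambda>(i, k). if k = n then g i (Suc n) q else g i k q)"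
        by (auto simp: fun_eq_iff)
      then show ?thesis using True by simp
    next
      case False
      have "det (mat ?N ?N (\<lambda>(i, k). if k = j then g i (Suc k) q else g i k q)) = 0"
        by (rule Determinant.det_identical_columns[of _ ?N j "Suc j"]) (use j False in auto)
      then show ?thesis using False by simp
    qed
  qed
  also have "\<dots> = det (mat ?N ?N (\<lambda>(i, k). if k = n then g i (Suc n) q else g i k q))"
    by (subst sum.delta) auto
  finally show ?thesis using 1 by blast
qed

section \<open>The third moment and the derivative of Jacobi's identity\<close>

lemma theta_seq_eq_power:
  "theta_seq p k = (if even k then 1 else -1) * (p\<^sup>2) ^ nat (k * (k + 1) div 2)"
proof -
  have "even (k * (k + 1))" by simp
  then have "nat (k * (k + 1)) = 2 * nat (k * (k + 1) div 2)"
    by (metis dvd_mult_div_cancel int_mult_Suc_nonneg nat_mult_distrib nat_numeral zero_le_numeral)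
  then show ?thesis
    using int_mult_Suc_nonneg[of k] by (simp add: theta_seq_def power_int_def power_mult)
qed

text \<open>The first moment of \<open>theta_seq\<close> written as a function of q = p^2 on the
  disc, so that it can be differentiated without choosing a root p.\<close>

definition jacobi_series :: "complex \<Rightarrow> complex" where
  "jacobi_series q = (\<Sum>\<^sub>\<infinity>k. (if even k then 1 else -1) * (of_int k + 1 / 2) * q ^ nat (k * (k + 1) div 2))"

lemma jacobi_series_abs_summable:
  assumes x: "0 < x" "x < (1 :: real)"
  shows "(\<lambda>k. norm ((if even k then 1 else -1) * (of_int k + 1 / 2) :: complex) * x ^ nat (k * (k + 1) div 2)) summable_on UNIV"
proof -
  define p where "p = complex_of_real (sqrt x)"
  have p: "norm p < 1" "p \<noteq> 0" "p\<^sup>2 = of_real x" using x by (auto simp: p_def simp flip: of_real_power)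
  have "(\<lambda>k. norm (theta_seq p k * (of_int k + 1 / 2) ^ 1)) summable_on UNIV"
    using moment_summable[OF rapidly_decreasing_theta_seq[OF p(1,2)], of "1 / 2" 1]
    by (simp add: summable_on_iff_abs_summable_on_complex)
  moreover have "norm (theta_seq p k * (of_int k + 1 / 2) ^ 1)
      = norm ((if even k then 1 else -1) * (of_int k + 1 / 2) :: complex) * x ^ nat (k * (k + 1) div 2)" for k
    using x by (simp add: theta_seq_eq_power p(3) norm_mult norm_power)
  ultimately show ?thesis by simp
qed

lemma theta_seq_first_moment:
  assumes "norm p < 1" "p \<noteq> 0"
  shows "fps_nth (moment_fps (1 / 2) (theta_seq p)) 1 = qpoch_inf (p\<^sup>2) (p\<^sup>2) ^ 3"
  using infsumI[OF jacobi_theta_moment[OF assms]] by (simp add: moment_fps_def)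

lemma jacobi_series_eq:
  assumes "norm q < 1" "q \<noteq> 0"
  shows "jacobi_series q = qpoch_inf q q ^ 3"
proof -
  define p where "p = csqrt q"
  have p: "p\<^sup>2 = q" by (simp add: p_def)
  then have "norm p ^ 2 < 1" using assms by (metis norm_power)
  then have np: "norm p < 1" by (simp add: power_less_one_iff abs_square_less_1)
  have pz: "p \<noteq> 0" using p assms by auto
  show ?thesis
    using infsumI[OF jacobi_theta_moment[OF np pz]]
    by (simp add: jacobi_series_def theta_seq_eq_power p mult_ac)
qed

lemma qpoch_inf_differentiable:
  assumes "norm q < 1"
  shows "((\<lambda>q. qpoch_inf q q) has_field_derivative deriv (\<lambda>q. qpoch_inf q q) q) (at q)"
  by (rule holomorphic_derivI[OF qpoch_inf_holomorphic open_ball]) (use assms in auto)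

text \<open>Since \<open>(k + 1/2)\<^sup>2 = k(k+1) + 1/4\<close>, the third moment is an Euler derivative of the first one.\<close>
lemma theta_seq_third_moment:
  assumes np: "norm p < 1" and pz: "p \<noteq> 0"
  defines "q \<equiv> p\<^sup>2"
  shows "fps_nth (moment_fps (1 / 2) (theta_seq p)) 3
    = q * qpoch_inf q q ^ 2 * deriv (\<lambda>q. qpoch_inf q q) q + qpoch_inf q q ^ 3 / 24"
proof -
  have q: "norm q < 1" "q \<noteq> 0" using norm_p2[OF np pz] pz by (auto simp: q_def)
  let ?Q = "\<lambda>q. qpoch_inf q q"
  have "deriv jacobi_series q = deriv (\<lambda>q. ?Q q ^ 3) q"
  proof (rule deriv_cong_ev)
    show "\<forall>\<^sub>F x in nhds q. jacobi_series x = ?Q x ^ 3"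
      by (rule eventually_nhds_in_open[of "ball 0 1 - {0}", THEN eventually_mono])
         (use q jacobi_series_eq in \<open>auto simp: open_delete\<close>)
  qed simp
  also have "\<dots> = 3 * ?Q q ^ 2 * deriv ?Q q"
    by (rule DERIV_imp_deriv) (auto intro!: derivative_eq_intros qpoch_inf_differentiable[OF q(1)])
  finally have 1: "q * (3 * ?Q q ^ 2 * deriv ?Q q) = q * deriv jacobi_series q" by simp
  also have "\<dots> = (\<Sum>\<^sub>\<infinity>k. of_nat (nat (k * (k + 1) div 2)) *
     ((if even k then 1 else -1) * (of_int k + 1 / 2) * q ^ nat (k * (k + 1) div 2)))"
    unfolding jacobi_series_def[abs_def]
    by (rule sparse_power_series_deriv(2)[OF jacobi_series_abs_summable q(1)])
  also have "\<dots> = (\<Sum>\<^sub>\<infinity>k. 1 / 2 * (theta_seq p k * (of_int k + 1 / 2) ^ 3) - 1 / 8 * (theta_seq p k * (of_int k + 1 / 2) ^ 1))"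
  proof (rule infsum_cong)
    fix k :: int
    have "int (nat (k * (k + 1) div 2)) * 2 = k * (k + 1)"
      using int_mult_Suc_nonneg[of k] by (simp add: pos_imp_zdiv_nonneg_iff)
    then have "of_int (int (nat (k * (k + 1) div 2)) * 2) = (of_int (k * (k + 1)) :: complex)" by (simp only:)
    then have e: "of_nat (nat (k * (k + 1) div 2)) = (of_int k * (of_int k + 1) / 2 :: complex)"
      by (simp only: of_int_mult of_int_of_nat_eq of_int_numeral of_int_add of_int_1) simp
    show "of_nat (nat (k * (k + 1) div 2)) * ((if even k then 1 else -1) * (of_int k + 1 / 2) * q ^ nat (k * (k + 1) div 2))
       = 1 / 2 * (theta_seq p k * (of_int k + 1 / 2) ^ 3) - 1 / 8 * (theta_seq p k * (of_int k + 1 / 2) ^ 1)"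
      unfolding e theta_seq_eq_power q_def[symmetric]
      by (simp add: power3_eq_cube field_simps)
  qed
  also have "\<dots> = 1 / 2 * (\<Sum>\<^sub>\<infinity>k. theta_seq p k * (of_int k + 1 / 2) ^ 3) - 1 / 8 * (\<Sum>\<^sub>\<infinity>k. theta_seq p k * (of_int k + 1 / 2) ^ 1)"
    by (intro infsumI has_sum_minus has_sum_cmult_right has_sum_infsum moment_summable rapidly_decreasing_theta_seq np pz)
  also have "\<dots> = 1 / 2 * (6 * fps_nth (moment_fps (1 / 2) (theta_seq p)) 3) - 1 / 8 * ?Q q ^ 3"
    using theta_seq_first_moment[OF np pz] by (simp add: moment_fps_def q_def fact_numeral)
  finally show ?thesis by (simp add: field_simps)
qed

section \<open>The determinant of the level theta series\<close>

definition theta_matrix :: "nat \<Rightarrow> complex \<Rightarrow> complex mat" where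
  "theta_matrix n q = mat (Suc n) (Suc n) (\<lambda>(i, j). level_theta n (Suc i) (2 * j + 1) q)"

text \<open>\<open>theta_matrix\<close> without its first row and last column. The remaining classes
  r = 2, ..., n + 1 are the residues prescribed for v in the final sum.\<close>

definition theta_minor :: "nat \<Rightarrow> complex \<Rightarrow> complex" where
  "theta_minor n q = det (mat n n (\<lambda>(i, j). level_theta n (i + 2) (2 * j + 1) q))"

text \<open>The determinant of the odd powers of 1, ..., n. It is the denominator of
  \<open>chi\<close> at \<open>rho_star\<close> and, for n + 1, the value at q = 0 of the
  determinant of \<open>theta_matrix n\<close>.\<close>

definition vandermonde_C :: "nat \<Rightarrow> complex" where
  "vandermonde_C n = (\<Prod>i<n. of_nat (Suc i)) * (\<Prod>j<n. \<Prod>i<j. (of_nat (Suc j))\<^sup>2 - (of_nat (Suc i))\<^sup>2)"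

lemma vandermonde_C_nonzero: "vandermonde_C n \<noteq> 0"
proof -
  have "(of_nat (Suc j))\<^sup>2 - (of_nat (Suc i))\<^sup>2 \<noteq> (0 :: complex)" if "i < j" for i j
  proof
    assume "(of_nat (Suc j))\<^sup>2 - (of_nat (Suc i))\<^sup>2 = (0 :: complex)"
    then have "(of_nat ((Suc j)\<^sup>2) :: complex) = of_nat ((Suc i)\<^sup>2)" by (simp only: of_nat_power right_minus_eq)
    then have "(Suc j)\<^sup>2 = (Suc i)\<^sup>2" by (simp only: of_nat_eq_iff)
    then show False using that by (simp add: power2_eq_iff_nonneg)
  qed
  then show ?thesis by (auto simp: vandermonde_C_def simp del: of_nat_Suc)
qed

lemma level_theta_0:
  assumes "r \<le> n + 1"
  shows "level_theta n r j 0 = of_nat r ^ j"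
proof -
  have "level_theta n r j 0 = (\<Sum>\<^sub>\<infinity>k\<in>{0}. of_int (int r + (2 * int n + 4) * k) ^ j * 0 ^ nat (k * (int r + (int n + 2) * k)))"
    unfolding level_theta_def
  proof (rule infsum_cong_neutral)
    fix k :: int assume "k \<in> UNIV - {0}"
    then have "0 < k\<^sup>2" by simp
    then have "0 < k * (int r + (int n + 2) * k)" using level_theta_exponent_ge[OF assms, of k] by linarith
    then have "nat (k * (int r + (int n + 2) * k)) \<noteq> 0" by simp
    then show "of_int (int r + (2 * int n + 4) * k) ^ j * 0 ^ nat (k * (int r + (int n + 2) * k)) = (0 :: complex)"
      by simp
  qed auto
  then show ?thesis by simp
qed

lemma sum_squares_Suc: "6 * (\<Sum>i<Suc n. (of_nat (Suc i))\<^sup>2) = (of_nat n + 1) * (of_nat n + 2) * (2 * of_nat n + 3 :: complex)"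
  by (induction n) (auto simp: power2_eq_square algebra_simps)

context
  fixes p :: complex and n :: nat
  assumes np: "norm p < 1" and pz: "p \<noteq> 0"
begin

private abbreviation "q \<equiv> p\<^sup>2"
private abbreviation "Q \<equiv> qpoch_inf (p\<^sup>2) (p\<^sup>2)"
private abbreviation "x i \<equiv> theta_product_seq p (2 * n) (int (Suc i) - int n)"

private lemma linear_relation:
  "(\<Sum>i<Suc n. x i * level_theta n (Suc i) (2 * j + 1) q)
    = fact (2 * j + 1) * fps_nth (moment_fps 0 (odd_theta_seq p) * moment_fps (1 / 2) (theta_seq p) ^ (2 * n)) (2 * j + 1) / 2"
proof -
  have "(\<Sum>i<Suc n. x i * level_theta n (Suc i) (2 * j + 1) q)
     = (\<Sum>r=1..n + 1. theta_product_seq p (2 * n) (int r - int n) * level_theta n r (2 * j + 1) q)"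
    by (rule sum.reindex_bij_witness[of _ "\<lambda>r. r - 1" Suc]) auto
  then show ?thesis
    using theta_product_linear_relation[OF np pz, of "2 * j + 1" n] moment_fps_theta_product_seq[OF np pz, of "2 * n"]
    by simp
qed

text \<open>The columns are the moments of orders 1, 3, ..., 2n + 1, and the zero of order 2n + 1
  kills all but the last. The halving in \<open>linear_relation\<close> cancels the 2 of the leading
  coefficient, and each of the 2n + 1 factors gives (q)_\<infinity>^3.\<close>

private lemma relation_matrix:
  assumes "j < Suc n"
  shows "(\<Sum>i<Suc n. x i * theta_matrix n q $$ (i, j)) = (if j = n then fact (2 * n + 1) * Q ^ (3 * (2 * n + 1)) else 0)"
proof -
  have "(\<Sum>i<Suc n. x i * theta_matrix n q $$ (i, j)) = (\<Sum>i<Suc n. x i * level_theta n (Suc i) (2 * j + 1) q)"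
    using assms by (intro sum.cong) (auto simp: theta_matrix_def)
  also have "\<dots> = (if j = n then fact (2 * n + 1) * Q ^ (3 * (2 * n + 1)) else 0)"
    unfolding linear_relation
    using assms theta_product_fps(1)[OF np pz, of "2 * j + 1" n] theta_product_fps(2)[OF np pz, of n]
    unfolding theta_seq_first_moment[OF np pz] power_mult[symmetric]
    by auto
  finally show ?thesis .
qed

text \<open>The first moment beyond the matrix, of order 2n + 3: the heat equation produces it from
  the last column.\<close>

private lemma relation_next:
  "(\<Sum>i<Suc n. x i * level_theta n (Suc i) (2 * Suc n + 1) q)
     = fact (2 * n + 3) * ((2 * of_nat n + 4) * (q * Q ^ 2 * deriv (\<lambda>q. qpoch_inf q q) q + Q ^ 3 / 24) * Q ^ (3 * (2 * n)))"
proof -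
  have e: "2 * Suc n + 1 = 2 * n + 3" by simp
  have half: "fact (2 * n + 3) * ((4 * of_nat n + 8) * T * Z) / 2 = fact (2 * n + 3) * ((2 * of_nat n + 4) * T * Z)"
    for T Z :: complex
  proof -
    have "4 * of_nat n + 8 = 2 * (2 * of_nat n + 4 :: complex)" by simp
    then show ?thesis by (simp only: mult.assoc) simp
  qed
  show ?thesis
    using linear_relation[of "Suc n"]
    unfolding e theta_product_fps(3)[OF np pz] theta_seq_first_moment[OF np pz]
      theta_seq_third_moment[OF np pz] power_mult[symmetric] half .
qed

text \<open>The term 1/24 of the third moment contributes (2n+2)(2n+3)(2n+4)/24, which is the sum of
  the squares 1, ..., (n+1)^2 subtracted by the heat equations. What is left is (2n+3)(n+1) times
  the logarithmic derivative of (q)_\<infinity>.\<close>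

lemma theta_det_deriv:
  "((\<lambda>q. det (theta_matrix n q)) has_field_derivative
     (2 * of_nat n + 3) * (of_nat n + 1) * deriv (\<lambda>q. qpoch_inf q q) (p\<^sup>2) / qpoch_inf (p\<^sup>2) (p\<^sup>2)
       * det (theta_matrix n (p\<^sup>2))) (at (p\<^sup>2))"
proof -
  have q: "norm q < 1" "q \<noteq> 0" using norm_p2[OF np pz] pz by auto
  have Q: "Q \<noteq> 0" using q by simp
  let ?Q' = "deriv (\<lambda>q. qpoch_inf q q) q"
  let ?W = "det (theta_matrix n q)"
  let ?g = "\<lambda>i j. level_theta n (Suc i) (2 * j + 1)"
  have tm: "theta_matrix n z = mat (Suc n) (Suc n) (\<lambda>(i, j). ?g i j z)" for z
    by (simp add: theta_matrix_def)
  have "\<exists>D. ((\<lambda>q. det (mat (Suc n) (Suc n) (\<lambda>(i, j). ?g i j q))) has_field_derivative D) (at q) \<and>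
    4 * (of_nat n + 2) * (q * D) = det (mat (Suc n) (Suc n) (\<lambda>(i, j). if j = n then ?g i (Suc n) q else ?g i j q))
      - (\<Sum>i<Suc n. (of_nat (Suc i))\<^sup>2) * det (mat (Suc n) (Suc n) (\<lambda>(i, j). ?g i j q))"
  proof (rule det_euler_derivative)
    fix i j assume i: "i < Suc n"
    show "(?g i j has_field_derivative deriv (?g i j) q) (at q)"
      by (rule holomorphic_derivI[OF level_theta_holomorphic open_ball]) (use i q in auto)
    show "4 * (of_nat n + 2) * (q * deriv (?g i j) q) = ?g i (Suc j) q - (of_nat (Suc i))\<^sup>2 * ?g i j q"
      using level_theta_deriv[of "Suc i" n q "2 * j + 1"] i q by simp
  qed
  then obtain D where D: "((\<lambda>q. det (theta_matrix n q)) has_field_derivative D) (at q)"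
    and eq: "4 * (of_nat n + 2) * (q * D) = det (mat (Suc n) (Suc n) (\<lambda>(i, j). if j = n then ?g i (Suc n) q else ?g i j q))
      - (\<Sum>i<Suc n. (of_nat (Suc i))\<^sup>2) * ?W"
    unfolding tm by blast
  define R where "R = det (mat (Suc n) (Suc n) (\<lambda>(i, j). if j = n then ?g i (Suc n) q else ?g i j q))"
  have "(\<lambda>(i, j). if j = n then ?g i (Suc n) q else ?g i j q)
      = (\<lambda>(i, j). if j = n then ?g i (Suc n) q else ?g i j q)" ..
  have "R = det (mat (Suc n) (Suc n) (\<lambda>(i, j). if j = n then ?g i (Suc n) q else theta_matrix n q $$ (i, j)))"
    unfolding R_def by (rule arg_cong[where f = det], rule eq_matI) (auto simp: theta_matrix_def)
  then have "fact (2 * n + 1) * Q ^ (3 * (2 * n + 1)) * R = ?W * (\<Sum>i<Suc n. x i * ?g i (Suc n) q)"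
    using cramer_last_replace[of "theta_matrix n q" n x, OF _ relation_matrix] by (simp add: theta_matrix_def)
  also have "\<dots> = ?W * (fact (2 * n + 3) * ((2 * of_nat n + 4) * (q * Q ^ 2 * ?Q' + Q ^ 3 / 24) * Q ^ (3 * (2 * n))))"
    unfolding relation_next ..
  also have "fact (2 * n + 3) = (fact (2 * n + 1) * ((2 * of_nat n + 2) * (2 * of_nat n + 3)) :: complex)"
  proof -
    have "2 * n + 3 = Suc (Suc (2 * n + 1))" by simp
    then have "fact (2 * n + 3) = (of_nat (Suc (Suc (2 * n + 1))) * (of_nat (Suc (2 * n + 1)) * fact (2 * n + 1)) :: complex)"
      by (simp only: fact_Suc)
    moreover have "of_nat (Suc (Suc (2 * n + 1))) = (2 * of_nat n + 3 :: complex)"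
      "of_nat (Suc (2 * n + 1)) = (2 * of_nat n + 2 :: complex)" by simp_all
    ultimately show ?thesis by (simp only: mult_ac)
  qed
  also have "?W * (fact (2 * n + 1) * ((2 * of_nat n + 2) * (2 * of_nat n + 3)) * ((2 * of_nat n + 4) * (q * Q ^ 2 * ?Q' + Q ^ 3 / 24) * Q ^ (3 * (2 * n))))
     = fact (2 * n + 1) * Q ^ (3 * (2 * n + 1)) *
        (?W * ((2 * of_nat n + 2) * (2 * of_nat n + 3) * (2 * of_nat n + 4)) * (q * ?Q' / Q + 1 / 24))"
  proof -
    have "(q * Q ^ 2 * ?Q' + Q ^ 3 / 24) * Q ^ (3 * (2 * n)) = Q ^ (3 * (2 * n + 1)) * (q * ?Q' / Q + 1 / 24)"
    proof -
      have "3 * (2 * n + 1) = 3 * (2 * n) + 3" by simp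
      then have "Q ^ (3 * (2 * n + 1)) = Q ^ (3 * (2 * n)) * Q ^ 3" by (simp only: power_add)
      moreover have "q * Q ^ 2 * ?Q' + Q ^ 3 / 24 = Q ^ 3 * (q * ?Q' / Q + 1 / 24)"
        using Q by (simp add: power2_eq_square power3_eq_cube distrib_left)
      ultimately show ?thesis by (simp only: mult_ac)
    qed
    then show ?thesis by (simp only: mult_ac)
  qed
  finally have "fact (2 * n + 1) * Q ^ (3 * (2 * n + 1)) * R = fact (2 * n + 1) * Q ^ (3 * (2 * n + 1)) *
        (?W * ((2 * of_nat n + 2) * (2 * of_nat n + 3) * (2 * of_nat n + 4)) * (q * ?Q' / Q + 1 / 24))" .
  moreover have "fact (2 * n + 1) * Q ^ (3 * (2 * n + 1)) \<noteq> 0" 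
    by (intro no_zero_divisors power_not_zero fact_nonzero Q)
  ultimately have R: "R = ?W * ((2 * of_nat n + 2) * (2 * of_nat n + 3) * (2 * of_nat n + 4)) * (q * ?Q' / Q + 1 / 24)"
    using mult_left_cancel by blast
  have "6 * (4 * (of_nat n + 2) * (q * D)) = 6 * R - (6 * (\<Sum>i<Suc n. (of_nat (Suc i))\<^sup>2)) * ?W"
    unfolding eq R_def[symmetric] by (simp only: right_diff_distrib mult.assoc)
  also have "\<dots> = 6 * R - ((of_nat n + 1) * (of_nat n + 2) * (2 * of_nat n + 3)) * ?W"
    unfolding sum_squares_Suc ..
  also have "\<dots> = 6 * (4 * (of_nat n + 2) * (q * ((2 * of_nat n + 3) * (of_nat n + 1) * ?Q' / Q * ?W)))"
  proof -
    have "6 * (w * ((2 * m + 2) * (2 * m + 3) * (2 * m + 4)) * (y + 1 / 24)) - (m + 1) * (m + 2) * (2 * m + 3) * w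
        = 24 * ((m + 1) * (m + 2) * (2 * m + 3)) * w * y" for w m y :: complex
      by (simp add: algebra_simps)
    moreover have "6 * (4 * (m + 2) * (z * ((2 * m + 3) * (m + 1) * d / u * w)))
        = 24 * ((m + 1) * (m + 2) * (2 * m + 3)) * w * (z * d / u)" for w m z d u :: complex
      by simp
    ultimately show ?thesis unfolding R by (simp only:)
  qed
  finally have "6 * (4 * (of_nat n + 2) * q) * D = 6 * (4 * (of_nat n + 2) * q) * ((2 * of_nat n + 3) * (of_nat n + 1) * ?Q' / Q * ?W)"
    by (simp only: mult.assoc)
  moreover have "6 * (4 * (of_nat n + 2) * q) \<noteq> (0 :: complex)"
  proof -
    have "(of_nat n + 2 :: complex) = of_nat (n + 2)" by simp
    then have "(of_nat n + 2 :: complex) \<noteq> 0" by (metis of_nat_eq_0_iff add_is_0 zero_neq_numeral)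
    then show ?thesis using q(2) by (simp only: mult_eq_0_iff de_Morgan_disj) simp
  qed
  ultimately have "D = (2 * of_nat n + 3) * (of_nat n + 1) * ?Q' / Q * ?W"
    using mult_left_cancel by blast
  then show ?thesis using D by simp
qed

text \<open>The unknown of class r = 1 is, up to a power of p and a sign, the coefficient at -(n+1),
  which oddness moves to n + 1. The sign of the cofactor cancels the one from (-p)^(1-n).\<close>

lemma theta_product_value:
  "det (theta_matrix n (p\<^sup>2)) * (theta_op p ^^ (2 * n)) (odd_theta_seq p) (int n + 1)
    = p ^ n * (fact (2 * n + 1) * qpoch_inf (p\<^sup>2) (p\<^sup>2) ^ (3 * (2 * n + 1)) * theta_minor n (p\<^sup>2))"
proof -
  have "cofactor (theta_matrix n q) 0 n = (-1) ^ n * theta_minor n q"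
  proof -
    have "mat_delete (theta_matrix n q) 0 n = mat n n (\<lambda>(i, j). level_theta n (i + 2) (2 * j + 1) q)"
      by (rule eq_matI) (auto simp: mat_delete_def theta_matrix_def)
    then show ?thesis by (simp add: cofactor_def theta_minor_def)
  qed
  then have 1: "fact (2 * n + 1) * Q ^ (3 * (2 * n + 1)) * ((-1) ^ n * theta_minor n q) = det (theta_matrix n q) * x 0"
    using cramer_last[of "theta_matrix n q" n x, OF _ relation_matrix, of 0] by (simp add: theta_matrix_def)
  have "x 0 = (- p) powi (1 - int n) / p * (theta_op p ^^ (2 * n)) (odd_theta_seq p) (1 - int n - 2)"
    using theta_product_seq_eq_funpow[OF pz, of "2 * n" "1 - int n"] by simp
  also have "1 - int n - 2 = - (int n + 1)" by simp
  also have "(theta_op p ^^ (2 * n)) (odd_theta_seq p) (- (int n + 1)) = - (theta_op p ^^ (2 * n)) (odd_theta_seq p) (int n + 1)"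
    by (rule funpow_theta_op_minus) (rule odd_theta_seq_minus)
  finally have "x 0 = - ((- p) powi (1 - int n) / p) * (theta_op p ^^ (2 * n)) (odd_theta_seq p) (int n + 1)" by simp
  moreover have "- ((- p) powi (1 - int n) / p) = (-1) ^ n / p ^ n"
  proof -
    have "(- p) powi (1 - int n) = - p / ((- p) ^ n)"
      using pz by (simp add: power_int_diff)
    moreover have "(- p) ^ n = (-1) ^ n * p ^ n" by (rule power_minus)
    ultimately show ?thesis using pz by (cases "even n") simp_all
  qed
  ultimately have "x 0 = (-1) ^ n / p ^ n * (theta_op p ^^ (2 * n)) (odd_theta_seq p) (int n + 1)" by (simp only:)
  moreover have "p ^ n * ((-1) ^ n * ((-1) ^ n / p ^ n * e)) = e" for e
    using pz by (cases "even n") simp_all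
  ultimately have 2: "p ^ n * ((-1) ^ n * x 0) = (theta_op p ^^ (2 * n)) (odd_theta_seq p) (int n + 1)"
    by (simp only:)
  have "det (theta_matrix n q) * (p ^ n * ((-1) ^ n * x 0)) = p ^ n * ((-1) ^ n * (det (theta_matrix n q) * x 0))"
    by (simp only: mult_ac)
  also have "\<dots> = p ^ n * ((-1) ^ n * (-1) ^ n * (fact (2 * n + 1) * Q ^ (3 * (2 * n + 1)) * theta_minor n q))"
    unfolding 1[symmetric] by (simp only: mult_ac)
  also have "(-1) ^ n * (-1) ^ n = (1 :: complex)" by (cases "even n") simp_all
  finally show ?thesis unfolding 2 by simp
qed

end

text \<open>This is Macdonald's identity for the affine root system of type \<open>C\<^sub>n\<^sub>+\<^sub>1\<close>, specialized to the \<open>\<eta>\<close>-function.\<close>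
theorem det_theta_matrix:
  assumes "norm q < 1"
  shows "det (theta_matrix n q) = vandermonde_C (Suc n) * qpoch_inf q q ^ ((2 * n + 3) * (n + 1))"
proof -
  let ?W = "\<lambda>q. det (theta_matrix n q)" and ?Q = "\<lambda>q. qpoch_inf q q"
  let ?E = "(2 * n + 3) * (n + 1)"
  let ?H = "\<lambda>q. ?W q / ?Q q ^ ?E"
  have Qnz: "?Q q \<noteq> 0" if "q \<in> ball 0 1" for q using that by simp
  have "continuous_on (ball 0 1) ?W"
  proof -
    have "?W q = (\<Sum>\<pi> | \<pi> permutes {0..<Suc n}. signof \<pi> * (\<Prod>i=0..<Suc n. level_theta n (Suc i) (2 * \<pi> i + 1) q))" for q
      by (subst det_def'[of _ "Suc n"]) (auto simp: theta_matrix_def permutes_in_image intro!: sum.cong prod.cong)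
    moreover have "continuous_on (ball 0 1) (level_theta n (Suc i) j)" if "i \<in> {0..<Suc n}" for i j
      using that by (intro holomorphic_on_imp_continuous_on level_theta_holomorphic) auto
    then have "continuous_on (ball 0 1) (\<lambda>q. \<Sum>\<pi> | \<pi> permutes {0..<Suc n}. signof \<pi> * (\<Prod>i=0..<Suc n. level_theta n (Suc i) (2 * \<pi> i + 1) q))"
      by (intro continuous_on_sum continuous_on_mult continuous_on_const continuous_on_prod) auto
    ultimately show ?thesis by (simp only:)
  qed
  then have cont: "continuous_on (ball 0 1) ?H"
    using Qnz holomorphic_on_imp_continuous_on[OF qpoch_inf_holomorphic] by (intro continuous_intros) auto
  have der: "(?H has_field_derivative 0) (at q)" if "q \<in> ball 0 1 - {0}" for q
  proof -
    define p where "p = csqrt q"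
    have p: "p\<^sup>2 = q" by (simp add: p_def)
    then have "norm p ^ 2 < 1" using that by (metis DiffD1 mem_ball_0 norm_power)
    then have np: "norm p < 1" by (simp add: power_less_one_iff abs_square_less_1)
    have pz: "p \<noteq> 0" using p that by auto
    have W: "(?W has_field_derivative (2 * of_nat n + 3) * (of_nat n + 1) * deriv ?Q q / ?Q q * ?W q) (at q)"
      using theta_det_deriv[OF np pz, of n] unfolding p .
    have Q: "?Q q \<noteq> 0" using that by simp
    have QE: "((\<lambda>q. ?Q q ^ ?E) has_field_derivative of_nat ?E * (deriv ?Q q * ?Q q ^ (?E - 1))) (at q)"
      using DERIV_power[OF qpoch_inf_differentiable[of q], of ?E] that by (simp add: mult_ac)
    have E1: "?Q q * ?Q q ^ (?E - 1) = ?Q q ^ ?E" 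
      by (rule trans[OF mult.commute power_minus_mult]) simp
    have "(?H has_field_derivative
       ((2 * of_nat n + 3) * (of_nat n + 1) * deriv ?Q q / ?Q q * ?W q * ?Q q ^ ?E
         - ?W q * (of_nat ?E * (deriv ?Q q * ?Q q ^ (?E - 1)))) / (?Q q ^ ?E * ?Q q ^ ?E)) (at q)"
      by (rule DERIV_divide[OF W QE]) (use Q in simp)
    moreover have "(2 * of_nat n + 3) * (of_nat n + 1) * deriv ?Q q / ?Q q * ?W q * ?Q q ^ ?E
         - ?W q * (of_nat ?E * (deriv ?Q q * ?Q q ^ (?E - 1))) = 0"
    proof -
      have "c * d / z * w * (z * y) - w * (c * (d * y)) = 0" if "z \<noteq> 0" for c d w y z :: complex
        using that by simp
      moreover have "of_nat ?E = (2 * of_nat n + 3) * (of_nat n + 1 :: complex)"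
        by (simp only: of_nat_mult of_nat_add of_nat_numeral of_nat_1)
      ultimately show ?thesis using Q by (simp only: E1[symmetric])
    qed
    ultimately show ?thesis by simp
  qed
  \<comment> \<open>The derivative is available only away from 0; continuity covers this exceptional
    point, where the constant is then read off.\<close>
  obtain c where c: "\<And>q. q \<in> ball 0 1 \<Longrightarrow> ?H q = c"
    using DERIV_zero_connected_constant[of "ball 0 1" "{0}" ?H] cont der by (auto simp: connected_ball)
  have "?Q 0 = 1" by (simp add: qpoch_inf_def)
  then have "c = ?W 0" using c[of 0] by simp
  also have "theta_matrix n 0 = mat (Suc n) (Suc n) (\<lambda>(i, j). (of_nat (Suc i)) ^ (2 * j + 1))"
    by (rule eq_matI) (auto simp: theta_matrix_def level_theta_0)
  also have "det \<dots> = vandermonde_C (Suc n)"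
    unfolding det_odd_vandermonde vandermonde_C_def ..
  finally show ?thesis using c[of q] assms by (auto simp: field_simps)
qed

section \<open>The sum over m for nonzero q\<close>

lemma prod_shifted_fact: "(\<Prod>i<k. of_nat (m + 1 + i)) * fact m = (fact (m + k) :: complex)"
proof (induction k)
  case (Suc k)
  have "(\<Prod>i<Suc k. of_nat (m + 1 + i)) * fact m = of_nat (m + 1 + k) * ((\<Prod>i<k. of_nat (m + 1 + i)) * fact m :: complex)"
    by (simp only: prod.lessThan_Suc mult_ac)
  also have "\<dots> = of_nat (Suc (m + k)) * fact (m + k)"
    unfolding Suc.IH by simp
  also have "\<dots> = fact (m + Suc k)" unfolding add_Suc_right fact_Suc ..
  finally show ?case .
qed simp

text \<open>The new factors are n + 1 and the (n+1)^2 - i^2 = (n+1-i)(n+1+i) for 1 <= i <= n, with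
  product (2n+1)!. This cancels the factorial of the moment of order 2n + 1.\<close>

lemma vandermonde_C_Suc: "vandermonde_C (Suc n) = vandermonde_C n * fact (2 * n + 1)"
proof -
  have "(of_nat (Suc n))\<^sup>2 - (of_nat (Suc i))\<^sup>2 = of_nat (n - i) * (of_nat (n + 1 + 1 + i) :: complex)" if "i < n" for i
    using that by (simp add: of_nat_diff power2_eq_square algebra_simps)
  then have "(\<Prod>i<n. (of_nat (Suc n))\<^sup>2 - (of_nat (Suc i))\<^sup>2) = (\<Prod>i<n. of_nat (n - i) * (of_nat (n + 1 + 1 + i) :: complex))"
    by (intro prod.cong) auto
  also have "\<dots> = (\<Prod>i<n. of_nat (n - i)) * (\<Prod>i<n. of_nat (n + 1 + 1 + i))"
    by (rule prod.distrib)
  also have "(\<Prod>i<n. of_nat (n - i)) = (fact n :: complex)"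
    unfolding fact_prod_rev of_nat_prod by (simp add: atLeast0LessThan)
  finally have P: "(\<Prod>i<n. (of_nat (Suc n))\<^sup>2 - (of_nat (Suc i))\<^sup>2) = fact n * (\<Prod>i<n. of_nat (n + 1 + 1 + i) :: complex)" .
  have "of_nat (Suc n) * (fact n * (\<Prod>i<n. of_nat (n + 1 + 1 + i) :: complex)) = (\<Prod>i<n. of_nat (n + 1 + 1 + i)) * fact (n + 1)"
    by (simp add: algebra_simps)
  also have "\<dots> = fact (n + 1 + n)" by (rule prod_shifted_fact)
  also have "n + 1 + n = 2 * n + 1" by simp
  finally have F: "of_nat (Suc n) * (fact n * (\<Prod>i<n. of_nat (n + 1 + 1 + i) :: complex)) = fact (2 * n + 1)" .
  show ?thesis
    unfolding vandermonde_C_def prod.lessThan_Suc P F[symmetric] by (simp only: mult_ac)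
qed

lemma csqrt_unit_disc:
  assumes "norm q < 1" "q \<noteq> 0"
  shows "norm (csqrt q) < 1" "csqrt q \<noteq> 0"
proof -
  have "norm (csqrt q) ^ 2 < 1" using assms(1) by (metis norm_power power2_csqrt)
  then show "norm (csqrt q) < 1" by (simp add: power_less_one_iff abs_square_less_1)
qed (use assms in simp)

lemma fermionic_sum_eq_minor:
  assumes "norm q < 1" "q \<noteq> 0"
  shows "((\<lambda>m. q powi lhs_exponent (2 * n) m / qpoch_vec (2 * n) q m) has_sum
     theta_minor n q / (vandermonde_C n * qpoch_inf q q ^ (2 * n\<^sup>2 + n))) (nat_vecs (2 * n))"
proof -
  define p where "p = csqrt q"
  have np: "norm p < 1" and pz: "p \<noteq> 0" and p: "p\<^sup>2 = q"
    using csqrt_unit_disc[OF assms] by (auto simp: p_def)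
  let ?Q = "qpoch_inf q q"
  let ?e = "(theta_op p ^^ (2 * n)) (odd_theta_seq p) (int n + 1)"
  have Q: "?Q \<noteq> 0" using assms by simp
  define E where "E = 2 * n\<^sup>2 + n"
  \<comment> \<open>The determinant contributes (2n+3)(n+1) and the kernel 2n factors
    (q)_\<infinity> to the denominator; Jacobi's identity puts 3(2n+1) into the numerator.\<close>
  have ex: "(2 * n + 3) * (n + 1) + 2 * n = 3 * (2 * n + 1) + E"
    by (simp add: E_def power2_eq_square algebra_simps)
  have "vandermonde_C n * fact (2 * n + 1) * ?Q ^ ((2 * n + 3) * (n + 1)) * ?e
      = p ^ n * (fact (2 * n + 1) * ?Q ^ (3 * (2 * n + 1)) * theta_minor n q)"
    using theta_product_value[OF np pz, of n]
    unfolding p det_theta_matrix[OF assms(1)] vandermonde_C_Suc .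
  then have "fact (2 * n + 1) * (vandermonde_C n * ?Q ^ ((2 * n + 3) * (n + 1)) * ?e)
      = fact (2 * n + 1) * (p ^ n * ?Q ^ (3 * (2 * n + 1)) * theta_minor n q)"
    by (simp only: mult_ac)
  then have 1: "vandermonde_C n * ?Q ^ ((2 * n + 3) * (n + 1)) * ?e = p ^ n * ?Q ^ (3 * (2 * n + 1)) * theta_minor n q"
    using mult_left_cancel[OF fact_nonzero] by blast
  have "?Q ^ (3 * (2 * n + 1)) * (vandermonde_C n * ?Q ^ E * ?e)
      = (vandermonde_C n * ?Q ^ ((2 * n + 3) * (n + 1)) * ?e) * ?Q ^ (2 * n)"
  proof -
    have "?Q ^ (3 * (2 * n + 1)) * ?Q ^ E = ?Q ^ ((2 * n + 3) * (n + 1)) * ?Q ^ (2 * n)"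
      by (simp only: power_add[symmetric] ex)
    moreover have "a * (v * b * e) = (a * b) * (v * e)" "(v * b * e) * a = (b * a) * (v * e)" for a b v e :: complex
      by (simp_all only: mult_ac)
    ultimately show ?thesis by (simp only:)
  qed
  also have "\<dots> = ?Q ^ (3 * (2 * n + 1)) * (p ^ n * ?Q ^ (2 * n) * theta_minor n q)"
    unfolding 1 by (simp only: mult_ac)
  finally have "vandermonde_C n * ?Q ^ E * ?e = p ^ n * ?Q ^ (2 * n) * theta_minor n q"
    using mult_left_cancel[OF power_not_zero[OF Q]] by blast
  then have "?e / (p ^ n * ?Q ^ (2 * n)) = theta_minor n q / (vandermonde_C n * ?Q ^ E)"
    using Q pz vandermonde_C_nonzero[of n] by (simp add: frac_eq_eq mult_ac)
  then show ?thesis using fermionic_sum[OF np pz, of n] unfolding p E_def by simp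
qed

section \<open>The sum over \<open>v\<close>\<close>

text \<open>Numerator and denominator are both odd Vandermonde determinants. Their factors have the
  opposite sign to those in \<open>chi\<close>, which cancels in each quotient.\<close>

lemma chi_rho_star:
  "chi n v rho_star = det (mat n n (\<lambda>(i, j). of_int (v (Suc i)) ^ (2 * j + 1))) / vandermonde_C n"
proof -
  have 1: "(\<Prod>i=1..n. of_int (v i) / of_int (rho_star i)) = (\<Prod>i<n. of_int (v (Suc i))) / (\<Prod>i<n. of_nat (Suc i) :: complex)"
    unfolding prod_dividef
    by (intro arg_cong2[where f = "(/)"]; rule prod.reindex_bij_witness[of _ Suc "\<lambda>i. i - 1"]) (auto simp: rho_star_def)
  have "(\<Prod>(i, j) | 1 \<le> i \<and> i < j \<and> j \<le> n. of_int ((v i)\<^sup>2 - (v j)\<^sup>2) / of_int ((rho_star i)\<^sup>2 - (rho_star j)\<^sup>2))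
     = (\<Prod>(j, i)\<in>(SIGMA j:{..<n}. {..<j}). ((of_int (v (Suc j)))\<^sup>2 - (of_int (v (Suc i)))\<^sup>2) /
          ((of_nat (Suc j))\<^sup>2 - (of_nat (Suc i))\<^sup>2 :: complex))"
  proof (rule prod.reindex_bij_witness[of _ "\<lambda>(j, i). (Suc i, Suc j)" "\<lambda>(i, j). (j - 1, i - 1)"])
    fix x assume "x \<in> {(i, j). 1 \<le> i \<and> i < j \<and> j \<le> n}"
    then obtain a b where "x = (a, b)" "a \<noteq> 0" "b \<noteq> 0" by auto
    then obtain i j where x: "x = (Suc i, Suc j)" by (metis not0_implies_Suc)
    have "(a - b) / (c - d) = (b - a) / (d - c)" for a b c d :: complex
      by (metis minus_diff_eq minus_divide_divide)
    then show "(case (case x of (i, j) \<Rightarrow> (j - 1, i - 1)) of (j, i) \<Rightarrow> ((of_int (v (Suc j)))\<^sup>2 - (of_int (v (Suc i)))\<^sup>2) /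
          ((of_nat (Suc j))\<^sup>2 - (of_nat (Suc i))\<^sup>2 :: complex))
       = (case x of (i, j) \<Rightarrow> of_int ((v i)\<^sup>2 - (v j)\<^sup>2) / of_int ((rho_star i)\<^sup>2 - (rho_star j)\<^sup>2))"
      by (simp add: x rho_star_def del: of_nat_Suc)
  qed auto
  also have "\<dots> = (\<Prod>j<n. \<Prod>i<j. ((of_int (v (Suc j)))\<^sup>2 - (of_int (v (Suc i)))\<^sup>2) / ((of_nat (Suc j))\<^sup>2 - (of_nat (Suc i))\<^sup>2 :: complex))"
    by (subst prod.Sigma) auto
  also have "\<dots> = (\<Prod>j<n. \<Prod>i<j. (of_int (v (Suc j)))\<^sup>2 - (of_int (v (Suc i)))\<^sup>2) / (\<Prod>j<n. \<Prod>i<j. (of_nat (Suc j))\<^sup>2 - (of_nat (Suc i))\<^sup>2)"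
    by (simp only: prod_dividef)
  finally show ?thesis
    unfolding chi_def 1 det_odd_vandermonde vandermonde_C_def by simp
qed

definition residue_class :: "nat \<Rightarrow> nat \<Rightarrow> int set" where
  "residue_class n t = {v. [v = rho_star t + 1] (mod (2 * int n + 4))}"

definition class_exponent :: "nat \<Rightarrow> nat \<Rightarrow> int \<Rightarrow> int" where
  "class_exponent n t v = (v\<^sup>2 - (int t + 1)\<^sup>2) div (4 * (int n + 2))"

text \<open>The congruences bind each coordinate separately, so sums of products over these vectors
  factor.\<close>

lemma congruent_vecs_eq_PiE: "congruent_vecs n = PiE {1..n} (residue_class n)"
  by (auto simp: congruent_vecs_def residue_class_def PiE_iff extensional_def)

lemma bij_betw_residue_class: "bij_betw (\<lambda>k. int (Suc t) + (2 * int n + 4) * k) UNIV (residue_class n t)"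
proof (rule bij_betwI')
  fix v assume "v \<in> residue_class n t"
  then obtain k where "v - (int t + 1) = (2 * int n + 4) * k"
    by (auto simp: residue_class_def rho_star_def cong_iff_dvd_diff)
  then show "\<exists>k\<in>UNIV. v = int (Suc t) + (2 * int n + 4) * k" by (intro bexI[of _ k]) auto
qed (auto simp: residue_class_def rho_star_def cong_iff_dvd_diff)

lemma class_exponent_eq:
  "class_exponent n t (int (Suc t) + (2 * int n + 4) * k) = k * (int (Suc t) + (int n + 2) * k)"
proof -
  have "(int (Suc t) + (2 * int n + 4) * k)\<^sup>2 - (int t + 1)\<^sup>2 = 4 * (int n + 2) * (k * (int (Suc t) + (int n + 2) * k))"
    by (simp add: power2_eq_square algebra_simps)
  then show ?thesis unfolding class_exponent_def by simp
qed

lemma residue_class_level_theta: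
  assumes "t \<le> n" "norm q < 1"
  shows "((\<lambda>v. of_int v ^ j * q ^ nat (class_exponent n t v)) has_sum level_theta n (Suc t) j q) (residue_class n t)"
proof -
  have "((\<lambda>k. of_int (int (Suc t) + (2 * int n + 4) * k) ^ j * q ^ nat (k * (int (Suc t) + (int n + 2) * k)))
      has_sum level_theta n (Suc t) j q) UNIV"
    unfolding level_theta_def using assms by (intro has_sum_infsum level_theta_summable) auto
  then have "((\<lambda>k. (\<lambda>v. of_int v ^ j * q ^ nat (class_exponent n t v)) (int (Suc t) + (2 * int n + 4) * k))
      has_sum level_theta n (Suc t) j q) UNIV"
    by (simp only: class_exponent_eq)
  then show ?thesis by (subst (asm) has_sum_reindex_bij_betw[OF bij_betw_residue_class])
qed

lemma class_exponent_nonneg: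
  assumes "t \<le> n" "v \<in> residue_class n t"
  shows "0 \<le> class_exponent n t v"
proof -
  obtain k where "v = int (Suc t) + (2 * int n + 4) * k"
    using bij_betw_imp_surj_on[OF bij_betw_residue_class, of t n] assms(2) by blast
  then show ?thesis using level_theta_exponent_nonneg[of "Suc t" n k] assms(1) by (simp only: class_exponent_eq)
qed

lemma rhs_exponent_eq_sum:
  assumes "v \<in> congruent_vecs n"
  shows "rhs_exponent n v = (\<Sum>t=1..n. class_exponent n t (v t))"
proof -
  have "4 * (int n + 2) * class_exponent n t (v t) = (v t)\<^sup>2 - (rho_star t + 1)\<^sup>2" if "t \<in> {1..n}" for t
  proof -
    have "v t \<in> residue_class n t" using assms that by (auto simp: congruent_vecs_eq_PiE)
    then obtain k where k: "v t = int (Suc t) + (2 * int n + 4) * k"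
      using bij_betw_imp_surj_on[OF bij_betw_residue_class, of t n] by blast
    show ?thesis unfolding k class_exponent_eq by (simp add: rho_star_def power2_eq_square algebra_simps)
  qed
  then have "4 * (int n + 2) * (\<Sum>t=1..n. class_exponent n t (v t)) = norm_sq n v - norm_sq n (\<lambda>i. rho_star i + 1)"
    unfolding norm_sq_def sum_distrib_left sum_subtractf[symmetric] by (intro sum.cong) auto
  also have "\<dots> = 4 * (int n + 2) * rhs_exponent n v" by (rule rhs_exponent_exact[OF assms, symmetric])
  finally show ?thesis by simp
qed

text \<open>In the Leibniz expansion of the determinant in \<open>chi\<close> each permutation gives
  a product over coordinates, whose sum is a product of level theta series. Recombining the
  permutations gives the determinant \<open>theta_minor\<close>.\<close>

lemma bosonic_sum:
  assumes q: "norm q < 1"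
  shows "((\<lambda>v. chi n v rho_star * q powi rhs_exponent n v) has_sum theta_minor n q / vandermonde_C n) (congruent_vecs n)"
proof -
  let ?S = "{\<pi>. \<pi> permutes {0..<n}}"
  let ?f = "\<lambda>\<pi> t v. of_int v ^ (2 * \<pi> (t - 1) + 1) * q ^ nat (class_exponent n t v)"
  have f: "(?f \<pi> t has_sum level_theta n (Suc t) (2 * \<pi> (t - 1) + 1) q) (residue_class n t)" if "t \<in> {1..n}" for \<pi> t
    using that q by (intro residue_class_level_theta) auto
  have fabs: "(\<lambda>v. norm (?f \<pi> t v)) summable_on residue_class n t" if "t \<in> {1..n}" for \<pi> t
    using has_sum_imp_summable[OF f[OF that]] by (simp only: summable_on_iff_abs_summable_on_complex)
  have P: "((\<lambda>v. \<Prod>t=1..n. ?f \<pi> t (v t)) has_sum (\<Prod>t=1..n. level_theta n (Suc t) (2 * \<pi> (t - 1) + 1) q)) (congruent_vecs n)" for \<pi>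
  proof -
    have "Infinite_Set_Sum.abs_summable_on (\<lambda>v. \<Prod>t=1..n. ?f \<pi> t (v t)) (PiE {1..n} (residue_class n))"
      by (rule abs_summable_on_prod_PiE) (use fabs in \<open>auto simp flip: abs_summable_equivalent\<close>)
    then have "(\<lambda>v. norm (\<Prod>t=1..n. ?f \<pi> t (v t))) summable_on PiE {1..n} (residue_class n)"
      by (simp flip: abs_summable_equivalent)
    then have "(\<lambda>v. \<Prod>t=1..n. ?f \<pi> t (v t)) summable_on PiE {1..n} (residue_class n)"
      by (rule abs_summable_summable)
    moreover have "(\<Sum>\<^sub>\<infinity>v\<in>PiE {1..n} (residue_class n). \<Prod>t=1..n. ?f \<pi> t (v t))
        = (\<Prod>t=1..n. infsum (?f \<pi> t) (residue_class n t))"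
      by (rule infsum_prod_PiE_abs) (use fabs in auto)
    moreover have "\<dots> = (\<Prod>t=1..n. level_theta n (Suc t) (2 * \<pi> (t - 1) + 1) q)"
      by (intro prod.cong refl infsumI f)
    ultimately show ?thesis unfolding congruent_vecs_eq_PiE by (simp add: has_sum_iff)
  qed
  have "((\<lambda>v. \<Sum>\<pi>\<in>?S. signof \<pi> * (\<Prod>t=1..n. ?f \<pi> t (v t))) has_sum
     (\<Sum>\<pi>\<in>?S. signof \<pi> * (\<Prod>t=1..n. level_theta n (Suc t) (2 * \<pi> (t - 1) + 1) q))) (congruent_vecs n)"
    by (rule has_sum_sum[OF finite_permutations has_sum_cmult_right[OF P]]) simp
  moreover have shift: "(\<Prod>t=1..n. g t) = (\<Prod>i=0..<n. g (Suc i))" for g :: "nat \<Rightarrow> complex"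
    by (rule prod.reindex_bij_witness[of _ Suc "\<lambda>t. t - 1"]) auto
  have det: "det (mat n n (\<lambda>(i, j). B i j)) = (\<Sum>\<pi>\<in>?S. signof \<pi> * (\<Prod>i=0..<n. B i (\<pi> i)))" for B :: "nat \<Rightarrow> nat \<Rightarrow> complex"
    by (subst det_def'[OF mat_carrier]) (auto intro!: sum.cong prod.cong simp: permutes_in_image)
  have "(\<Sum>\<pi>\<in>?S. signof \<pi> * (\<Prod>t=1..n. level_theta n (Suc t) (2 * \<pi> (t - 1) + 1) q)) = theta_minor n q"
    unfolding shift theta_minor_def det by simp
  ultimately have "((\<lambda>v. \<Sum>\<pi>\<in>?S. signof \<pi> * (\<Prod>t=1..n. ?f \<pi> t (v t))) has_sum theta_minor n q) (congruent_vecs n)"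
    by (simp only:)
  then have hs: "((\<lambda>v. 1 / vandermonde_C n * (\<Sum>\<pi>\<in>?S. signof \<pi> * (\<Prod>t=1..n. ?f \<pi> t (v t)))) has_sum 1 / vandermonde_C n * theta_minor n q) (congruent_vecs n)"
    by (rule has_sum_cmult_right)
  have eq: "1 / vandermonde_C n * (\<Sum>\<pi>\<in>?S. signof \<pi> * (\<Prod>t=1..n. ?f \<pi> t (v t))) = chi n v rho_star * q powi rhs_exponent n v"
    if v: "v \<in> congruent_vecs n" for v
  proof -
    have nn: "0 \<le> class_exponent n t (v t)" if "t \<in> {1..n}" for t
      using that v by (intro class_exponent_nonneg) (auto simp: congruent_vecs_eq_PiE)
    have "(\<Prod>t=1..n. q ^ nat (class_exponent n t (v t))) = q ^ (\<Sum>t=1..n. nat (class_exponent n t (v t)))"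
      by (rule power_sum[symmetric])
    also have "(\<Sum>t=1..n. nat (class_exponent n t (v t))) = nat (rhs_exponent n v)"
    proof -
      have "int (\<Sum>t=1..n. nat (class_exponent n t (v t))) = rhs_exponent n v"
        unfolding rhs_exponent_eq_sum[OF v] of_nat_sum using nn by (intro sum.cong) auto
      then show ?thesis by (metis nat_int)
    qed
    also have "q ^ nat (rhs_exponent n v) = q powi rhs_exponent n v"
    proof -
      have "0 \<le> rhs_exponent n v" unfolding rhs_exponent_eq_sum[OF v] using nn by (rule sum_nonneg)
      then show ?thesis by (simp add: power_int_def)
    qed
    finally have e: "(\<Prod>t=1..n. q ^ nat (class_exponent n t (v t))) = q powi rhs_exponent n v" .
    have "(\<Sum>\<pi>\<in>?S. signof \<pi> * (\<Prod>t=1..n. ?f \<pi> t (v t)))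
        = (\<Sum>\<pi>\<in>?S. signof \<pi> * (\<Prod>i=0..<n. of_int (v (Suc i)) ^ (2 * \<pi> i + 1))) * q powi rhs_exponent n v"
      unfolding prod.distrib e shift[of "\<lambda>t. of_int (v t) ^ (2 * _ (t - 1) + 1)"] sum_distrib_right
      by (simp add: mult.assoc)
    also have "(\<Sum>\<pi>\<in>?S. signof \<pi> * (\<Prod>i=0..<n. of_int (v (Suc i)) ^ (2 * \<pi> i + 1)))
        = (det (mat n n (\<lambda>(i, j). of_int (v (Suc i)) ^ (2 * j + 1))) :: complex)"
      by (rule det[of "\<lambda>i j. of_int (v (Suc i)) ^ (2 * j + 1)", symmetric])
    finally show ?thesis unfolding chi_rho_star by simp
  qed
  show ?thesis using has_sum_cong[THEN iffD1, OF eq hs] by simp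
qed

section \<open>Continuity at q = 0 and the conclusion\<close>

lemma qpoch_vec_nonzero: "norm q < 1 \<Longrightarrow> qpoch_vec k q m \<noteq> 0"
  by (simp add: qpoch_vec_def)

text \<open>On |q| <= r each summand is largest in modulus at the real point r: the exponent is
  nonnegative and |1 - q^i| >= 1 - r^i. One summable series thus dominates on the whole
  disc.\<close>

lemma fermionic_term_bound:
  fixes q :: complex and r :: real
  assumes "norm q \<le> r" "r < 1"
  shows "norm (q powi lhs_exponent (2 * n) m / qpoch_vec (2 * n) q m)
     \<le> norm (of_real r powi lhs_exponent (2 * n) m / qpoch_vec (2 * n) (of_real r) m)"
proof -
  have r0: "0 \<le> r" using assms(1) norm_ge_zero order_trans by blast
  have "norm (q powi lhs_exponent (2 * n) m) \<le> norm (complex_of_real r powi lhs_exponent (2 * n) m)"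
    using lhs_exponent_nonneg[of n m] assms(1) r0 by (simp add: norm_power_int power_int_def power_mono norm_power)
  moreover have "norm (qpoch_vec (2 * n) (of_real r) m) \<le> norm (qpoch_vec (2 * n) q m)"
  proof -
    have "norm (1 - complex_of_real r * of_real r ^ i) \<le> norm (1 - q * q ^ i)" for i
    proof -
      have "norm (1 - complex_of_real r * of_real r ^ i) = \<bar>1 - r ^ Suc i\<bar>"
        by (metis norm_of_real of_real_1 of_real_diff of_real_mult of_real_power power_Suc)
      also have "\<dots> = 1 - r ^ Suc i" using r0 assms(2) by (simp add: power_le_one del: power_Suc)
      also have "\<dots> \<le> 1 - norm (q ^ Suc i)"
        unfolding norm_power using power_mono[OF assms(1) norm_ge_zero, of "Suc i"] by simp
      also have "\<dots> \<le> norm (1 - q ^ Suc i)" using norm_triangle_ineq2[of 1 "q ^ Suc i"] by simp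
      finally show ?thesis by simp
    qed
    then show ?thesis
      unfolding qpoch_vec_def qpoch_eq_lessThan prod_norm[symmetric] by (intro prod_mono conjI norm_ge_zero) (auto intro!: prod_nonneg)
  qed
  moreover have "0 < norm (qpoch_vec (2 * n) (of_real r) m)"
    using qpoch_vec_nonzero[of "of_real r"] r0 assms(2) by simp
  ultimately show ?thesis unfolding norm_divide by (intro frac_le) auto
qed

lemma fermionic_sum_0:
  "((\<lambda>m. 0 powi lhs_exponent (2 * n) m / qpoch_vec (2 * n) 0 m) has_sum
     theta_minor n 0 / (vandermonde_C n * qpoch_inf 0 0 ^ (2 * n\<^sup>2 + n))) (nat_vecs (2 * n))"
proof -
  let ?F = "\<lambda>m q. q powi lhs_exponent (2 * n) m / qpoch_vec (2 * n) q m"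
  let ?R = "\<lambda>q. theta_minor n q / (vandermonde_C n * qpoch_inf q q ^ (2 * n\<^sup>2 + n))"
  define L where "L q = (\<Sum>\<^sub>\<infinity>m\<in>nat_vecs (2 * n). ?F m q)" for q
  \<comment> \<open>The majorant is the series at the real point 1/2, where the identity for nonzero
    q already gives summability.\<close>
  have M: "(\<lambda>m. norm (?F m (of_real (1 / 2)))) summable_on nat_vecs (2 * n)"
    using has_sum_imp_summable[OF fermionic_sum_eq_minor[of "of_real (1 / 2)" n]]
    by (simp add: summable_on_iff_abs_summable_on_complex)
  have bound: "norm (?F m q) \<le> norm (?F m (of_real (1 / 2)))" if "q \<in> cball 0 (1 / 2)" for m q
    using that by (intro fermionic_term_bound) auto
  have S: "(\<lambda>m. ?F m 0) summable_on nat_vecs (2 * n)"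
    by (rule summable_on_dominated[OF M bound]) simp
  have "uniform_limit (cball 0 (1 / 2)) (\<lambda>X q. \<Sum>m\<in>X. ?F m q) L (finite_subsets_at_top (nat_vecs (2 * n)))"
    unfolding L_def
  proof (rule Weierstrass_m_test_general[where M = "\<lambda>m. norm (?F m (of_real (1 / 2)))"])
    fix m and q :: complex assume "q \<in> cball 0 (1 / 2)"
    then show "norm (?F m q) \<le> norm (?F m (of_real (1 / 2)))" by (rule bound)
  qed (rule M)
  moreover have "continuous_on (cball 0 (1 / 2)) (?F m)" for m
  proof -
    have "continuous_on (cball 0 (1 / 2)) (\<lambda>q. q ^ nat (lhs_exponent (2 * n) m) / qpoch_vec (2 * n) q m)"
      unfolding qpoch_vec_def qpoch_eq_lessThan
    proof (rule continuous_on_divide)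
      show "\<forall>q\<in>cball 0 (1 / 2). (\<Prod>i=1..2 * n. \<Prod>i<m i. 1 - q * q ^ i) \<noteq> (0 :: complex)"
        using qpoch_vec_nonzero[of _ "2 * n" m] unfolding qpoch_vec_def qpoch_eq_lessThan by simp
    qed (intro continuous_intros)+
    then show ?thesis using lhs_exponent_nonneg[of n m] by (simp add: power_int_def)
  qed
  then have "\<forall>\<^sub>F X in finite_subsets_at_top (nat_vecs (2 * n)). continuous_on (cball 0 (1 / 2)) (\<lambda>q. \<Sum>m\<in>X. ?F m q)"
    by (intro always_eventually allI continuous_on_sum)
  ultimately have contL: "continuous_on (cball 0 (1 / 2)) L"
    by (intro uniform_limit_theorem[where F = "finite_subsets_at_top (nat_vecs (2 * n))"]) auto
  have minor: "theta_minor n q = (\<Sum>\<pi> | \<pi> permutes {0..<n}. signof \<pi> * (\<Prod>i=0..<n. level_theta n (i + 2) (2 * \<pi> i + 1) q))" for q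
    unfolding theta_minor_def
    by (subst det_def'[OF mat_carrier]) (auto simp: permutes_in_image intro!: sum.cong prod.cong)
  have "continuous_on (ball 0 1) (level_theta n (i + 2) j)" if "i \<in> {0..<n}" for i j
    using that by (intro holomorphic_on_imp_continuous_on level_theta_holomorphic) auto
  then have "continuous_on (ball 0 1) (theta_minor n)"
    unfolding minor[abs_def]
    by (intro continuous_on_sum continuous_on_mult continuous_on_const continuous_on_prod) auto
  then have contR: "continuous_on (ball 0 1) ?R"
    using holomorphic_on_imp_continuous_on[OF qpoch_inf_holomorphic] vandermonde_C_nonzero[of n]
    by (intro continuous_on_divide continuous_on_mult continuous_on_power continuous_on_const) auto
  have lims: "(L \<longlongrightarrow> L 0) (at 0)" "(?R \<longlongrightarrow> ?R 0) (at 0)"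
    using continuous_on_interior[OF contL, of 0] continuous_on_interior[OF contR, of 0]
    by (simp_all add: isCont_def)
  have ev: "\<forall>\<^sub>F q in at 0. L q = ?R q"
  proof (rule eventually_at_ball'[of 1 0 UNIV, THEN eventually_mono])
    fix q :: complex assume "q \<in> ball 0 1 \<and> q \<noteq> 0 \<and> q \<in> UNIV"
    then show "L q = ?R q" unfolding L_def by (intro infsumI fermionic_sum_eq_minor) auto
  qed simp
  have "L 0 = ?R 0"
    by (rule LIM_unique[OF Lim_transform_eventually[OF lims(1) ev] lims(2)])
  then show ?thesis using has_sum_infsum[OF S] by (simp add: L_def)
qed

theorem theorem2p3:
  fixes n N :: nat and q :: complex
  assumes "n \<ge> 1" and "N = 2 * n + 1" and "norm q < 1"
  shows "(\<lambda>m. q powi lhs_exponent (N - 1) m / qpoch_vec (N - 1) q m)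
           summable_on nat_vecs (N - 1) \<and>
         (\<lambda>v. chi n v rho_star * q powi rhs_exponent n v) summable_on congruent_vecs n \<and>
         (\<Sum>\<^sub>\<infinity>m\<in>nat_vecs (N - 1). q powi lhs_exponent (N - 1) m / qpoch_vec (N - 1) q m) =
         1 / qpoch_inf q q ^ (2 * n\<^sup>2 + n) *
         (\<Sum>\<^sub>\<infinity>v\<in>congruent_vecs n. chi n v rho_star * q powi rhs_exponent n v)"
proof -
  have N: "N - 1 = 2 * n" using assms(2) by simp
  have L: "((\<lambda>m. q powi lhs_exponent (2 * n) m / qpoch_vec (2 * n) q m) has_sum
     theta_minor n q / (vandermonde_C n * qpoch_inf q q ^ (2 * n\<^sup>2 + n))) (nat_vecs (2 * n))"
  proof (cases "q = 0")
    case True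
    show ?thesis unfolding True by (rule fermionic_sum_0)
  qed (rule fermionic_sum_eq_minor[OF assms(3)])
  note R = bosonic_sum[OF assms(3), of n]
  show ?thesis
    unfolding N infsumI[OF L] infsumI[OF R]
    using has_sum_imp_summable[OF L] has_sum_imp_summable[OF R] by (intro conjI) simp_all
qed

end
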